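(* Let $X=(X_i)_{i\ge 1}$ be any version of an infinite system of competing Brownian particles with drift coefficients $g_1,g_2,\ldots\in\mathbb{R}$ and diffusion coefficients $\sigma_1^2,\sigma_2^2,\ldots$ (with $\sigma_k>0$) satisfying $$\sup_{k\ge 1}|g_k|<\infty\quad\text{and}\quad \sup_{k\ge 1}\sigma_k^2<\infty,$$ and with initial configuration $X(0)=x=(x_i)_{i\ge 1}$ satisfying $$\sum_{i=1}^\infty e^{-\alpha x_i^2}<\infty\quad\text{for all }\alpha>0.$$ Let $n\ge 4$ be an integer and assume $$\sup_{k\ge 1}\sigma_k^2<\frac{n-1}{2}\inf_{k\ge 1}\sigma_k^2.$$ Then there are no $n$-tuple collisions in this system.
   Context: Infinite system of competing Brownian particles: let $(X_i)_{i\ge 1}$ be a sequence of continuous, adapted, real-valued processes $X_i=(X_i(t),t\ge 0)$ on a filtered probability space $(\Omega,\mathcal{F},(\mathcal{F}_t)_{t\ge 0},\mathbf{P})$ with the filtration satisfying the usual conditions. Assume that for every $t\ge 0$ the values $X_i(t)$, $i=1,2,\ldots$, can be ranked from the bottom upward, $X_{(1)}(t)\le X_{(2)}(t)\le\cdots$, ties being resolved in lexicographic order. That is, there is a bijection $\mathbf{p}_t:\{1,2,\ldots\}\to\{1,2,\ldots\}$ with $X_{\mathbf{p}_t(i)}(t)\le X_{\mathbf{p}_t(j)}(t)$ for $i<j$, and $\mathbf{p}_t(i)<\mathbf{p}_t(j)$ whenever $i<j$ and $X_{\mathbf{p}_t(i)}(t)=X_{\mathbf{p}_t(j)}(t)$;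 the particle $X_{\mathbf{p}_t(k)}$ is said to have rank $k$ at time $t$. Fix $g_k\in\mathbb{R}$ and $\sigma_k>0$ for $k=1,2,\ldots$, and i.i.d. Brownian motions $W_1,W_2,\ldots$ (with respect to the filtration). If $$\mathrm{d}X_i(t)=\sum_{k=1}^\infty 1(X_i\text{ has rank }k\text{ at time }t)\,(g_k\,\mathrm{d}t+\sigma_k\,\mathrm{d}W_i(t)),\qquad i=1,2,\ldots,$$ then $X=(X(t),t\ge 0)$, $X(t)=(X_i(t))_{i\ge 1}$, is called an infinite system of competing Brownian particles with drift coefficients $g_1,g_2,\ldots$ and diffusion coefficients $\sigma_1^2,\sigma_2^2,\ldots$. The $k$th ranked particle is $Y_k(t):=X_{(k)}(t)=X_{\mathbf{p}_t(k)}(t)$. No $n$-tuple collisions: for every pair of ranks $1\le k_-<k_+$ with $k_+-k_-=n-1$, $\mathbf{P}(\exists\,t>0:\ Y_{k_-}(t)=\cdots=Y_{k_+}(t))=0$; equivalently, for every set $\{i_1,\ldots,i_n\}$ of $n$ distinct positive integers, $\mathbf{P}(\exists\,t>0:\ X_{i_1}(t)=\cdots=X_{i_n}(t))=0$. *)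

theory Defs
  imports "HOL-Probability.Probability"
begin

text \<open>Particles and ranks are indexed by \<open>0, 1, 2, \<dots>\<close> instead of \<open>1, 2, 3, \<dots>\<close>.
  Processes are indexed by \<open>real\<close>; only times \<open>t \<ge> 0\<close> are ever used, and a filtration
  \<open>(F\<^sub>t)\<close> given for \<open>t \<ge> 0\<close> may be continued by \<open>F\<^sub>0\<close> to negative times.\<close>

locale usual_filtration = prob_space M + filtration "space M" F
  for M :: "'a measure" and F :: "real \<Rightarrow> 'a measure" +
  assumes sets_F_subset: "\<And>t. sets (F t) \<subseteq> sets M"
    and right_continuous: "\<And>t. 0 \<le> t \<Longrightarrow> (\<Inter>u\<in>{t<..}. sets (F u)) = sets (F t)"
    and null_subset_in_F: "\<And>N A. N \<in> null_sets M \<Longrightarrow> A \<subseteq> N \<Longrightarrow> A \<in> sets (F 0)"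

definition adapted :: "(real \<Rightarrow> 'a measure) \<Rightarrow> (real \<Rightarrow> 'a \<Rightarrow> real) \<Rightarrow> bool" where
  "adapted F Z \<longleftrightarrow> (\<forall>t\<ge>0. Z t \<in> borel_measurable (F t))"

definition continuous_paths :: "'a measure \<Rightarrow> (real \<Rightarrow> 'a \<Rightarrow> real) \<Rightarrow> bool" where
  "continuous_paths M Z \<longleftrightarrow> (\<forall>\<omega>\<in>space M. continuous_on {0..} (\<lambda>t. Z t \<omega>))"

definition progressive :: "(real \<Rightarrow> 'a measure) \<Rightarrow> (real \<Rightarrow> 'a \<Rightarrow> real) \<Rightarrow> bool" where
  "progressive F H \<longleftrightarrow> (\<forall>t\<ge>0.
     (\<lambda>(s, \<omega>). H s \<omega>) \<in> borel_measurable (restrict_space borel {0..t} \<Otimes>\<^sub>M F t))"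

definition brownian_motion ::
  "'a measure \<Rightarrow> (real \<Rightarrow> 'a measure) \<Rightarrow> (real \<Rightarrow> 'a \<Rightarrow> real) \<Rightarrow> bool" where
  "brownian_motion M F W \<longleftrightarrow>
     adapted F W \<and> continuous_paths M W \<and> (AE \<omega> in M. W 0 \<omega> = 0) \<and>
     (\<forall>s t. 0 \<le> s \<and> s < t \<longrightarrow>
        distributed M lborel (\<lambda>\<omega>. W t \<omega> - W s \<omega>) (normal_density 0 (sqrt (t - s))) \<and>
        prob_space.indep_set M (sets (F s))
          (sets (vimage_algebra (space M) (\<lambda>\<omega>. W t \<omega> - W s \<omega>) borel)))"

definition independent_processes :: "'a measure \<Rightarrow> (nat \<Rightarrow> real \<Rightarrow> 'a \<Rightarrow> real) \<Rightarrow> bool" where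
  "independent_processes M W \<longleftrightarrow>
     prob_space.indep_vars M (\<lambda>_. PiM {0..} (\<lambda>_. borel)) (\<lambda>i \<omega>. \<lambda>t\<in>{0..}. W i t \<omega>) UNIV"

text \<open>The simple process \<open>\<Sum>j<m. 1(\<tau>\<^sub>j < t \<le> \<tau>\<^sub>j\<^sub>+\<^sub>1) \<xi>\<^sub>j\<close> with each \<open>\<xi>\<^sub>j\<close> bounded and
  \<open>F(\<tau>\<^sub>j)\<close>-measurable, and its elementary stochastic integral.\<close>

definition simple_data ::
  "(real \<Rightarrow> 'a measure) \<Rightarrow> nat \<Rightarrow> (nat \<Rightarrow> real) \<Rightarrow> (nat \<Rightarrow> 'a \<Rightarrow> real) \<Rightarrow> bool" where
  "simple_data F m \<tau> \<xi> \<longleftrightarrow> 0 \<le> \<tau> 0 \<and> mono \<tau> \<and>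
     (\<forall>j<m. \<xi> j \<in> borel_measurable (F (\<tau> j)) \<and>
            (\<exists>B. \<forall>\<omega>\<in>space (F (\<tau> j)). \<bar>\<xi> j \<omega>\<bar> \<le> B))"

definition simple_process ::
  "nat \<Rightarrow> (nat \<Rightarrow> real) \<Rightarrow> (nat \<Rightarrow> 'a \<Rightarrow> real) \<Rightarrow> real \<Rightarrow> 'a \<Rightarrow> real" where
  "simple_process m \<tau> \<xi> t \<omega> = (\<Sum>j<m. indicator {\<tau> j<..\<tau> (Suc j)} t * \<xi> j \<omega>)"

definition simple_integral ::
  "nat \<Rightarrow> (nat \<Rightarrow> real) \<Rightarrow> (nat \<Rightarrow> 'a \<Rightarrow> real) \<Rightarrow> (real \<Rightarrow> 'a \<Rightarrow> real) \<Rightarrow> real \<Rightarrow> 'a \<Rightarrow> real" where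
  "simple_integral m \<tau> \<xi> W t \<omega> =
     (\<Sum>j<m. \<xi> j \<omega> * (W (min t (\<tau> (Suc j))) \<omega> - W (min t (\<tau> j)) \<omega>))"

definition null_in_probability :: "'a measure \<Rightarrow> (nat \<Rightarrow> 'a \<Rightarrow> ennreal) \<Rightarrow> bool" where
  "null_in_probability M Z \<longleftrightarrow>
     (\<forall>\<epsilon>>0. (\<lambda>n. measure M {\<omega>\<in>space M. ennreal \<epsilon> < Z n \<omega>}) \<longlonglongrightarrow> 0)"

text \<open>The process \<open>I\<close> is a continuous version of the Ito integral \<open>\<integral> H dW\<close>. The integral is
  characterised, uniquely up to indistinguishability, as the limit in probability of
  elementary integrals of simple processes approximating \<open>H\<close>.\<close>

definition ito_integral ::
  "'a measure \<Rightarrow> (real \<Rightarrow> 'a measure) \<Rightarrow> (real \<Rightarrow> 'a \<Rightarrow> real) \<Rightarrow> (real \<Rightarrow> 'a \<Rightarrow> real)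
    \<Rightarrow> (real \<Rightarrow> 'a \<Rightarrow> real) \<Rightarrow> bool" where
  "ito_integral M F H W I \<longleftrightarrow>
     progressive F H \<and>
     (\<forall>t\<ge>0. AE \<omega> in M. (\<integral>\<^sup>+s\<in>{0..t}. ennreal ((H s \<omega>)\<^sup>2) \<partial>lborel) < \<infinity>) \<and>
     adapted F I \<and> continuous_paths M I \<and>
     (\<exists>m \<tau> \<xi>. (\<forall>n. simple_data F (m n) (\<tau> n) (\<xi> n)) \<and>
        (\<forall>t\<ge>0.
           null_in_probability M (\<lambda>n \<omega>. \<integral>\<^sup>+s\<in>{0..t}.
             ennreal ((simple_process (m n) (\<tau> n) (\<xi> n) s \<omega> - H s \<omega>)\<^sup>2) \<partial>lborel) \<and>
           null_in_probability M (\<lambda>n \<omega>.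
             ennreal \<bar>simple_integral (m n) (\<tau> n) (\<xi> n) W t \<omega> - I t \<omega>\<bar>)))"

definition is_ranking :: "(nat \<Rightarrow> real) \<Rightarrow> (nat \<Rightarrow> nat) \<Rightarrow> bool" where
  "is_ranking x p \<longleftrightarrow> bij p \<and>
     (\<forall>i j. i < j \<longrightarrow> x (p i) \<le> x (p j)) \<and>
     (\<forall>i j. i < j \<and> x (p i) = x (p j) \<longrightarrow> p i < p j)"

definition rankable :: "(nat \<Rightarrow> real) \<Rightarrow> bool" where
  "rankable x \<longleftrightarrow> (\<exists>p. is_ranking x p)"

definition ranking :: "(nat \<Rightarrow> real) \<Rightarrow> nat \<Rightarrow> nat" where
  "ranking x = (THE p. is_ranking x p)"

lemma is_ranking_unique:
  assumes p: "is_ranking x p" and q: "is_ranking x q"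
  shows "p = q"
proof -
  have mono: "strict_mono (\<lambda>i. inv q' (p' i))" if p': "is_ranking x p'" and q': "is_ranking x q'"
    for p' q'
  proof (rule strict_monoI)
    fix i j :: nat assume ij: "i < j"
    have q_inv: "q' (inv q' a) = a" for a
      using q' by (simp add: is_ranking_def bij_is_surj surj_f_inv_f)
    have ne: "p' i \<noteq> p' j"
      using p' ij by (metis is_ranking_def bij_pointE less_irrefl)
    show "inv q' (p' i) < inv q' (p' j)"
    proof (rule ccontr)
      assume "\<not> inv q' (p' i) < inv q' (p' j)"
      moreover have "inv q' (p' i) \<noteq> inv q' (p' j)" using ne q_inv by metis
      ultimately have lt: "inv q' (p' j) < inv q' (p' i)" by simp
      have le: "x (p' j) \<le> x (p' i)" using q' lt unfolding is_ranking_def by (metis q_inv)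
      have "x (p' i) \<le> x (p' j)" using p' ij unfolding is_ranking_def by blast
      with le have eq: "x (p' i) = x (p' j)" by simp
      then have "p' i < p' j" using p' ij unfolding is_ranking_def by blast
      moreover have "p' j < p' i" using q' lt eq unfolding is_ranking_def by (metis q_inv)
      ultimately show False by simp
    qed
  qed
  have bp: "bij p" and bq: "bij q" using p q by (auto simp: is_ranking_def)
  show ?thesis
  proof
    fix i
    have 1: "i \<le> inv q (p i)" using strict_mono_imp_increasing[OF mono[OF p q]] by simp
    have "inv q (p i) \<le> inv p (q (inv q (p i)))"
      using strict_mono_imp_increasing[OF mono[OF q p]] by simp
    also have "\<dots> = i" using bp bq by (simp add: bij_is_surj surj_f_inv_f bij_is_inj)
    finally have "inv q (p i) = i" using 1 by simp
    then show "p i = q i" using bq by (metis bij_is_surj surj_f_inv_f)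
  qed
qed

lemma ranking_eqI: "is_ranking x p \<Longrightarrow> ranking x = p"
  unfolding ranking_def using is_ranking_unique by blast

definition has_rank :: "(nat \<Rightarrow> real \<Rightarrow> 'a \<Rightarrow> real) \<Rightarrow> nat \<Rightarrow> nat \<Rightarrow> real \<Rightarrow> 'a \<Rightarrow> bool" where
  "has_rank X i k t \<omega> \<longleftrightarrow> ranking (\<lambda>j. X j t \<omega>) k = i"

definition ranked :: "(nat \<Rightarrow> real \<Rightarrow> 'a \<Rightarrow> real) \<Rightarrow> nat \<Rightarrow> real \<Rightarrow> 'a \<Rightarrow> real" where
  "ranked X k t \<omega> = X (ranking (\<lambda>j. X j t \<omega>) k) t \<omega>"

text \<open>The coefficient \<open>\<Sum>k. 1(X\<^sub>i has rank k at time t) c\<^sub>k\<close>; at most one summand is nonzero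
  when the configuration is rankable.\<close>

definition rank_coeff ::
  "(nat \<Rightarrow> real \<Rightarrow> 'a \<Rightarrow> real) \<Rightarrow> (nat \<Rightarrow> real) \<Rightarrow> nat \<Rightarrow> real \<Rightarrow> 'a \<Rightarrow> real" where
  "rank_coeff X c i t \<omega> = (\<Sum>k. of_bool (has_rank X i k t \<omega>) * c k)"

text \<open>Here \<open>\<sigma>\<close> lists the \<open>\<sigma>\<^sub>k\<close>, so that the diffusion coefficients are \<open>\<sigma>\<^sub>k\<^sup>2\<close>.\<close>

definition competing_brownian_particles ::
  "'a measure \<Rightarrow> (real \<Rightarrow> 'a measure) \<Rightarrow> (nat \<Rightarrow> real) \<Rightarrow> (nat \<Rightarrow> real)
    \<Rightarrow> (nat \<Rightarrow> real \<Rightarrow> 'a \<Rightarrow> real) \<Rightarrow> (nat \<Rightarrow> real \<Rightarrow> 'a \<Rightarrow> real) \<Rightarrow> bool" where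
  "competing_brownian_particles M F g \<sigma> W X \<longleftrightarrow>
     usual_filtration M F \<and>
     (\<forall>i. brownian_motion M F (W i)) \<and> independent_processes M W \<and>
     (\<forall>i. adapted F (X i) \<and> continuous_paths M (X i)) \<and>
     (AE \<omega> in M. \<forall>t\<ge>0. rankable (\<lambda>i. X i t \<omega>)) \<and>
     (\<forall>i. \<exists>I. ito_integral M F (rank_coeff X \<sigma> i) (W i) I \<and>
        (AE \<omega> in M. \<forall>t\<ge>0.
           set_integrable lborel {0..t} (\<lambda>s. rank_coeff X g i s \<omega>) \<and>
           X i t \<omega> = X i 0 \<omega> + (LINT s:{0..t}|lborel. rank_coeff X g i s \<omega>) + I t \<omega>))"

definition no_tuple_collisions ::
  "'a measure \<Rightarrow> nat \<Rightarrow> (nat \<Rightarrow> real \<Rightarrow> 'a \<Rightarrow> real) \<Rightarrow> bool" where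
  "no_tuple_collisions M n X \<longleftrightarrow>
     (\<forall>k l. k < l \<and> l - k = n - 1 \<longrightarrow>
        {\<omega>\<in>space M. \<exists>t>0. \<forall>j\<in>{k..l}. ranked X j t \<omega> = ranked X k t \<omega>} \<in> null_sets M)"

end

theory Submission
  imports Defs
begin

text \<open>A collision of ranks is a collision of \<open>n\<close> named particles, and there are only countably many
  choices of names. For \<open>n\<close> named particles let \<open>R\<close> be the sum of the squared deviations from their
  mean. Its drift is at least \<open>(n - 1) inf \<sigma>\<^sup>2 - O(\<surd>R)\<close> and its quadratic variation grows at rate at
  most \<open>4 R sup \<sigma>\<^sup>2\<close>, so under the gap condition, for some small \<open>d > 0\<close>, the function
  \<open>V = (R + e) powr (-d)\<close> satisfies \<open>L V \<le> K V - \<kappa> 1(R = 0)\<close> with \<open>K\<close> independent of \<open>e > 0\<close> and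
  \<open>\<kappa>\<close> of order \<open>e powr (-d - 1)\<close>. The maximal inequality for \<open>exp (-K t) V\<close> and \<open>e \<rightarrow> 0\<close> exclude
  a later collision once \<open>R > 0\<close>. Hence \<open>P(R t = 0)\<close> decreases in \<open>t\<close>, and the killing term bounds
  \<open>t P(R t = 0)\<close> by \<open>O(e)\<close>, so that \<open>R > 0\<close> immediately after time \<open>0\<close>.

  Instead of the Ito formula the second order Taylor expansion over a short time step is used; it
  needs only bounds on the conditional second and on the fourth moments of the increments of the
  Ito integrals, which pass to the limit from elementary integrals.\<close>

section \<open>Brownian increments\<close>

text \<open>The factor (n - 1) / 2 comes from the generator. At order
  \<open>(R + e) powr (-d - 1)\<close> the drift of \<open>R\<close> contributes at most -d (n - 1)
  inf \<sigma>^2 and its quadratic variation at most 2 d (d + 1) sup \<sigma>^2; some d > 0 makes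
  the sum negative exactly when 2 sup \<sigma>^2 < (n - 1) inf \<sigma>^2. Apart from a bound on the
  drifts only these extremal values enter, so the way in which particles exchange ranks needs no
  control. Two obstacles shape the rest. The drift of the particles is not removed by a change of
  measure: its contribution of order sqrt R is absorbed by completing a square, at the price of the
  growth rate K, and it is the independence of K from e that permits e to tend to 0. Moreover the n
  particles may coincide at time 0, where a comparison with the starting value of V says nothing;
  the killing term is there for this case.\<close>

definition L4 :: "'a measure \<Rightarrow> ('a \<Rightarrow> real) \<Rightarrow> bool" where
  "L4 M X \<longleftrightarrow> X \<in> borel_measurable M \<and> integrable M (\<lambda>\<omega>. X \<omega> ^ 4)"

lemma power_le_one_plus_power4:
  fixes x :: real
  assumes "p \<le> 4"
  shows "\<bar>x\<bar> ^ p \<le> 1 + x ^ 4"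
proof (cases "\<bar>x\<bar> \<le> 1")
  case True
  then have "\<bar>x\<bar> ^ p \<le> 1" by (simp add: power_le_one)
  moreover have "0 \<le> x ^ 4" by simp
  ultimately show ?thesis by linarith
next
  case False
  then have "\<bar>x\<bar> ^ p \<le> \<bar>x\<bar> ^ 4" using assms by (intro power_increasing) auto
  then show ?thesis by (simp add: power_even_abs)
qed

lemma power4_add_le: "(a + b) ^ 4 \<le> 8 * a ^ 4 + 8 * b ^ 4" for a b :: real
proof -
  have 1: "(x + y)\<^sup>2 \<le> 2 * (x\<^sup>2 + y\<^sup>2)" for x y :: real
    using sum_squares_bound[of x y] by (simp add: power2_sum)
  have "(a + b) ^ 4 = ((a + b)\<^sup>2)\<^sup>2" by simp
  also have "\<dots> \<le> (2 * (a\<^sup>2 + b\<^sup>2))\<^sup>2" by (intro power_mono 1) simp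
  also have "\<dots> = 4 * (a\<^sup>2 + b\<^sup>2)\<^sup>2" by (simp only: power_mult_distrib) simp
  also have "\<dots> \<le> 4 * (2 * ((a\<^sup>2)\<^sup>2 + (b\<^sup>2)\<^sup>2))" by (intro mult_left_mono 1) simp
  finally show ?thesis by simp
qed

lemma Int_stable_vimage: "Int_stable {f -` A \<inter> S |A. A \<in> sets N}"
proof (rule Int_stableI)
  fix a b assume "a \<in> {f -` A \<inter> S |A. A \<in> sets N}" "b \<in> {f -` A \<inter> S |A. A \<in> sets N}"
  then obtain A B where "A \<in> sets N" "B \<in> sets N" "a = f -` A \<inter> S" "b = f -` B \<inter> S" by blast
  then have "A \<inter> B \<in> sets N" "a \<inter> b = f -` (A \<inter> B) \<inter> S" by auto
  then show "a \<inter> b \<in> {f -` A \<inter> S |A. A \<in> sets N}" by blast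
qed

context prob_space
begin

lemma L4_integrable_power: "L4 M X \<Longrightarrow> p \<le> 4 \<Longrightarrow> integrable M (\<lambda>\<omega>. X \<omega> ^ p)"
  unfolding L4_def
  by (rule Bochner_Integration.integrable_bound[where f="\<lambda>\<omega>. 1 + X \<omega> ^ 4"])
     (auto simp: power_abs intro!: AE_I2 power_le_one_plus_power4)

lemma L4_integrable: "L4 M X \<Longrightarrow> integrable M X"
  using L4_integrable_power[of X 1] by simp

lemma L4_integrable_mult:
  assumes X: "L4 M X" and Y: "L4 M Y"
  shows "integrable M (\<lambda>\<omega>. X \<omega> * Y \<omega>)"
proof (rule Bochner_Integration.integrable_bound[where f="\<lambda>\<omega>. (X \<omega>)\<^sup>2 + (Y \<omega>)\<^sup>2"])
  show "integrable M (\<lambda>\<omega>. (X \<omega>)\<^sup>2 + (Y \<omega>)\<^sup>2)"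
    using L4_integrable_power[OF X, of 2] L4_integrable_power[OF Y, of 2] by simp
  show "(\<lambda>\<omega>. X \<omega> * Y \<omega>) \<in> borel_measurable M" using X Y by (auto simp: L4_def)
  have "\<bar>x * y\<bar> \<le> x\<^sup>2 + y\<^sup>2" for x y :: real
  proof -
    have "2 * \<bar>x * y\<bar> \<le> x\<^sup>2 + y\<^sup>2"
      using sum_squares_bound[of "\<bar>x\<bar>" "\<bar>y\<bar>"] by (simp add: abs_mult mult.assoc)
    then show ?thesis using abs_ge_zero[of "x * y"] by linarith
  qed
  then show "AE \<omega> in M. norm (X \<omega> * Y \<omega>) \<le> norm ((X \<omega>)\<^sup>2 + (Y \<omega>)\<^sup>2)" by simp
qed

lemma integrable_bounded_mult:
  fixes X \<zeta> :: "'a \<Rightarrow> real"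
  assumes [measurable]: "\<zeta> \<in> borel_measurable M" and b: "\<And>\<omega>. \<omega> \<in> space M \<Longrightarrow> \<bar>\<zeta> \<omega>\<bar> \<le> b"
    and X: "integrable M X"
  shows "integrable M (\<lambda>\<omega>. \<zeta> \<omega> * X \<omega>)"
proof (rule Bochner_Integration.integrable_bound[where f="\<lambda>\<omega>. b * X \<omega>"])
  show "AE \<omega> in M. norm (\<zeta> \<omega> * X \<omega>) \<le> norm (b * X \<omega>)"
  proof (intro AE_I2)
    fix \<omega> assume "\<omega> \<in> space M"
    then have "\<bar>\<zeta> \<omega>\<bar> * \<bar>X \<omega>\<bar> \<le> \<bar>b\<bar> * \<bar>X \<omega>\<bar>" using b[of \<omega>] by (intro mult_right_mono) auto
    then show "norm (\<zeta> \<omega> * X \<omega>) \<le> norm (b * X \<omega>)" by (simp add: abs_mult)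
  qed
qed (use X in auto)

lemma integrable_bounded:
  fixes X \<zeta> :: "'a \<Rightarrow> real"
  assumes "\<zeta> \<in> borel_measurable M" and b: "\<And>\<omega>. \<omega> \<in> space M \<Longrightarrow> \<bar>\<zeta> \<omega>\<bar> \<le> b"
  shows "integrable M \<zeta>"
  using integrable_bounded_mult[OF assms, of "\<lambda>_. 1"] by simp

lemma L4_bounded_mult:
  assumes \<zeta>: "\<zeta> \<in> borel_measurable M" and b: "\<And>\<omega>. \<omega> \<in> space M \<Longrightarrow> \<bar>\<zeta> \<omega>\<bar> \<le> b"
    and X: "L4 M X"
  shows "L4 M (\<lambda>\<omega>. \<zeta> \<omega> * X \<omega>)"
proof -
  have "integrable M (\<lambda>\<omega>. \<zeta> \<omega> ^ 4 * X \<omega> ^ 4)"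
  proof (rule integrable_bounded_mult[where b="b^4"])
    fix \<omega> assume "\<omega> \<in> space M"
    then show "\<bar>\<zeta> \<omega> ^ 4\<bar> \<le> b ^ 4" using power_mono[OF b[of \<omega>], of 4] by (simp add: power_abs)
  qed (use \<zeta> X in \<open>auto simp: L4_def\<close>)
  then show ?thesis using \<zeta> X by (auto simp: L4_def power_mult_distrib)
qed

lemma L4_add:
  assumes X: "L4 M X" and Y: "L4 M Y"
  shows "L4 M (\<lambda>\<omega>. X \<omega> + Y \<omega>)"
proof -
  have "integrable M (\<lambda>\<omega>. (X \<omega> + Y \<omega>) ^ 4)"
    by (rule Bochner_Integration.integrable_bound[where f="\<lambda>\<omega>. 8 * X \<omega> ^ 4 + 8 * Y \<omega> ^ 4"])
       (use X Y in \<open>auto simp: L4_def power4_add_le intro!: AE_I2\<close>)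
  then show ?thesis using X Y by (auto simp: L4_def)
qed

lemma L4_zero [simp]: "L4 M (\<lambda>_. 0)" by (simp add: L4_def)

end

section \<open>Moments and independence of Brownian increments\<close>

context usual_filtration
begin

lemma space_F_eq [simp]: "space (F t) = space M"
  by (rule space_F)

lemma borel_measurable_F_mono:
  "f \<in> borel_measurable (F s) \<Longrightarrow> s \<le> t \<Longrightarrow> f \<in> borel_measurable (F t)"
  using measurable_mono[of borel borel "F s" "F t"] sets_F_mono[of s t] by auto

lemma borel_measurable_F: "f \<in> borel_measurable (F s) \<Longrightarrow> f \<in> borel_measurable M"
  using measurable_mono[of borel borel "F s" M] sets_F_subset[of s] by auto

lemma bm_measurable: "brownian_motion M F W \<Longrightarrow> 0 \<le> t \<Longrightarrow> W t \<in> borel_measurable (F t)"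
  by (simp add: brownian_motion_def adapted_def)

lemma bm_measurable_M: "brownian_motion M F W \<Longrightarrow> 0 \<le> t \<Longrightarrow> W t \<in> borel_measurable M"
  by (rule borel_measurable_F[OF bm_measurable])

lemma bm_increment_moments:
  assumes W: "brownian_motion M F W" and uv: "0 \<le> u" "u \<le> v"
  defines "\<Delta> \<equiv> \<lambda>\<omega>. W v \<omega> - W u \<omega>"
  shows "integrable M (\<lambda>\<omega>. \<Delta> \<omega> ^ p)"
    and "expectation \<Delta> = 0" and "expectation (\<lambda>\<omega>. \<Delta> \<omega> ^ 2) = v - u"
    and "expectation (\<lambda>\<omega>. \<Delta> \<omega> ^ 3) = 0" and "expectation (\<lambda>\<omega>. \<Delta> \<omega> ^ 4) = 3 * (v - u)\<^sup>2"
proof -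
  have *: "integrable M (\<lambda>\<omega>. \<Delta> \<omega> ^ p) \<and> expectation \<Delta> = 0 \<and> expectation (\<lambda>\<omega>. \<Delta> \<omega> ^ 2) = v - u
    \<and> expectation (\<lambda>\<omega>. \<Delta> \<omega> ^ 3) = 0 \<and> expectation (\<lambda>\<omega>. \<Delta> \<omega> ^ 4) = 3 * (v - u)\<^sup>2"
  \<comment> \<open>\<open>brownian_motion\<close> prescribes the law only for strictly ordered
    times, so the empty increment is treated apart.\<close>
  proof (cases "u = v")
    case True
    then show ?thesis by (simp add: \<Delta>_def)
  next
    case False
    with uv have lt: "u < v" by simp
    then have D: "distributed M lborel \<Delta> (normal_density 0 (sqrt (v - u)))"
      using W uv by (simp add: brownian_motion_def \<Delta>_def)
    have pos: "0 < sqrt (v - u)" using lt by simp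
    have E: "expectation (\<lambda>\<omega>. \<Delta> \<omega> ^ k) = (\<integral>x. normal_density 0 (sqrt (v - u)) x * x ^ k \<partial>lborel)" for k
      using distributed_integral[OF D, of "\<lambda>x. x ^ k"] by simp
    have I: "integrable M (\<lambda>\<omega>. \<Delta> \<omega> ^ p)"
      using distributed_integrable[OF D, of "\<lambda>x. x ^ p"] integrable_normal_moment[OF pos, of 0 p] by simp
    have "expectation \<Delta> = 0"
      using E[of 1] integral_normal_moment_odd[OF pos, of 0 0] by simp
    moreover have "expectation (\<lambda>\<omega>. \<Delta> \<omega> ^ 3) = 0"
      using E[of 3] integral_normal_moment_odd[OF pos, of 0 1] by simp
    moreover have "expectation (\<lambda>\<omega>. \<Delta> \<omega> ^ 2) = v - u"
      using E[of 2] integral_normal_moment_even[OF pos, of 0 1] lt by (simp add: fact_numeral)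
    moreover have "expectation (\<lambda>\<omega>. \<Delta> \<omega> ^ 4) = 3 * (v - u)\<^sup>2"
      using E[of 4] integral_normal_moment_even[OF pos, of 0 2] lt
      by (simp add: fact_numeral power_divide)
    ultimately show ?thesis using I by blast
  qed
  show "integrable M (\<lambda>\<omega>. \<Delta> \<omega> ^ p)"
    and "expectation \<Delta> = 0" and "expectation (\<lambda>\<omega>. \<Delta> \<omega> ^ 2) = v - u"
    and "expectation (\<lambda>\<omega>. \<Delta> \<omega> ^ 3) = 0" and "expectation (\<lambda>\<omega>. \<Delta> \<omega> ^ 4) = 3 * (v - u)\<^sup>2"
    using * by blast+
qed

lemma bm_increment_L4:
  "brownian_motion M F W \<Longrightarrow> 0 \<le> u \<Longrightarrow> u \<le> v \<Longrightarrow> L4 M (\<lambda>\<omega>. W v \<omega> - W u \<omega>)"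
  unfolding L4_def by (intro conjI bm_increment_moments(1) borel_measurable_diff bm_measurable_M) auto

text \<open>An increment after u is independent of the sigma-algebra at u, hence of
  \<open>U\<close>. Conditional expectations given \<open>F u\<close> appear in this development
  only in such tested form, as expectations against multipliers measurable with respect to
  \<open>F u\<close>.\<close>

lemma bm_increment_mult:
  assumes W: "brownian_motion M F W" and uv: "0 \<le> u" "u \<le> v"
    and U: "U \<in> borel_measurable (F u)" "integrable M U"
  shows "integrable M (\<lambda>\<omega>. U \<omega> * (W v \<omega> - W u \<omega>) ^ p)" (is ?int)
    and "expectation (\<lambda>\<omega>. U \<omega> * (W v \<omega> - W u \<omega>) ^ p) =
      expectation U * expectation (\<lambda>\<omega>. (W v \<omega> - W u \<omega>) ^ p)" (is ?eq)
proof -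
  define \<Delta> where "\<Delta> = (\<lambda>\<omega>. W v \<omega> - W u \<omega>)"
  have "?int \<and> ?eq"
  proof (cases "u = v")
    case True
    \<comment> \<open>For p > 0 both sides vanish; for p = 0 the convention 0 ^ 0 = 1 leaves the
      expectation of \<open>U\<close> on both sides.\<close>
    then show ?thesis using U(2) by (cases p) (auto simp: prob_space)
  next
    case False
    with uv have lt: "u < v" by simp
    have [measurable]: "U \<in> borel_measurable M" "\<Delta> \<in> borel_measurable M"
      using borel_measurable_F[OF U(1)] bm_measurable_M[OF W] uv by (auto simp: \<Delta>_def)
    have ind: "indep_set (sets (F u)) (sets (vimage_algebra (space M) \<Delta> borel))"
      using W uv lt by (simp add: brownian_motion_def \<Delta>_def)
    \<comment> \<open>Independence is first checked on preimages of Borel sets;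
      \<open>Int_stable_vimage\<close> then carries it over to the generated sigma-algebras.\<close>
    have *: "indep_set {U -` A \<inter> space M |A. A \<in> sets borel} {(\<lambda>\<omega>. \<Delta> \<omega> ^ p) -` A \<inter> space M |A. A \<in> sets borel}"
    proof (rule indep_setI)
      show "{U -` A \<inter> space M |A. A \<in> sets borel} \<subseteq> events"
        "{(\<lambda>\<omega>. \<Delta> \<omega> ^ p) -` A \<inter> space M |A. A \<in> sets borel} \<subseteq> events" by auto
      fix a b assume a: "a \<in> {U -` A \<inter> space M |A. A \<in> sets borel}"
        and b: "b \<in> {(\<lambda>\<omega>. \<Delta> \<omega> ^ p) -` A \<inter> space M |A. A \<in> sets borel}"
      have "a \<in> sets (F u)" using a measurable_sets[OF U(1)] by auto
      moreover have "b \<in> sets (vimage_algebra (space M) \<Delta> borel)"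
      proof -
        from b obtain A where A: "A \<in> sets borel" "b = (\<lambda>\<omega>. \<Delta> \<omega> ^ p) -` A \<inter> space M" by auto
        have "(\<lambda>x::real. x ^ p) -` A \<in> sets borel"
          using A(1) by (rule measurable_sets_borel[rotated]) simp
        moreover have "b = \<Delta> -` ((\<lambda>x::real. x ^ p) -` A) \<inter> space M" using A(2) by auto
        ultimately show ?thesis by (auto intro: in_vimage_algebra)
      qed
      ultimately show "prob (a \<inter> b) = prob a * prob b" by (rule indep_setD[OF ind])
    qed
    have "indep_var borel U borel (\<lambda>\<omega>. \<Delta> \<omega> ^ p)"
      unfolding indep_var_eq
    proof (intro conjI)
      show "indep_set (sigma_sets (space M) {U -` A \<inter> space M |A. A \<in> sets borel})
        (sigma_sets (space M) {(\<lambda>\<omega>. \<Delta> \<omega> ^ p) -` A \<inter> space M |A. A \<in> sets borel})"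
        by (rule indep_set_sigma_sets[OF *]) (rule Int_stable_vimage)+
    qed auto
    then show ?thesis
      using indep_var_lebesgue_integral[of U "\<lambda>\<omega>. \<Delta> \<omega> ^ p"] indep_var_integrable[of U "\<lambda>\<omega>. \<Delta> \<omega> ^ p"]
        U(2) bm_increment_moments(1)[OF W uv, of p] by (simp add: \<Delta>_def)
  qed
  then show ?int ?eq by auto
qed

lemma bm_increment_orthogonal:
  assumes W: "brownian_motion M F W" and uv: "0 \<le> u" "u \<le> v"
    and U: "U \<in> borel_measurable (F u)" "integrable M U"
  shows "expectation (\<lambda>\<omega>. U \<omega> * (W v \<omega> - W u \<omega>)) = 0"
  using bm_increment_mult(2)[OF assms, of 1] bm_increment_moments(2)[OF W uv] by simp

end

section \<open>Discrete stochastic integrals\<close>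

definition grid_integral ::
  "(nat \<Rightarrow> real) \<Rightarrow> (nat \<Rightarrow> 'a \<Rightarrow> real) \<Rightarrow> (real \<Rightarrow> 'a \<Rightarrow> real) \<Rightarrow> nat \<Rightarrow> 'a \<Rightarrow> real" where
  "grid_integral q h W k \<omega> = (\<Sum>j<k. h j \<omega> * (W (q (Suc j)) \<omega> - W (q j) \<omega>))"

text \<open>Measurability of \<open>h j\<close> at the left end \<open>q j\<close> of its cell is
  predictability. The grid is an infinite sequence that is only nondecreasing, so a finite partition
  can be continued by repeating its last point; empty cells contribute nothing.\<close>

definition grid_data :: "(real \<Rightarrow> 'a measure) \<Rightarrow> (nat \<Rightarrow> real) \<Rightarrow> (nat \<Rightarrow> 'a \<Rightarrow> real) \<Rightarrow> real \<Rightarrow> bool" where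
  "grid_data F q h b \<longleftrightarrow> mono q \<and> 0 \<le> q 0 \<and>
     (\<forall>j. h j \<in> borel_measurable (F (q j)) \<and> (\<forall>\<omega>\<in>space (F (q j)). \<bar>h j \<omega>\<bar> \<le> b))"

context prob_space
begin

text \<open>The variance of the absolute value of \<open>X\<close> is nonnegative.\<close>

lemma expectation_abs_le_sqrt:
  assumes [measurable]: "X \<in> borel_measurable M" and int: "integrable M (\<lambda>\<omega>. (X \<omega>)\<^sup>2)"
  shows "expectation (\<lambda>\<omega>. \<bar>X \<omega>\<bar>) \<le> sqrt (expectation (\<lambda>\<omega>. (X \<omega>)\<^sup>2))"
proof -
  have "integrable M X"
  proof (rule Bochner_Integration.integrable_bound[where f="\<lambda>\<omega>. 1 + (X \<omega>)\<^sup>2"])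
    have "\<bar>x\<bar> \<le> 1 + x\<^sup>2" for x :: real
      using sum_squares_bound[of 1 "\<bar>x\<bar>"] by simp
    then show "AE \<omega> in M. norm (X \<omega>) \<le> norm (1 + (X \<omega>)\<^sup>2)" by simp
  qed (use int in auto)
  then have "0 \<le> expectation (\<lambda>\<omega>. (X \<omega>)\<^sup>2) - (expectation (\<lambda>\<omega>. \<bar>X \<omega>\<bar>))\<^sup>2"
    using variance_eq[of "\<lambda>\<omega>. \<bar>X \<omega>\<bar>"] variance_positive[of "\<lambda>\<omega>. \<bar>X \<omega>\<bar>"] int by simp
  then show ?thesis by (intro real_le_rsqrt) simp
qed

end

context usual_filtration
begin

lemma grid_dataD:
  assumes "grid_data F q h b"
  shows "mono q" "0 \<le> q j" "q j \<le> q (Suc j)" "h j \<in> borel_measurable (F (q j))"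
    "\<omega> \<in> space M \<Longrightarrow> \<bar>h j \<omega>\<bar> \<le> b"
  using assms by (auto simp: grid_data_def monoD intro: order.trans[OF _ monoD[of q 0 j]])

lemma grid_integral_Suc:
  "grid_integral q h W (Suc k) \<omega> =
    grid_integral q h W k \<omega> + h k \<omega> * (W (q (Suc k)) \<omega> - W (q k) \<omega>)"
  by (simp add: grid_integral_def)

lemma grid_integral_0 [simp]: "grid_integral q h W 0 \<omega> = 0"
  by (simp add: grid_integral_def)

lemma grid_integral_measurable:
  assumes W: "brownian_motion M F W" and g: "grid_data F q h b"
  shows "grid_integral q h W k \<in> borel_measurable (F (q k))"
proof (induction k)
  case 0
  then show ?case by (simp add: grid_integral_def)
next
  case (Suc k)
  note q = grid_dataD[OF g]
  have "grid_integral q h W k \<in> borel_measurable (F (q (Suc k)))"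
    "h k \<in> borel_measurable (F (q (Suc k)))" "W (q k) \<in> borel_measurable (F (q (Suc k)))"
    using borel_measurable_F_mono[OF Suc q(3)] borel_measurable_F_mono[OF q(4) q(3)]
      borel_measurable_F_mono[OF bm_measurable[OF W] q(3)] q(2) by auto
  moreover have "W (q (Suc k)) \<in> borel_measurable (F (q (Suc k)))"
    using bm_measurable[OF W q(2)] .
  ultimately show ?case unfolding grid_integral_Suc by measurable
qed

lemma grid_integral_L4:
  assumes W: "brownian_motion M F W" and g: "grid_data F q h b"
  shows "L4 M (grid_integral q h W k)"
proof (induction k)
  case 0
  then show ?case by (simp add: grid_integral_def)
next
  case (Suc k)
  note q = grid_dataD[OF g]
  have "L4 M (\<lambda>\<omega>. h k \<omega> * (W (q (Suc k)) \<omega> - W (q k) \<omega>))"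
    by (rule L4_bounded_mult[where b=b, OF borel_measurable_F[OF q(4)] q(5) bm_increment_L4[OF W q(2,3)]])
  with Suc show ?case unfolding grid_integral_Suc by (rule L4_add)
qed

text \<open>One induction for both bounds, since the fourth moment needs the second. In the fourth
  power of S + h \<Delta> the odd powers of \<Delta> have mean zero against multipliers known at
  \<open>q k\<close>. With x = q k - q 0 and d the length of the new cell, what remains is at most
  b^4 (3 x^2 + 6 x d + 3 d^2), again a multiple of a perfect square. The constant 3 is that of the
  Gaussian fourth moment.\<close>

lemma grid_integral_fourth_moment:
  assumes W: "brownian_motion M F W" and g: "grid_data F q h b"
  shows "expectation (\<lambda>\<omega>. grid_integral q h W k \<omega> ^ 4) \<le> 3 * b ^ 4 * (q k - q 0)\<^sup>2"
    and "expectation (\<lambda>\<omega>. grid_integral q h W k \<omega> ^ 2) \<le> b\<^sup>2 * (q k - q 0)"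
proof (induction k)
  case 0
  { case 1 then show ?case by simp }
  { case 2 then show ?case by simp }
next
  case (Suc k)
  note q = grid_dataD[OF g]
  define S where "S = grid_integral q h W k"
  define \<Delta> where "\<Delta> = (\<lambda>\<omega>. W (q (Suc k)) \<omega> - W (q k) \<omega>)"
  define d where "d = q (Suc k) - q k"
  have d: "0 \<le> d" using q(3) by (simp add: d_def)
  have hm [measurable]: "h k \<in> borel_measurable M" "S \<in> borel_measurable M"
    using borel_measurable_F[OF q(4)] borel_measurable_F[OF grid_integral_measurable[OF W g]]
    by (auto simp: S_def)
  have SL: "L4 M S" unfolding S_def by (rule grid_integral_L4[OF W g])
  have hb: "\<bar>h k \<omega> ^ e\<bar> \<le> b ^ e" if "\<omega> \<in> space M" for e \<omega>
    using power_mono[OF q(5)[OF that, of k], where n=e] by (simp add: power_abs)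
  have int: "integrable M (\<lambda>\<omega>. S \<omega> ^ r * h k \<omega> ^ p)" if "r \<le> 4" for r p
    using integrable_bounded_mult[OF _ hb[of _ p] L4_integrable_power[OF SL that]]
    by (simp add: mult.commute)
  have meas: "(\<lambda>\<omega>. S \<omega> ^ r * h k \<omega> ^ p) \<in> borel_measurable (F (q k))" for r p
    using grid_integral_measurable[OF W g] q(4) by (auto simp: S_def)
  have mom: "integrable M (\<lambda>\<omega>. S \<omega> ^ r * h k \<omega> ^ p * \<Delta> \<omega> ^ s)"
    "expectation (\<lambda>\<omega>. S \<omega> ^ r * h k \<omega> ^ p * \<Delta> \<omega> ^ s) =
      expectation (\<lambda>\<omega>. S \<omega> ^ r * h k \<omega> ^ p) * expectation (\<lambda>\<omega>. \<Delta> \<omega> ^ s)" if "r \<le> 4" for r p s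
    using bm_increment_mult[OF W q(2) q(3) meas int[OF that]] by (auto simp: \<Delta>_def)
  have \<Delta>: "expectation (\<lambda>\<omega>. \<Delta> \<omega>) = 0" "expectation (\<lambda>\<omega>. \<Delta> \<omega> ^ 2) = d"
    "expectation (\<lambda>\<omega>. \<Delta> \<omega> ^ 3) = 0" "expectation (\<lambda>\<omega>. \<Delta> \<omega> ^ 4) = 3 * d\<^sup>2"
    using bm_increment_moments[OF W q(2) q(3)] by (simp_all add: \<Delta>_def d_def)
  have "expectation (\<lambda>\<omega>. S \<omega> ^ 2 * h k \<omega> ^ 2) \<le> expectation (\<lambda>\<omega>. S \<omega> ^ 2 * b ^ 2)"
    by (intro integral_mono int) (use L4_integrable_power[OF SL, of 2] hb[of _ 2] in \<open>auto intro!: mult_left_mono\<close>)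
  also have "\<dots> \<le> b\<^sup>2 * (q k - q 0) * b\<^sup>2"
    using Suc(2) by (simp add: S_def mult_right_mono)
  finally have b22: "expectation (\<lambda>\<omega>. S \<omega> ^ 2 * h k \<omega> ^ 2) \<le> b ^ 4 * (q k - q 0)"
    by (simp add: power2_eq_square power4_eq_xxxx algebra_simps)
  have b0: "expectation (\<lambda>\<omega>. S \<omega> ^ 0 * h k \<omega> ^ p) \<le> b ^ p" for p
    using integral_mono[OF int[of 0 p], of "\<lambda>_. b ^ p"] hb[of _ p] by (auto simp: prob_space abs_le_iff)
  {
    case 1
    \<comment> \<open>The trivial exponents 0 and 1 are kept so that every summand has the shape
      treated in \<open>mom\<close>.\<close>
    have "expectation (\<lambda>\<omega>. grid_integral q h W (Suc k) \<omega> ^ 4) =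
      expectation (\<lambda>\<omega>. S \<omega> ^ 4 * h k \<omega> ^ 0 * \<Delta> \<omega> ^ 0 + 4 * (S \<omega> ^ 3 * h k \<omega> ^ 1 * \<Delta> \<omega> ^ 1)
        + 6 * (S \<omega> ^ 2 * h k \<omega> ^ 2 * \<Delta> \<omega> ^ 2) + 4 * (S \<omega> ^ 1 * h k \<omega> ^ 3 * \<Delta> \<omega> ^ 3)
        + S \<omega> ^ 0 * h k \<omega> ^ 4 * \<Delta> \<omega> ^ 4)"
      unfolding grid_integral_Suc S_def[symmetric] \<Delta>_def[symmetric]
      by (intro Bochner_Integration.integral_cong refl) (simp add: \<Delta>_def; algebra)
    also have "\<dots> = expectation (\<lambda>\<omega>. S \<omega> ^ 4) + 6 * (expectation (\<lambda>\<omega>. S \<omega> ^ 2 * h k \<omega> ^ 2) * d)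
        + expectation (\<lambda>\<omega>. S \<omega> ^ 0 * h k \<omega> ^ 4) * (3 * d\<^sup>2)"
      using mom(1)[of 4 0 0] mom(1)[of 3 1 1] mom(1)[of 2 2 2] mom(1)[of 1 3 3] mom(1)[of 0 4 4]
        mom(2)[of 4 0 0] mom(2)[of 3 1 1] mom(2)[of 2 2 2] mom(2)[of 1 3 3] mom(2)[of 0 4 4] \<Delta>
      by (simp add: prob_space)
    also have "\<dots> \<le> 3 * b ^ 4 * (q k - q 0)\<^sup>2 + 6 * (b ^ 4 * (q k - q 0) * d) + b ^ 4 * (3 * d\<^sup>2)"
      using Suc(1) d by (intro add_mono mult_left_mono mult_right_mono b22 b0) (auto simp: S_def)
    also have "\<dots> = 3 * b ^ 4 * (q (Suc k) - q 0)\<^sup>2"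
      by (simp add: d_def power2_eq_square algebra_simps)
    finally show ?case .
  next
    case 2
    have "expectation (\<lambda>\<omega>. grid_integral q h W (Suc k) \<omega> ^ 2) =
      expectation (\<lambda>\<omega>. S \<omega> ^ 2 * h k \<omega> ^ 0 * \<Delta> \<omega> ^ 0 + 2 * (S \<omega> ^ 1 * h k \<omega> ^ 1 * \<Delta> \<omega> ^ 1)
        + (S \<omega> ^ 0 * h k \<omega> ^ 2 * \<Delta> \<omega> ^ 2))"
      unfolding grid_integral_Suc S_def[symmetric] \<Delta>_def[symmetric]
      by (intro Bochner_Integration.integral_cong refl) (simp add: \<Delta>_def; algebra)
    also have "\<dots> = expectation (\<lambda>\<omega>. S \<omega> ^ 2) + expectation (\<lambda>\<omega>. S \<omega> ^ 0 * h k \<omega> ^ 2) * d"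
      using mom(1)[of 2 0 0] mom(1)[of 1 1 1] mom(1)[of 0 2 2]
        mom(2)[of 2 0 0] mom(2)[of 1 1 1] mom(2)[of 0 2 2] \<Delta>
      by (simp add: prob_space)
    also have "\<dots> \<le> b\<^sup>2 * (q k - q 0) + b ^ 2 * d"
      using Suc(2) d by (intro add_mono mult_right_mono b0) (auto simp: S_def)
    also have "\<dots> = b\<^sup>2 * (q (Suc k) - q 0)"
      by (simp add: d_def algebra_simps)
    finally show ?case .
  }
qed

text \<open>The martingale property in tested form: each new increment has mean zero against
  \<open>\<zeta>\<close> times \<open>h k\<close>, which is known at \<open>q k\<close>.\<close>

lemma grid_integral_orthogonal:
  assumes W: "brownian_motion M F W" and g: "grid_data F q h b"
    and \<zeta>: "\<zeta> \<in> borel_measurable (F (q 0))" and B: "\<And>\<omega>. \<omega> \<in> space M \<Longrightarrow> \<bar>\<zeta> \<omega>\<bar> \<le> B"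
  shows "expectation (\<lambda>\<omega>. \<zeta> \<omega> * grid_integral q h W k \<omega>) = 0"
proof (induction k)
  case 0
  then show ?case by simp
next
  case (Suc k)
  note q = grid_dataD[OF g]
  have q0: "q 0 \<le> q k" using q(1) by (simp add: monoD)
  have \<zeta>M: "\<zeta> \<in> borel_measurable M" by (rule borel_measurable_F[OF \<zeta>])
  have meas: "(\<lambda>\<omega>. \<zeta> \<omega> * h k \<omega>) \<in> borel_measurable (F (q k))"
    using borel_measurable_F_mono[OF \<zeta> q0] q(4) by auto
  have int: "integrable M (\<lambda>\<omega>. \<zeta> \<omega> * h k \<omega>)"
    by (rule integrable_bounded_mult[OF \<zeta>M B integrable_bounded[OF borel_measurable_F[OF q(4)] q(5)]])
  have "expectation (\<lambda>\<omega>. \<zeta> \<omega> * grid_integral q h W (Suc k) \<omega>) =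
    expectation (\<lambda>\<omega>. \<zeta> \<omega> * grid_integral q h W k \<omega> + \<zeta> \<omega> * h k \<omega> * (W (q (Suc k)) \<omega> - W (q k) \<omega>))"
    by (simp add: grid_integral_Suc algebra_simps)
  also have "\<dots> = expectation (\<lambda>\<omega>. \<zeta> \<omega> * grid_integral q h W k \<omega>)
     + expectation (\<lambda>\<omega>. \<zeta> \<omega> * h k \<omega> * (W (q (Suc k)) \<omega> - W (q k) \<omega>))"
    using bm_increment_mult(1)[OF W q(2) q(3) meas int, of 1]
      integrable_bounded_mult[OF \<zeta>M B L4_integrable[OF grid_integral_L4[OF W g]]]
    by (intro Bochner_Integration.integral_add) auto
  also have "\<dots> = 0"
    using Suc bm_increment_orthogonal[OF W q(2) q(3) meas int] by simp
  finally show ?case .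
qed

text \<open>When the product of the two sums is expanded, the mixed terms vanish: each is an
  increment times something known at the start of its cell. Only products of increments over the
  same cell survive. Nothing is assumed about the pair W, W': the case W' = W gives second moments,
  the case of independent motions gives zero.\<close>

lemma grid_integral_covariation:
  assumes W: "brownian_motion M F W" and g: "grid_data F q h b"
    and W': "brownian_motion M F W'" and g': "grid_data F q h' b'"
    and \<zeta>: "\<zeta> \<in> borel_measurable (F (q 0))" and B: "\<And>\<omega>. \<omega> \<in> space M \<Longrightarrow> \<bar>\<zeta> \<omega>\<bar> \<le> B"
  shows "expectation (\<lambda>\<omega>. \<zeta> \<omega> * (grid_integral q h W k \<omega> * grid_integral q h' W' k \<omega>)) =
    (\<Sum>j<k. expectation (\<lambda>\<omega>. \<zeta> \<omega> * (h j \<omega> * h' j \<omega>) *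
       ((W (q (Suc j)) \<omega> - W (q j) \<omega>) * (W' (q (Suc j)) \<omega> - W' (q j) \<omega>))))"
proof (induction k)
  case 0
  then show ?case by simp
next
  case (Suc k)
  define \<Delta> \<Delta>' where "\<Delta> = (\<lambda>\<omega>. W (q (Suc k)) \<omega> - W (q k) \<omega>)" and "\<Delta>' = (\<lambda>\<omega>. W' (q (Suc k)) \<omega> - W' (q k) \<omega>)"
  define S S' where "S = grid_integral q h W k" and "S' = grid_integral q h' W' k"
  note q = grid_dataD[OF g] and q' = grid_dataD[OF g']
  have q0: "q 0 \<le> q k" using q(1) by (simp add: monoD)
  have \<zeta>M [measurable]: "\<zeta> \<in> borel_measurable M" by (rule borel_measurable_F[OF \<zeta>])
  have hM [measurable]: "h k \<in> borel_measurable M" "h' k \<in> borel_measurable M"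
    using borel_measurable_F[OF q(4)] borel_measurable_F[OF q'(4)] by auto
  have L: "L4 M S" "L4 M S'" "L4 M \<Delta>" "L4 M \<Delta>'"
    using grid_integral_L4[OF W g] grid_integral_L4[OF W' g'] bm_increment_L4[OF W q(2) q(3)]
      bm_increment_L4[OF W' q(2) q(3)] by (auto simp: S_def S'_def \<Delta>_def \<Delta>'_def)
  have hL: "L4 M (\<lambda>\<omega>. h k \<omega> * \<Delta> \<omega>)" "L4 M (\<lambda>\<omega>. h' k \<omega> * \<Delta>' \<omega>)"
    "L4 M (\<lambda>\<omega>. h' k \<omega> * S \<omega>)" "L4 M (\<lambda>\<omega>. h k \<omega> * S' \<omega>)"
    using L4_bounded_mult[OF hM(1) q(5)] L4_bounded_mult[OF hM(2) q'(5)] L by auto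
  have int: "integrable M (\<lambda>\<omega>. \<zeta> \<omega> * (X \<omega> * Y \<omega>))" if "L4 M X" "L4 M Y" for X Y
    by (rule integrable_bounded_mult[OF \<zeta>M B L4_integrable_mult[OF that]])
  have i1: "integrable M (\<lambda>\<omega>. \<zeta> \<omega> * (S \<omega> * S' \<omega>))" by (rule int[OF L(1,2)])
  have i2: "integrable M (\<lambda>\<omega>. \<zeta> \<omega> * (h' k \<omega> * S \<omega> * \<Delta>' \<omega>))" by (rule int[OF hL(3) L(4)])
  have i3: "integrable M (\<lambda>\<omega>. \<zeta> \<omega> * (h k \<omega> * S' \<omega> * \<Delta> \<omega>))" by (rule int[OF hL(4) L(3)])
  have i4: "integrable M (\<lambda>\<omega>. \<zeta> \<omega> * ((h k \<omega> * \<Delta> \<omega>) * (h' k \<omega> * \<Delta>' \<omega>)))" by (rule int[OF hL(1,2)])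
  have m: "S \<in> borel_measurable (F (q k))" "S' \<in> borel_measurable (F (q k))" "\<zeta> \<in> borel_measurable (F (q k))"
    "h k \<in> borel_measurable (F (q k))" "h' k \<in> borel_measurable (F (q k))"
    using grid_integral_measurable[OF W g] grid_integral_measurable[OF W' g']
      borel_measurable_F_mono[OF \<zeta> q0] q(4) q'(4) by (auto simp: S_def S'_def)
  have z2: "expectation (\<lambda>\<omega>. \<zeta> \<omega> * (h' k \<omega> * S \<omega> * \<Delta>' \<omega>)) = 0"
    using bm_increment_orthogonal[OF W' q(2) q(3), of "\<lambda>\<omega>. \<zeta> \<omega> * (h' k \<omega> * S \<omega>)"] m
      integrable_bounded_mult[OF \<zeta>M B L4_integrable[OF hL(3)]]
    by (simp add: \<Delta>'_def mult.assoc)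
  have z3: "expectation (\<lambda>\<omega>. \<zeta> \<omega> * (h k \<omega> * S' \<omega> * \<Delta> \<omega>)) = 0"
    using bm_increment_orthogonal[OF W q(2) q(3), of "\<lambda>\<omega>. \<zeta> \<omega> * (h k \<omega> * S' \<omega>)"] m
      integrable_bounded_mult[OF \<zeta>M B L4_integrable[OF hL(4)]]
    by (simp add: \<Delta>_def mult.assoc)
  have "expectation (\<lambda>\<omega>. \<zeta> \<omega> * (grid_integral q h W (Suc k) \<omega> * grid_integral q h' W' (Suc k) \<omega>)) =
    expectation (\<lambda>\<omega>. \<zeta> \<omega> * (S \<omega> * S' \<omega>) + \<zeta> \<omega> * (h' k \<omega> * S \<omega> * \<Delta>' \<omega>) + \<zeta> \<omega> * (h k \<omega> * S' \<omega> * \<Delta> \<omega>)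
      + \<zeta> \<omega> * ((h k \<omega> * \<Delta> \<omega>) * (h' k \<omega> * \<Delta>' \<omega>)))"
    by (intro Bochner_Integration.integral_cong refl)
       (simp add: grid_integral_Suc S_def S'_def \<Delta>_def \<Delta>'_def; algebra)
  also have "\<dots> = expectation (\<lambda>\<omega>. \<zeta> \<omega> * (S \<omega> * S' \<omega>)) + expectation (\<lambda>\<omega>. \<zeta> \<omega> * ((h k \<omega> * \<Delta> \<omega>) * (h' k \<omega> * \<Delta>' \<omega>)))"
    using i1 i2 i3 i4 z2 z3 by simp
  also have "expectation (\<lambda>\<omega>. \<zeta> \<omega> * ((h k \<omega> * \<Delta> \<omega>) * (h' k \<omega> * \<Delta>' \<omega>))) =
    expectation (\<lambda>\<omega>. \<zeta> \<omega> * (h k \<omega> * h' k \<omega>) * (\<Delta> \<omega> * \<Delta>' \<omega>))"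
    by (simp add: ac_simps)
  finally show ?case using Suc by (simp add: S_def S'_def \<Delta>_def \<Delta>'_def)
qed

lemma grid_integral_second_moment:
  assumes W: "brownian_motion M F W" and g: "grid_data F q h b"
    and \<zeta>: "\<zeta> \<in> borel_measurable (F (q 0))" and B: "\<And>\<omega>. \<omega> \<in> space M \<Longrightarrow> \<bar>\<zeta> \<omega>\<bar> \<le> B"
  shows "expectation (\<lambda>\<omega>. \<zeta> \<omega> * (grid_integral q h W k \<omega>)\<^sup>2) =
    (\<Sum>j<k. expectation (\<lambda>\<omega>. \<zeta> \<omega> * (h j \<omega>)\<^sup>2) * (q (Suc j) - q j))"
proof -
  note q = grid_dataD[OF g]
  have "expectation (\<lambda>\<omega>. \<zeta> \<omega> * (h j \<omega>)\<^sup>2 * (W (q (Suc j)) \<omega> - W (q j) \<omega>)\<^sup>2) =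
    expectation (\<lambda>\<omega>. \<zeta> \<omega> * (h j \<omega>)\<^sup>2) * (q (Suc j) - q j)" for j
  proof -
    have q0: "q 0 \<le> q j" using q(1) by (simp add: monoD)
    have m: "(\<lambda>\<omega>. \<zeta> \<omega> * (h j \<omega>)\<^sup>2) \<in> borel_measurable (F (q j))"
      using borel_measurable_F_mono[OF \<zeta> q0] q(4) by auto
    have "integrable M (\<lambda>\<omega>. \<zeta> \<omega> * (h j \<omega> * h j \<omega>))"
      by (intro integrable_bounded_mult[OF borel_measurable_F[OF \<zeta>] B]
          integrable_bounded_mult[OF borel_measurable_F[OF q(4)] q(5)]
          integrable_bounded[OF borel_measurable_F[OF q(4)] q(5)])
    then have i: "integrable M (\<lambda>\<omega>. \<zeta> \<omega> * (h j \<omega>)\<^sup>2)" by (simp add: power2_eq_square)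
    show ?thesis
      using bm_increment_mult(2)[OF W q(2) q(3) m i, of 2] bm_increment_moments(3)[OF W q(2) q(3)] by simp
  qed
  then show ?thesis
    using grid_integral_covariation[OF W g W g \<zeta> B] by (simp add: power2_eq_square)
qed

text \<open>Two-sided bounds on the conditional second moment given the initial time, in tested
  form; being inequalities they need a nonnegative multiplier.\<close>

lemma grid_integral_second_moment_bounds:
  assumes W: "brownian_motion M F W" and g: "grid_data F q h b"
    and \<zeta>: "\<zeta> \<in> borel_measurable (F (q 0))" and B: "\<And>\<omega>. \<omega> \<in> space M \<Longrightarrow> \<bar>\<zeta> \<omega>\<bar> \<le> B"
    and pos: "\<And>\<omega>. \<omega> \<in> space M \<Longrightarrow> 0 \<le> \<zeta> \<omega>"
    and h: "\<And>j \<omega>. \<omega> \<in> space M \<Longrightarrow> lo \<le> (h j \<omega>)\<^sup>2" "\<And>j \<omega>. \<omega> \<in> space M \<Longrightarrow> (h j \<omega>)\<^sup>2 \<le> up"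
  shows "lo * (q k - q 0) * expectation \<zeta> \<le> expectation (\<lambda>\<omega>. \<zeta> \<omega> * (grid_integral q h W k \<omega>)\<^sup>2)"
    and "expectation (\<lambda>\<omega>. \<zeta> \<omega> * (grid_integral q h W k \<omega>)\<^sup>2) \<le> up * (q k - q 0) * expectation \<zeta>"
proof -
  note q = grid_dataD[OF g]
  have tel: "(\<Sum>j<k. q (Suc j) - q j) = q k - q 0" by (rule sum_lessThan_telescope)
  have \<zeta>M: "\<zeta> \<in> borel_measurable M" by (rule borel_measurable_F[OF \<zeta>])
  have iz: "integrable M \<zeta>" by (rule integrable_bounded[OF \<zeta>M B])
  have i: "integrable M (\<lambda>\<omega>. \<zeta> \<omega> * (h j \<omega>)\<^sup>2)" for j
  proof -
    have "integrable M (\<lambda>\<omega>. \<zeta> \<omega> * (h j \<omega> * h j \<omega>))"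
      by (intro integrable_bounded_mult[OF \<zeta>M B]
          integrable_bounded_mult[OF borel_measurable_F[OF q(4)] q(5)]
          integrable_bounded[OF borel_measurable_F[OF q(4)] q(5)])
    then show ?thesis by (simp add: power2_eq_square)
  qed
  have tel': "(\<Sum>j<k. c * (q (Suc j) - q j)) = c * (q k - q 0)" for c
    by (simp only: sum_distrib_left[symmetric] tel)
  have gsm: "expectation (\<lambda>\<omega>. \<zeta> \<omega> * (grid_integral q h W k \<omega>)\<^sup>2) =
    (\<Sum>j<k. expectation (\<lambda>\<omega>. \<zeta> \<omega> * (h j \<omega>)\<^sup>2) * (q (Suc j) - q j))"
    by (rule grid_integral_second_moment[OF W g \<zeta> B])
  have "lo * expectation \<zeta> \<le> expectation (\<lambda>\<omega>. \<zeta> \<omega> * (h j \<omega>)\<^sup>2)" for j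
    using integral_mono[of M "\<lambda>\<omega>. lo * \<zeta> \<omega>" "\<lambda>\<omega>. \<zeta> \<omega> * (h j \<omega>)\<^sup>2"] iz i
      mult_left_mono[OF h(1) pos] by (simp add: mult.commute)
  then have "(\<Sum>j<k. lo * expectation \<zeta> * (q (Suc j) - q j)) \<le>
    (\<Sum>j<k. expectation (\<lambda>\<omega>. \<zeta> \<omega> * (h j \<omega>)\<^sup>2) * (q (Suc j) - q j))"
    using q(3) by (intro sum_mono mult_right_mono) auto
  then show "lo * (q k - q 0) * expectation \<zeta> \<le> expectation (\<lambda>\<omega>. \<zeta> \<omega> * (grid_integral q h W k \<omega>)\<^sup>2)"
    unfolding gsm tel' by (simp only: mult_ac)
  have "expectation (\<lambda>\<omega>. \<zeta> \<omega> * (h j \<omega>)\<^sup>2) \<le> up * expectation \<zeta>" for j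
    using integral_mono[of M "\<lambda>\<omega>. \<zeta> \<omega> * (h j \<omega>)\<^sup>2" "\<lambda>\<omega>. up * \<zeta> \<omega>"] iz i
      mult_left_mono[OF h(2) pos] by (simp add: mult.commute)
  then have "(\<Sum>j<k. expectation (\<lambda>\<omega>. \<zeta> \<omega> * (h j \<omega>)\<^sup>2) * (q (Suc j) - q j)) \<le>
    (\<Sum>j<k. up * expectation \<zeta> * (q (Suc j) - q j))"
    using q(3) by (intro sum_mono mult_right_mono) auto
  then show "expectation (\<lambda>\<omega>. \<zeta> \<omega> * (grid_integral q h W k \<omega>)\<^sup>2) \<le> up * (q k - q 0) * expectation \<zeta>"
    unfolding gsm tel' by (simp only: mult_ac)
qed

text \<open>A discrete form of Lenglart's inequality: the integrand is cut off as soon as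
  the quadratic variation exceeds \<open>\<eta>\<close>.\<close>

lemma grid_integral_lenglart:
  assumes W: "brownian_motion M F W" and g: "grid_data F q h b" and \<eta>: "0 \<le> \<eta>"
  shows "expectation (\<lambda>\<omega>. min 1 \<bar>grid_integral q h W k \<omega>\<bar>) \<le>
    prob {\<omega>\<in>space M. \<eta> < (\<Sum>j<k. (h j \<omega>)\<^sup>2 * (q (Suc j) - q j))} + sqrt \<eta>"
proof -
  note q = grid_dataD[OF g]
  define V where "V i \<omega> = (\<Sum>j<i. (h j \<omega>)\<^sup>2 * (q (Suc j) - q j))" for i \<omega>
  \<comment> \<open>The index \<open>Suc j\<close> matters: \<open>V (Suc j)\<close> uses the
    integrand only up to \<open>h j\<close>, hence is known at \<open>q j\<close>, and the integrand
    is cut before the step that would exceed \<open>\<eta>\<close>, so there is no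
    overshoot.\<close>
  define h' where "h' j \<omega> = (if V (Suc j) \<omega> \<le> \<eta> then h j \<omega> else 0)" for j \<omega>
  have V_mono: "V i \<omega> \<le> V j \<omega>" if "i \<le> j" for i j \<omega>
    unfolding V_def using that q(3) by (intro sum_mono2) auto
  have hF: "h j \<in> borel_measurable (F (q i))" if "j \<le> i" for i j
    using borel_measurable_F_mono[OF q(4) monoD[OF q(1) that]] .
  have VF: "V (Suc i) \<in> borel_measurable (F (q i))" for i
    unfolding V_def by (intro borel_measurable_sum borel_measurable_times borel_measurable_power) (auto intro: hF)
  have g': "grid_data F q h' b"
    unfolding grid_data_def
  proof (intro conjI allI)
    fix j
    have [measurable]: "V (Suc j) \<in> borel_measurable (F (q j))" "h j \<in> borel_measurable (F (q j))"
      using VF q(4) by auto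
    show "h' j \<in> borel_measurable (F (q j))" unfolding h'_def by measurable
    have "0 \<le> b" if "\<omega> \<in> space M" for \<omega> using q(5)[OF that, of j] by linarith
    then show "\<forall>\<omega>\<in>space (F (q j)). \<bar>h' j \<omega>\<bar> \<le> b" using q(5) by (auto simp: h'_def)
  qed (use q(1) q(2)[of 0] in auto)
  have V'_le: "(\<Sum>j<i. (h' j \<omega>)\<^sup>2 * (q (Suc j) - q j)) \<le> \<eta>" for i \<omega>
  proof -
    \<comment> \<open>The bound by \<open>\<eta>\<close> alone is not inductive: a step taken below
      the threshold needs the sum so far to be at most \<open>V i\<close>.\<close>
    have "(\<Sum>j<i. (h' j \<omega>)\<^sup>2 * (q (Suc j) - q j)) \<le> (if V i \<omega> \<le> \<eta> then V i \<omega> else \<eta>)"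
    proof (induction i)
      case 0
      then show ?case using \<eta> by (auto simp: V_def)
    next
      case (Suc i)
      have "V i \<omega> \<le> V (Suc i) \<omega>" by (intro V_mono) simp
      then show ?case using Suc by (auto simp: h'_def V_def split: if_splits)
    qed
    then show ?thesis by (auto split: if_splits)
  qed
  have eq: "grid_integral q h' W k \<omega> = grid_integral q h W k \<omega>" if "V k \<omega> \<le> \<eta>" for \<omega>
    unfolding grid_integral_def
  proof (intro sum.cong refl)
    fix j assume "j \<in> {..<k}"
    then have "V (Suc j) \<omega> \<le> \<eta>" using V_mono[of "Suc j" k \<omega>] that by auto
    then show "h' j \<omega> * (W (q (Suc j)) \<omega> - W (q j) \<omega>) = h j \<omega> * (W (q (Suc j)) \<omega> - W (q j) \<omega>)"
      by (simp add: h'_def)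
  qed
  have L': "L4 M (grid_integral q h' W k)" by (rule grid_integral_L4[OF W g'])
  have [measurable]: "grid_integral q h W k \<in> borel_measurable M" "h j \<in> borel_measurable M" for j
    using borel_measurable_F[OF grid_integral_measurable[OF W g]] borel_measurable_F[OF q(4)] by auto
  have [measurable]: "V k \<in> borel_measurable M" unfolding V_def by measurable
  define A where "A = {\<omega>\<in>space M. \<eta> < V k \<omega>}"
  have A [measurable]: "A \<in> events" unfolding A_def by measurable
  have iA: "integrable M (indicat_real A)"
    by (rule integrable_bounded[where b=1]) (auto simp: indicator_def)
  have "expectation (\<lambda>\<omega>. (grid_integral q h' W k \<omega>)\<^sup>2) =
    (\<Sum>j<k. expectation (\<lambda>\<omega>. (h' j \<omega>)\<^sup>2) * (q (Suc j) - q j))"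
    using grid_integral_second_moment[OF W g', of "\<lambda>_. 1" 1 k] by simp
  also have "\<dots> = expectation (\<lambda>\<omega>. \<Sum>j<k. (h' j \<omega>)\<^sup>2 * (q (Suc j) - q j))"
  proof -
    have "integrable M (\<lambda>\<omega>. (h' j \<omega>)\<^sup>2)" for j
      unfolding power2_eq_square
      by (intro integrable_bounded_mult[OF borel_measurable_F[OF grid_dataD(4)[OF g']] grid_dataD(5)[OF g']]
          integrable_bounded[OF borel_measurable_F[OF grid_dataD(4)[OF g']] grid_dataD(5)[OF g']])
    then show ?thesis by (subst Bochner_Integration.integral_sum) auto
  qed
  also have "\<dots> \<le> expectation (\<lambda>_. \<eta>)"
    using \<eta> V'_le by (intro integral_mono') auto
  finally have "expectation (\<lambda>\<omega>. (grid_integral q h' W k \<omega>)\<^sup>2) \<le> \<eta>" by (simp add: prob_space)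
  then have E': "expectation (\<lambda>\<omega>. \<bar>grid_integral q h' W k \<omega>\<bar>) \<le> sqrt \<eta>"
    using expectation_abs_le_sqrt[of "grid_integral q h' W k"] L' L4_integrable_power[OF L', of 2]
    by (auto simp: L4_def intro: order.trans real_sqrt_le_mono)
  have "expectation (\<lambda>\<omega>. min 1 \<bar>grid_integral q h W k \<omega>\<bar>) \<le>
    expectation (\<lambda>\<omega>. indicator A \<omega> + \<bar>grid_integral q h' W k \<omega>\<bar>)"
  proof (rule integral_mono)
    show "integrable M (\<lambda>\<omega>. min 1 \<bar>grid_integral q h W k \<omega>\<bar>)"
      by (rule integrable_bounded[where b=1]) auto
    show "integrable M (\<lambda>\<omega>. indicator A \<omega> + \<bar>grid_integral q h' W k \<omega>\<bar>)"
      using L4_integrable[OF L'] iA by simp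
    fix \<omega> assume "\<omega> \<in> space M"
    then show "min 1 \<bar>grid_integral q h W k \<omega>\<bar> \<le> indicator A \<omega> + \<bar>grid_integral q h' W k \<omega>\<bar>"
      using eq[of \<omega>] by (auto simp: A_def indicator_def not_less)
  qed
  also have "\<dots> = prob A + expectation (\<lambda>\<omega>. \<bar>grid_integral q h' W k \<omega>\<bar>)"
    using L4_integrable[OF L'] iA A by simp
  finally show ?thesis using E' by (simp add: A_def V_def)
qed

section \<open>Integrals against independent Brownian motions\<close>

text \<open>The product of two increments is a measurable functional of the path, reading four
  coordinates, so independence of the paths factorises the expectation. Two time intervals are
  needed to compare different cells of a partition.\<close>

lemma independent_processes_increments:
  assumes bm: "\<And>i. brownian_motion M F (W i)" and ind: "independent_processes M W" and ij: "i \<noteq> j"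
    and t: "0 \<le> a" "a \<le> a'" "0 \<le> c" "c \<le> c'"
  shows "expectation (\<lambda>\<omega>. ((W i a' \<omega> - W i a \<omega>) * (W i c' \<omega> - W i c \<omega>)) *
      ((W j a' \<omega> - W j a \<omega>) * (W j c' \<omega> - W j c \<omega>))) =
    expectation (\<lambda>\<omega>. (W i a' \<omega> - W i a \<omega>) * (W i c' \<omega> - W i c \<omega>)) *
    expectation (\<lambda>\<omega>. (W j a' \<omega> - W j a \<omega>) * (W j c' \<omega> - W j c \<omega>))" (is ?eq)
    and "integrable M (\<lambda>\<omega>. ((W i a' \<omega> - W i a \<omega>) * (W i c' \<omega> - W i c \<omega>)) *
      ((W j a' \<omega> - W j a \<omega>) * (W j c' \<omega> - W j c \<omega>)))" (is ?int)
proof -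
  define f :: "(real \<Rightarrow> real) \<Rightarrow> real" where "f p = (p a' - p a) * (p c' - p c)" for p
  have [measurable]: "f \<in> borel_measurable (PiM {0..} (\<lambda>_. borel))"
    unfolding f_def using t
    by (intro borel_measurable_times borel_measurable_diff measurable_component_singleton) auto
  have "indep_vars (\<lambda>_. borel) (\<lambda>l \<omega>. f (\<lambda>t\<in>{0..}. W l t \<omega>)) {i, j}"
    using indep_vars_compose2[OF indep_vars_subset[OF ind[unfolded independent_processes_def]],
        of "{i, j}" "\<lambda>_. f" "\<lambda>_. borel"] by simp
  moreover have f_eq: "f (\<lambda>t\<in>{0..}. W l t \<omega>) = (W l a' \<omega> - W l a \<omega>) * (W l c' \<omega> - W l c \<omega>)" for l \<omega>
    using t by (simp add: f_def)
  ultimately have iv: "indep_vars (\<lambda>_. borel)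
      (\<lambda>l \<omega>. (W l a' \<omega> - W l a \<omega>) * (W l c' \<omega> - W l c \<omega>)) {i, j}" by simp
  have int: "integrable M (\<lambda>\<omega>. (W l a' \<omega> - W l a \<omega>) * (W l c' \<omega> - W l c \<omega>))" for l
    by (intro L4_integrable_mult bm_increment_L4[OF bm] t)
  show ?eq using indep_vars_lebesgue_integral[OF _ iv int] ij by simp
  show ?int using indep_vars_integrable[OF _ iv int] ij by simp
qed

text \<open>Only the independence of \<open>W i\<close> and \<open>W j\<close> as processes is available, not the joint
  independence of their increments from \<open>F u\<close>. Along a partition of mesh \<open>(v - u) / N\<close> the left
  side is the expectation of \<open>U\<close> times the discrete covariation, whose second moment is
  \<open>(v - u)\<^sup>2 / N\<close>.\<close>

lemma bm_increments_uncorrelated: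
  assumes bm: "\<And>i. brownian_motion M F (W i)" and ind: "independent_processes M W" and ij: "i \<noteq> j"
    and uv: "0 \<le> u" "u \<le> v"
    and U: "U \<in> borel_measurable (F u)" and B: "\<And>\<omega>. \<omega> \<in> space M \<Longrightarrow> \<bar>U \<omega>\<bar> \<le> B"
  shows "expectation (\<lambda>\<omega>. U \<omega> * ((W i v \<omega> - W i u \<omega>) * (W j v \<omega> - W j u \<omega>))) = 0"
proof -
  define E where "E = expectation (\<lambda>\<omega>. U \<omega> * ((W i v \<omega> - W i u \<omega>) * (W j v \<omega> - W j u \<omega>)))"
  have UM [measurable]: "U \<in> borel_measurable M" by (rule borel_measurable_F[OF U])
  have B0: "0 \<le> B" using B not_empty by (meson abs_ge_zero ex_in_conv order_trans)
  have bound: "\<bar>E\<bar> \<le> B * sqrt ((v - u)\<^sup>2 / N)" if N: "N > 0" for N :: nat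
  proof -
    define d where "d = (v - u) / N"
    have d: "0 \<le> d" using uv N by (simp add: d_def)
    define q where "q k = u + real k * d" for k
    have q_step: "q (Suc k) - q k = d" for k by (simp add: q_def algebra_simps)
    have q_mono: "mono q" using d by (auto simp: q_def mono_def intro!: mult_right_mono)
    have q_nn: "0 \<le> q k" for k using d uv by (simp add: q_def)
    have q_le: "q k \<le> q (Suc k)" for k using q_step[of k] d by simp
    have q0: "q 0 = u" and qN: "q N = v" using N by (simp_all add: q_def d_def)
    have g: "grid_data F q (\<lambda>_ _. 1) 1" using q_mono q_nn by (simp add: grid_data_def)
    have tel: "grid_integral q (\<lambda>_ _. 1) w N \<omega> = w v \<omega> - w u \<omega>" for w :: "real \<Rightarrow> 'a \<Rightarrow> real" and \<omega>
      using sum_lessThan_telescope[of "\<lambda>k. w (q k) \<omega>" N] by (simp add: grid_integral_def q0 qN)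
    define D where "D l k \<omega> = W l (q (Suc k)) \<omega> - W l (q k) \<omega>" for l k \<omega>
    define P where "P k \<omega> = D i k \<omega> * D j k \<omega>" for k \<omega>
    define T where "T \<omega> = (\<Sum>k<N. P k \<omega>)" for \<omega>
    have DL: "L4 M (D l k)" for l k
      unfolding D_def by (rule bm_increment_L4[OF bm q_nn q_le])
    have Pint: "integrable M (P k)" for k
      unfolding P_def by (rule L4_integrable_mult[OF DL DL])
    \<comment> \<open>This is the covariation formula for the constant integrand 1; independence of
      the two motions has not been used yet.\<close>
    have "E = (\<Sum>k<N. expectation (\<lambda>\<omega>. U \<omega> * P k \<omega>))"
      using grid_integral_covariation[OF bm[of i] g bm[of j] g, of U B N] U B
      by (simp add: E_def tel q0 P_def D_def)
    also have "\<dots> = expectation (\<lambda>\<omega>. U \<omega> * T \<omega>)"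
      unfolding T_def sum_distrib_left
      by (subst Bochner_Integration.integral_sum) (auto intro!: integrable_bounded_mult[OF UM B Pint])
    finally have E_eq: "E = expectation (\<lambda>\<omega>. U \<omega> * T \<omega>)" .
    have DD: "expectation (\<lambda>\<omega>. D l k \<omega> * D l m \<omega>) = (if k = m then d else 0)" for l k m
    proof -
      have less: "expectation (\<lambda>\<omega>. D l k \<omega> * D l m \<omega>) = 0" if "k < m" for k m
      proof -
        have "q (Suc k) \<le> q m" using q_mono that by (simp add: monoD)
        then have "D l k \<in> borel_measurable (F (q m))"
          unfolding D_def using q_le[of k]
          by (intro borel_measurable_diff borel_measurable_F_mono[OF bm_measurable[OF bm q_nn]]) auto
        then show ?thesis
          using bm_increment_orthogonal[OF bm q_nn q_le _ L4_integrable[OF DL], of l k m l]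
          by (simp add: D_def)
      qed
      have "expectation (\<lambda>\<omega>. D l k \<omega> * D l k \<omega>) = d"
        using bm_increment_moments(3)[OF bm q_nn q_le, of l k] q_step[of k]
        by (simp add: D_def power2_eq_square)
      then show ?thesis using less[of k m] less[of m k] by (cases k m rule: linorder_cases) (auto simp: mult.commute)
    qed
    \<comment> \<open>Independence of the two motions separates the factors belonging to i and j;
      each factor is then an expectation within one motion, where different cells are orthogonal by
      \<open>DD\<close>.\<close>
    have PP: "expectation (\<lambda>\<omega>. P k \<omega> * P m \<omega>) = (if k = m then d\<^sup>2 else 0)"
      "integrable M (\<lambda>\<omega>. P k \<omega> * P m \<omega>)" for k m
    proof -
      have eq: "P k \<omega> * P m \<omega> = (D i k \<omega> * D i m \<omega>) * (D j k \<omega> * D j m \<omega>)" for \<omega>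
        by (simp add: P_def)
      show "expectation (\<lambda>\<omega>. P k \<omega> * P m \<omega>) = (if k = m then d\<^sup>2 else 0)"
        unfolding eq using independent_processes_increments(1)[OF bm ind ij q_nn q_le q_nn q_le, of k m]
          DD[of i k m] DD[of j k m] by (auto simp: D_def power2_eq_square)
      show "integrable M (\<lambda>\<omega>. P k \<omega> * P m \<omega>)"
        unfolding eq using independent_processes_increments(2)[OF bm ind ij q_nn q_le q_nn q_le, of k m]
        by (simp add: D_def)
    qed
    have T2: "(T \<omega>)\<^sup>2 = (\<Sum>k<N. \<Sum>m<N. P k \<omega> * P m \<omega>)" for \<omega>
      by (simp add: T_def power2_eq_square sum_product)
    have T2int: "integrable M (\<lambda>\<omega>. (T \<omega>)\<^sup>2)" unfolding T2 by (intro Bochner_Integration.integrable_sum PP(2))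
    have "expectation (\<lambda>\<omega>. (T \<omega>)\<^sup>2) = N * d\<^sup>2"
      unfolding T2 by (simp add: PP)
    also have "\<dots> = (v - u)\<^sup>2 / N" using N by (simp add: d_def power2_eq_square field_simps)
    finally have ET: "expectation (\<lambda>\<omega>. (T \<omega>)\<^sup>2) = (v - u)\<^sup>2 / N" .
    have Tint: "integrable M T" unfolding T_def by (intro Bochner_Integration.integrable_sum Pint)
    have "\<bar>E\<bar> \<le> expectation (\<lambda>\<omega>. \<bar>U \<omega> * T \<omega>\<bar>)" unfolding E_eq by (rule integral_abs_bound)
    also have "\<dots> \<le> expectation (\<lambda>\<omega>. B * \<bar>T \<omega>\<bar>)"
    proof (rule integral_mono)
      show "integrable M (\<lambda>\<omega>. \<bar>U \<omega> * T \<omega>\<bar>)"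
        by (intro integrable_abs integrable_bounded_mult[OF UM B Tint])
      show "\<bar>U \<omega> * T \<omega>\<bar> \<le> B * \<bar>T \<omega>\<bar>" if "\<omega> \<in> space M" for \<omega>
        unfolding abs_mult by (intro mult_right_mono B that) simp
    qed (use Tint in simp)
    also have "\<dots> \<le> B * sqrt ((v - u)\<^sup>2 / N)"
      using expectation_abs_le_sqrt[of T] Tint T2int ET B0 by (auto intro!: mult_left_mono)
    finally show ?thesis .
  qed
  have "(\<lambda>N. B * sqrt ((v - u)\<^sup>2 / real (Suc N))) \<longlonglongrightarrow> B * sqrt 0"
    by (intro tendsto_intros LIMSEQ_Suc lim_const_over_n)
  then have "\<bar>E\<bar> \<le> B * sqrt 0"
    by (rule LIMSEQ_le_const) (intro exI[of _ 0] allI impI bound zero_less_Suc)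
  then show ?thesis by (simp add: E_def)
qed

lemma grid_integrals_uncorrelated:
  assumes bm: "\<And>i. brownian_motion M F (W i)" and ind: "independent_processes M W" and ij: "i \<noteq> j"
    and g: "grid_data F q h b" and g': "grid_data F q h' b'"
    and \<zeta>: "\<zeta> \<in> borel_measurable (F (q 0))" and B: "\<And>\<omega>. \<omega> \<in> space M \<Longrightarrow> \<bar>\<zeta> \<omega>\<bar> \<le> B"
  shows "expectation (\<lambda>\<omega>. \<zeta> \<omega> * (grid_integral q h (W i) k \<omega> * grid_integral q h' (W j) k \<omega>)) = 0"
proof -
  note q = grid_dataD[OF g] and q' = grid_dataD[OF g']
  have "expectation (\<lambda>\<omega>. \<zeta> \<omega> * (h l \<omega> * h' l \<omega>) *
       ((W i (q (Suc l)) \<omega> - W i (q l) \<omega>) * (W j (q (Suc l)) \<omega> - W j (q l) \<omega>))) = 0" for l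
  proof (rule bm_increments_uncorrelated[OF bm ind ij q(2) q(3), where B="\<bar>B\<bar> * (\<bar>b\<bar> * \<bar>b'\<bar>)"])
    have "q 0 \<le> q l" using q(1) by (simp add: monoD)
    then show "(\<lambda>\<omega>. \<zeta> \<omega> * (h l \<omega> * h' l \<omega>)) \<in> borel_measurable (F (q l))"
      using borel_measurable_F_mono[OF \<zeta>] q(4) q'(4) by auto
    fix \<omega> assume w: "\<omega> \<in> space M"
    have "\<bar>\<zeta> \<omega>\<bar> \<le> \<bar>B\<bar>" "\<bar>h l \<omega>\<bar> \<le> \<bar>b\<bar>" "\<bar>h' l \<omega>\<bar> \<le> \<bar>b'\<bar>"
      using B[OF w] q(5)[OF w, of l] q'(5)[OF w, of l] by linarith+
    then show "\<bar>\<zeta> \<omega> * (h l \<omega> * h' l \<omega>)\<bar> \<le> \<bar>B\<bar> * (\<bar>b\<bar> * \<bar>b'\<bar>)"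
      unfolding abs_mult by (intro mult_mono) auto
  qed
  then show ?thesis
    using grid_integral_covariation[OF bm g bm g' \<zeta> B] by simp
qed

end

section \<open>Approximation of the Ito integral\<close>

text \<open>The last conclusion is the usable form of refinement: no point of \<open>T\<close> lies
  in the interior of a cell. The grid is the sorted list of the relevant points and stays at t from
  index \<open>L\<close> on.\<close>

lemma refining_grid:
  fixes s t :: real
  assumes st: "s \<le> t" and T: "finite T"
  obtains q :: "nat \<Rightarrow> real" and L :: nat where "mono q" "q 0 = s" "q L = t"
    "\<And>k. s \<le> q k" "\<And>k. q k \<le> t" "\<And>k x. x \<in> T \<Longrightarrow> q k < x \<Longrightarrow> q (Suc k) \<le> x"
proof -
  define P where "P = {s, t} \<union> (T \<inter> {s..t})"
  have P: "finite P" "P \<noteq> {}" using T by (auto simp: P_def)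
  define xs where "xs = sorted_list_of_set P"
  have xs: "set xs = P" "sorted xs" "length xs > 0" "distinct xs" using P by (auto simp: xs_def)
  define L where "L = length xs - 1"
  define q where "q k = xs ! min k L" for k
  have lt: "min k L < length xs" for k using xs(3) unfolding L_def by linarith
  have qP: "q k \<in> P" for k using lt xs(1) by (auto simp: q_def)
  have mono: "mono q"
    unfolding q_def mono_def by (intro allI impI sorted_nth_mono[OF xs(2) _ lt]) auto
  have in_P: "\<exists>k\<le>L. x = q k" if "x \<in> P" for x
  proof -
    have "x \<in> set xs" using that xs(1) by simp
    then obtain k where "k < length xs" "x = xs ! k" by (auto simp: in_set_conv_nth)
    then show ?thesis by (intro exI[of _ k]) (auto simp: q_def L_def)
  qed
  have rng: "s \<le> q k" "q k \<le> t" for k using qP[of k] st by (auto simp: P_def)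
  have q0: "q 0 = s"
  proof -
    obtain k where "s = q k" using in_P[of s] by (auto simp: P_def)
    then have "q 0 \<le> s" using mono by (simp add: monoD)
    with rng[of 0] show ?thesis by simp
  qed
  have qL: "q L = t"
  proof -
    obtain k where "k \<le> L" "t = q k" using in_P[of t] by (auto simp: P_def)
    then have "t \<le> q L" using mono by (simp add: monoD)
    with rng[of L] show ?thesis by simp
  qed
  show thesis
  proof (rule that[OF mono q0 qL rng])
    fix k x assume x: "x \<in> T" "q k < x"
    show "q (Suc k) \<le> x"
    proof (rule ccontr)
      assume "\<not> q (Suc k) \<le> x"
      then have "x < q (Suc k)" by simp
      then have "x \<in> P" using x rng[of k] rng[of "Suc k"] by (auto simp: P_def)
      then obtain l where "x = q l" using in_P by blast
      then have "\<not> l \<le> k" "\<not> Suc k \<le> l"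
        using x \<open>x < q (Suc k)\<close> monoD[OF mono, of l k] monoD[OF mono, of "Suc k" l] by auto
      then show False by simp
    qed
  qed
qed

text \<open>A telescoping sum. As a and b are not interior to any cell, a half-open cell is
  contained in the interval or disjoint from it, and its right end decides which; in both cases the
  summand is the increment of \<open>\<phi>\<close>.\<close>

lemma interval_increment_grid:
  fixes q :: "nat \<Rightarrow> real" and G :: "real \<Rightarrow> real"
  assumes q: "mono q" "q 0 = s" "q L = t" "\<And>k. s \<le> q k" "\<And>k. q k \<le> t"
    and ab: "a \<le> b" "\<And>k x. x \<in> {a, b} \<Longrightarrow> q k < x \<Longrightarrow> q (Suc k) \<le> x"
  shows "(\<Sum>k<L. indicator {a<..b} (q (Suc k)) * (G (q (Suc k)) - G (q k))) =
    (G (min t b) - G (min t a)) - (G (min s b) - G (min s a))"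
proof -
  have "s \<le> t" using q(2) q(5)[of 0] by simp
  define \<phi> where "\<phi> k = G (min (q k) b) - G (min (q k) a)" for k
  have "indicator {a<..b} (q (Suc k)) * (G (q (Suc k)) - G (q k)) = \<phi> (Suc k) - \<phi> k" for k
    using ab(1) ab(2)[of a k] ab(2)[of b k] monoD[OF q(1), of k "Suc k"]
    by (cases "q k < a"; cases "q k < b"; cases "q k = q (Suc k)")
       (auto simp: \<phi>_def indicator_def min_def)
  then have "(\<Sum>k<L. indicator {a<..b} (q (Suc k)) * (G (q (Suc k)) - G (q k))) = \<phi> L - \<phi> 0"
    by (simp add: sum_lessThan_telescope)
  then show ?thesis by (simp add: \<phi>_def q(2,3))
qed

text \<open>Refining the partition does not change an elementary integral. The integrand is read at
  the right end of the cell because the intervals of a simple process are open on the left;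
  \<open>simple_process_predictable\<close> shows that this value is known at the left end.\<close>

lemma simple_integral_grid:
  fixes q :: "nat \<Rightarrow> real"
  assumes q: "mono q" "q 0 = s" "q L = t" "\<And>k. s \<le> q k" "\<And>k. q k \<le> t"
    and \<tau>: "mono \<tau>" "\<And>k x. x \<in> \<tau> ` {..m} \<Longrightarrow> q k < x \<Longrightarrow> q (Suc k) \<le> x"
  shows "grid_integral q (\<lambda>k. simple_process m \<tau> \<xi> (q (Suc k))) W L \<omega> =
    simple_integral m \<tau> \<xi> W t \<omega> - simple_integral m \<tau> \<xi> W s \<omega>"
proof -
  have "grid_integral q (\<lambda>k. simple_process m \<tau> \<xi> (q (Suc k))) W L \<omega> =
    (\<Sum>j<m. \<Sum>k<L. \<xi> j \<omega> * (indicator {\<tau> j<..\<tau> (Suc j)} (q (Suc k)) * (W (q (Suc k)) \<omega> - W (q k) \<omega>)))"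
    unfolding grid_integral_def simple_process_def sum_distrib_right
    by (subst sum.swap) (simp add: mult_ac)
  also have "\<dots> = (\<Sum>j<m. \<xi> j \<omega> * ((W (min t (\<tau> (Suc j))) \<omega> - W (min t (\<tau> j)) \<omega>)
      - (W (min s (\<tau> (Suc j))) \<omega> - W (min s (\<tau> j)) \<omega>)))"
    unfolding sum_distrib_left[symmetric]
  proof (intro sum.cong refl arg_cong2[where f="(*)"])
    fix j assume "j \<in> {..<m}"
    then show "(\<Sum>k<L. indicator {\<tau> j<..\<tau> (Suc j)} (q (Suc k)) * (W (q (Suc k)) \<omega> - W (q k) \<omega>)) =
      W (min t (\<tau> (Suc j))) \<omega> - W (min t (\<tau> j)) \<omega> - (W (min s (\<tau> (Suc j))) \<omega> - W (min s (\<tau> j)) \<omega>)"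
      by (intro interval_increment_grid[OF q, where G="\<lambda>t. W t \<omega>"] monoD[OF \<tau>(1)] \<tau>(2)) auto
  qed
  also have "\<dots> = simple_integral m \<tau> \<xi> W t \<omega> - simple_integral m \<tau> \<xi> W s \<omega>"
    by (simp add: simple_integral_def sum_subtractf[symmetric] right_diff_distrib)
  finally show ?thesis .
qed

lemma simple_process_const:
  assumes "\<And>x. x \<in> \<tau> ` {..m} \<Longrightarrow> a < x \<Longrightarrow> b \<le> x" "a < u" "u \<le> b"
  shows "simple_process m \<tau> \<xi> u \<omega> = simple_process m \<tau> \<xi> b \<omega>"
  unfolding simple_process_def
proof (intro sum.cong refl)
  fix j assume "j \<in> {..<m}"
  then have "a < \<tau> j \<Longrightarrow> b \<le> \<tau> j" "a < \<tau> (Suc j) \<Longrightarrow> b \<le> \<tau> (Suc j)"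
    using assms(1)[of "\<tau> j"] assms(1)[of "\<tau> (Suc j)"] by auto
  then have "u \<in> {\<tau> j<..\<tau> (Suc j)} \<longleftrightarrow> b \<in> {\<tau> j<..\<tau> (Suc j)}"
    using assms(2,3) by (cases "a < \<tau> j"; cases "a < \<tau> (Suc j)") auto
  then show "indicator {\<tau> j<..\<tau> (Suc j)} u * \<xi> j \<omega> = indicator {\<tau> j<..\<tau> (Suc j)} b * \<xi> j \<omega>"
    by (simp add: indicator_def)
qed

section \<open>Convergence of expectations under second moment bounds\<close>

context prob_space
begin

text \<open>A bound in L2 gives uniform integrability. Fatou's lemma carries the bound to the limit.
  For the expectations the distance is truncated at K: the truncated part converges by domination,
  and beyond K the distance is at most its square divided by K.\<close>

lemma L2_bounded_expectation_tendsto: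
  fixes U :: "nat \<Rightarrow> 'a \<Rightarrow> real"
  assumes [measurable]: "\<And>N. U N \<in> borel_measurable M" "u \<in> borel_measurable M"
    and ae: "AE \<omega> in M. (\<lambda>N. U N \<omega>) \<longlonglongrightarrow> u \<omega>"
    and int: "\<And>N. integrable M (\<lambda>\<omega>. (U N \<omega>)\<^sup>2)" and C: "\<And>N. expectation (\<lambda>\<omega>. (U N \<omega>)\<^sup>2) \<le> C"
  shows "integrable M (\<lambda>\<omega>. (u \<omega>)\<^sup>2)" and "expectation (\<lambda>\<omega>. (u \<omega>)\<^sup>2) \<le> C"
    and "(\<lambda>N. expectation (U N)) \<longlonglongrightarrow> expectation u"
proof -
  have C0: "0 \<le> C" using C[of 0] by (rule order.trans[rotated]) simp
  have "(\<integral>\<^sup>+\<omega>. ennreal ((u \<omega>)\<^sup>2) \<partial>M) = (\<integral>\<^sup>+\<omega>. liminf (\<lambda>N. ennreal ((U N \<omega>)\<^sup>2)) \<partial>M)"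
  proof (intro nn_integral_cong_AE)
    show "AE \<omega> in M. ennreal ((u \<omega>)\<^sup>2) = liminf (\<lambda>N. ennreal ((U N \<omega>)\<^sup>2))"
      using ae
    proof eventually_elim
      case (elim \<omega>)
      then have "(\<lambda>N. ennreal ((U N \<omega>)\<^sup>2)) \<longlonglongrightarrow> ennreal ((u \<omega>)\<^sup>2)"
        by (intro tendsto_intros)
      then show ?case using lim_imp_Liminf[OF sequentially_bot] by metis
    qed
  qed
  also have "\<dots> \<le> liminf (\<lambda>N. \<integral>\<^sup>+\<omega>. ennreal ((U N \<omega>)\<^sup>2) \<partial>M)"
    by (rule nn_integral_liminf) simp
  also have "\<dots> \<le> liminf (\<lambda>N::nat. ennreal C)"
    by (intro Liminf_mono always_eventually allI)
       (use C in \<open>simp add: nn_integral_eq_integral[OF int] ennreal_leI\<close>)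
  also have "\<dots> = ennreal C" by (rule Liminf_const) simp
  finally have le: "(\<integral>\<^sup>+\<omega>. ennreal ((u \<omega>)\<^sup>2) \<partial>M) \<le> ennreal C" .
  then show iu: "integrable M (\<lambda>\<omega>. (u \<omega>)\<^sup>2)"
    by (intro integrableI_bounded) (auto intro: le_less_trans)
  with le C0 show Cu: "expectation (\<lambda>\<omega>. (u \<omega>)\<^sup>2) \<le> C"
    by (simp add: nn_integral_eq_integral)
  have abs_le: "\<bar>x\<bar> \<le> 1 + x\<^sup>2" for x :: real
    using sum_squares_bound[of 1 "\<bar>x\<bar>"] by simp
  have i1: "integrable M (U N)" for N
    by (rule Bochner_Integration.integrable_bound[where f="\<lambda>\<omega>. 1 + (U N \<omega>)\<^sup>2"]) (use int abs_le in auto)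
  have i2: "integrable M u"
    by (rule Bochner_Integration.integrable_bound[where f="\<lambda>\<omega>. 1 + (u \<omega>)\<^sup>2"]) (use iu abs_le in auto)
  have bd: "\<bar>expectation (U N) - expectation u\<bar> \<le>
      expectation (\<lambda>\<omega>. min K \<bar>U N \<omega> - u \<omega>\<bar>) + 4 * C / K" if K: "K > 0" for N and K :: real
  proof -
    have pt: "\<bar>x - y\<bar> \<le> min K \<bar>x - y\<bar> + (2 * x\<^sup>2 + 2 * y\<^sup>2) / K" for x y :: real
    proof (cases "\<bar>x - y\<bar> \<le> K")
      case True
      then show ?thesis using K by simp
    next
      case False
      then have "K * \<bar>x - y\<bar> \<le> \<bar>x - y\<bar> * \<bar>x - y\<bar>" by (intro mult_right_mono) auto
      also have "\<dots> = (x - y)\<^sup>2" by (simp add: power2_eq_square)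
      also have "\<dots> \<le> 2 * x\<^sup>2 + 2 * y\<^sup>2"
        using zero_le_power2[of "x + y"] by (simp add: power2_sum power2_diff)
      finally have "\<bar>x - y\<bar> \<le> (2 * x\<^sup>2 + 2 * y\<^sup>2) / K" using K by (simp add: field_simps)
      then show ?thesis using K by (simp add: min_def)
    qed
    have im: "integrable M (\<lambda>\<omega>. min K \<bar>U N \<omega> - u \<omega>\<bar>)"
      by (rule integrable_bounded[where b=K]) (use K in auto)
    have i3: "integrable M (\<lambda>\<omega>. (2 * (U N \<omega>)\<^sup>2 + 2 * (u \<omega>)\<^sup>2) / K)" using int iu by simp
    have "\<bar>expectation (U N) - expectation u\<bar> = \<bar>expectation (\<lambda>\<omega>. U N \<omega> - u \<omega>)\<bar>"
      using i1 i2 by simp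
    also have "\<dots> \<le> expectation (\<lambda>\<omega>. \<bar>U N \<omega> - u \<omega>\<bar>)" by (rule integral_abs_bound)
    also have "\<dots> \<le> expectation (\<lambda>\<omega>. min K \<bar>U N \<omega> - u \<omega>\<bar> + (2 * (U N \<omega>)\<^sup>2 + 2 * (u \<omega>)\<^sup>2) / K)"
      using i1 i2 im i3 pt by (intro integral_mono) auto
    also have "\<dots> = expectation (\<lambda>\<omega>. min K \<bar>U N \<omega> - u \<omega>\<bar>)
        + (2 * expectation (\<lambda>\<omega>. (U N \<omega>)\<^sup>2) + 2 * expectation (\<lambda>\<omega>. (u \<omega>)\<^sup>2)) / K"
      using im i3 int iu by simp
    also have "\<dots> \<le> expectation (\<lambda>\<omega>. min K \<bar>U N \<omega> - u \<omega>\<bar>) + (2 * C + 2 * C) / K"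
      using C[of N] Cu K by (intro add_left_mono divide_right_mono) auto
    finally show ?thesis by simp
  qed
  have lim: "(\<lambda>N. expectation (\<lambda>\<omega>. min K \<bar>U N \<omega> - u \<omega>\<bar>)) \<longlonglongrightarrow> 0" if K: "K > 0" for K :: real
  proof -
    have "(\<lambda>N. expectation (\<lambda>\<omega>. min K \<bar>U N \<omega> - u \<omega>\<bar>)) \<longlonglongrightarrow> expectation (\<lambda>\<omega>. 0)"
    proof (rule integral_dominated_convergence[where w="\<lambda>_. K"])
      show "AE \<omega> in M. (\<lambda>N. min K \<bar>U N \<omega> - u \<omega>\<bar>) \<longlonglongrightarrow> 0"
        using ae
      proof eventually_elim
        case (elim \<omega>)
        then have "(\<lambda>N. min K \<bar>U N \<omega> - u \<omega>\<bar>) \<longlonglongrightarrow> min K \<bar>u \<omega> - u \<omega>\<bar>"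
          by (intro tendsto_intros)
        then show ?case using K by simp
      qed
    qed (use K in auto)
    then show ?thesis by simp
  qed
  show "(\<lambda>N. expectation (U N)) \<longlonglongrightarrow> expectation u"
  proof (rule LIMSEQ_I)
    fix r :: real assume r: "0 < r"
    \<comment> \<open>Chosen such that 4 C / K < r / 2; adding 1 keeps K positive if C = 0.\<close>
    define K where "K = 8 * (C + 1) / r"
    have K: "0 < K" using r C0 by (simp add: K_def)
    have "4 * C / K < r / 2 + r / 2 * 0" using r C0 by (simp add: K_def field_simps)
    moreover obtain N0 where "\<forall>N\<ge>N0. norm (expectation (\<lambda>\<omega>. min K \<bar>U N \<omega> - u \<omega>\<bar>) - 0) < r / 2"
      using LIMSEQ_D[OF lim[OF K], of "r / 2"] r by auto
    ultimately have "norm (expectation (U N) - expectation u) < r" if "N \<ge> N0" for N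
      using bd[OF K, of N] that by fastforce
    then show "\<exists>N0. \<forall>N\<ge>N0. norm (expectation (U N) - expectation u) < r" by blast
  qed
qed

end

definition clip :: "real \<Rightarrow> real \<Rightarrow> real \<Rightarrow> real" where
  "clip a b x = max a (min b x)"

lemma clip_bounds: "a \<le> b \<Longrightarrow> a \<le> clip a b x" "a \<le> b \<Longrightarrow> clip a b x \<le> b"
  by (auto simp: clip_def)

text \<open>Applied with y the value of H, this bounds the change made by clipping a simple process
  by its approximation error.\<close>

lemma clip_dist_le: "a \<le> y \<Longrightarrow> y \<le> b \<Longrightarrow> \<bar>clip a b x - x\<bar> \<le> \<bar>x - y\<bar>"
  by (auto simp: clip_def)

lemma clip_measurable [measurable]: "clip a b \<in> borel_measurable borel"
  unfolding clip_def by measurable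

text \<open>The triangle inequality for the metric of convergence in probability, with the signs in
  which the three errors of \<open>approximant_tendsto\<close> occur.\<close>

lemma min_abs_add_le: "min 1 \<bar>x + y - z\<bar> \<le> min 1 \<bar>x\<bar> + min 1 \<bar>y\<bar> + min 1 \<bar>z\<bar>" for x y z :: real
  by (cases "\<bar>x\<bar> \<le> 1"; cases "\<bar>y\<bar> \<le> 1"; cases "\<bar>z\<bar> \<le> 1") auto

lemma simple_process_bounded:
  assumes "simple_data F m \<tau> \<xi>" "\<And>t. space (F t) = \<Omega>"
  obtains b where "\<And>t \<omega>. \<omega> \<in> \<Omega> \<Longrightarrow> \<bar>simple_process m \<tau> \<xi> t \<omega>\<bar> \<le> b"
proof -
  have "\<forall>j. \<exists>B. j < m \<longrightarrow> (\<forall>\<omega>\<in>\<Omega>. \<bar>\<xi> j \<omega>\<bar> \<le> B)"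
    using assms by (auto simp: simple_data_def)
  then obtain B where B: "\<And>j \<omega>. j < m \<Longrightarrow> \<omega> \<in> \<Omega> \<Longrightarrow> \<bar>\<xi> j \<omega>\<bar> \<le> B j" by metis
  show thesis
  proof (rule that)
    fix t \<omega> assume w: "\<omega> \<in> \<Omega>"
    have "\<bar>simple_process m \<tau> \<xi> t \<omega>\<bar> \<le> (\<Sum>j<m. \<bar>indicator {\<tau> j<..\<tau> (Suc j)} t * \<xi> j \<omega>\<bar>)"
      unfolding simple_process_def by (rule sum_abs)
    also have "\<dots> \<le> (\<Sum>j<m. B j)"
    proof (rule sum_mono)
      fix j assume "j \<in> {..<m}"
      then have "\<bar>\<xi> j \<omega>\<bar> \<le> B j" using B w by auto
      then show "\<bar>indicator {\<tau> j<..\<tau> (Suc j)} t * \<xi> j \<omega>\<bar> \<le> B j"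
        by (auto simp: indicator_def)
    qed
    finally show "\<bar>simple_process m \<tau> \<xi> t \<omega>\<bar> \<le> (\<Sum>j<m. B j)" .
  qed
qed

context usual_filtration
begin

lemma adapted_measurable: "adapted F Z \<Longrightarrow> 0 \<le> t \<Longrightarrow> Z t \<in> borel_measurable M"
  by (auto simp: adapted_def intro: borel_measurable_F)

lemma simple_integral_measurable:
  assumes W: "brownian_motion M F W" and sd: "simple_data F m \<tau> \<xi>" and t: "0 \<le> t"
  shows "simple_integral m \<tau> \<xi> W t \<in> borel_measurable M"
  unfolding simple_integral_def[abs_def]
proof (intro borel_measurable_sum borel_measurable_times borel_measurable_diff)
  fix j assume j: "j \<in> {..<m}"
  have nn: "0 \<le> \<tau> i" for i using sd monoD[of \<tau> 0 i] by (auto simp: simple_data_def)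
  show "\<xi> j \<in> borel_measurable M"
    using sd j borel_measurable_F by (auto simp: simple_data_def)
  show "W (min t (\<tau> (Suc j))) \<in> borel_measurable M" "W (min t (\<tau> j)) \<in> borel_measurable M"
    using nn t by (auto intro!: bm_measurable_M[OF W])
qed

text \<open>Progressive measurability provides joint measurability on [0, t] only, hence the
  restriction of Lebesgue measure to that interval; the rest is the measurability part of Tonelli's
  theorem, after exchanging the coordinates.\<close>

lemma approximation_error_measurable:
  assumes H: "progressive F H" and sd: "simple_data F m \<tau> \<xi>" and t: "0 \<le> t"
  shows "(\<lambda>\<omega>. \<integral>\<^sup>+s\<in>{0..t}. ennreal ((simple_process m \<tau> \<xi> s \<omega> - H s \<omega>)\<^sup>2) \<partial>lborel) \<in> borel_measurable M"
proof -
  define R :: "real measure" where "R = restrict_space lborel {0..t}"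
  interpret R: sigma_finite_measure R
    unfolding R_def by (rule sigma_finite_measure_restrict_space) (auto simp: lborel.sigma_finite_measure_axioms)
  have R_sets: "sets R = sets (restrict_space borel {0..t})" unfolding R_def by (rule sets_restrict_space_cong) simp
  have id: "(\<lambda>\<omega>. \<omega>) \<in> M \<rightarrow>\<^sub>M F t"
    using sets_F_subset[of t] sets.sets_into_space[of _ "F t"] by (intro measurableI) (auto simp: Int_absorb2)
  have Hm: "(\<lambda>(s, \<omega>). H s \<omega>) \<in> borel_measurable (restrict_space borel {0..t} \<Otimes>\<^sub>M F t)"
    using H t by (simp add: progressive_def)
  have sw: "(\<lambda>p. (snd p, fst p)) \<in> M \<Otimes>\<^sub>M R \<rightarrow>\<^sub>M restrict_space borel {0..t} \<Otimes>\<^sub>M F t"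
  proof (rule measurable_Pair)
    show "(\<lambda>p. snd p) \<in> M \<Otimes>\<^sub>M R \<rightarrow>\<^sub>M restrict_space borel {0..t}"
      using measurable_snd[of M R] R_sets by (simp cong: measurable_cong_sets)
    show "(\<lambda>p. fst p) \<in> M \<Otimes>\<^sub>M R \<rightarrow>\<^sub>M F t"
      by (rule measurable_compose[OF measurable_fst id])
  qed
  have H1: "(\<lambda>p. H (snd p) (fst p)) \<in> borel_measurable (M \<Otimes>\<^sub>M R)"
    using measurable_compose[OF sw Hm] by simp
  have S1: "(\<lambda>p. simple_process m \<tau> \<xi> (snd p) (fst p)) \<in> borel_measurable (M \<Otimes>\<^sub>M R)"
    unfolding simple_process_def
  proof (intro borel_measurable_sum borel_measurable_times)
    fix j assume "j \<in> {..<m}"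
    then have "\<xi> j \<in> borel_measurable M" using sd borel_measurable_F by (auto simp: simple_data_def)
    then show "(\<lambda>p. \<xi> j (fst p)) \<in> borel_measurable (M \<Otimes>\<^sub>M R)" by (rule measurable_compose[OF measurable_fst])
    have "indicat_real {\<tau> j<..\<tau> (Suc j)} \<in> borel_measurable R"
      unfolding R_def by (rule measurable_restrict_space1) simp
    then show "(\<lambda>p. indicat_real {\<tau> j<..\<tau> (Suc j)} (snd p)) \<in> borel_measurable (M \<Otimes>\<^sub>M R)"
      by (rule measurable_compose[OF measurable_snd])
  qed
  have "(\<lambda>\<omega>. \<integral>\<^sup>+s. ennreal ((simple_process m \<tau> \<xi> s \<omega> - H s \<omega>)\<^sup>2) \<partial>R) \<in> borel_measurable M"
    by (rule R.borel_measurable_nn_integral) (use H1 S1 in \<open>simp add: case_prod_beta'\<close>)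
  then show ?thesis unfolding R_def by (simp add: nn_integral_restrict_space)
qed

text \<open>No partition point lies strictly between a and b. So a partition interval containing b
  starts at or before a, and its coefficient is known at time a.\<close>

lemma simple_process_predictable:
  assumes sd: "simple_data F m \<tau> \<xi>" and nb: "\<And>x. x \<in> \<tau> ` {..m} \<Longrightarrow> a < x \<Longrightarrow> b \<le> x"
  shows "simple_process m \<tau> \<xi> b \<in> borel_measurable (F a)"
  unfolding simple_process_def[abs_def]
proof (intro borel_measurable_sum)
  fix j assume j: "j \<in> {..<m}"
  show "(\<lambda>\<omega>. indicator {\<tau> j<..\<tau> (Suc j)} b * \<xi> j \<omega>) \<in> borel_measurable (F a)"
  proof (cases "\<tau> j \<le> a")
    case True
    have "\<xi> j \<in> borel_measurable (F (\<tau> j))" using sd j by (auto simp: simple_data_def)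
    from borel_measurable_F_mono[OF this True] show ?thesis by simp
  next
    case False
    then have "b \<le> \<tau> j" using nb[of "\<tau> j"] j by auto
    then have "indicator {\<tau> j<..\<tau> (Suc j)} b = (0::real)" by (simp add: indicator_def)
    then show ?thesis by simp
  qed
qed

text \<open>The left side is the integral of a step function. On each cell S is constant and H lies
  between a and b, so the step function is dominated pointwise by the squared error, with no loss of
  constants.\<close>

lemma clipped_approximation_error:
  fixes q :: "nat \<Rightarrow> real" and \<xi> :: "nat \<Rightarrow> 'b \<Rightarrow> real"
  assumes q: "mono q" "\<And>k. 0 \<le> q k" "\<And>k. q k \<le> t"
    and nb: "\<And>k x. x \<in> \<tau> ` {..m} \<Longrightarrow> q k < x \<Longrightarrow> q (Suc k) \<le> x"
    and H: "\<And>u. 0 \<le> u \<Longrightarrow> a \<le> H u \<omega> \<and> H u \<omega> \<le> b"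
  defines "S \<equiv> \<lambda>u. simple_process m \<tau> \<xi> u \<omega>"
  shows "ennreal (\<Sum>k<L. (clip a b (S (q (Suc k))) - S (q (Suc k)))\<^sup>2 * (q (Suc k) - q k)) \<le>
    (\<integral>\<^sup>+u\<in>{0..t}. ennreal ((S u - H u \<omega>)\<^sup>2) \<partial>lborel)"
proof -
  define e where "e k = (clip a b (S (q (Suc k))) - S (q (Suc k)))\<^sup>2" for k
  have qs: "q k \<le> q (Suc k)" for k using q(1) by (simp add: monoD)
  have "ennreal (\<Sum>k<L. e k * (q (Suc k) - q k)) = (\<Sum>k<L. ennreal (e k * (q (Suc k) - q k)))"
    using qs by (intro sum_ennreal[symmetric]) (auto simp: e_def)
  also have "\<dots> = (\<Sum>k<L. \<integral>\<^sup>+u. ennreal (e k) * indicator {q k<..q (Suc k)} u \<partial>lborel)"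
    using qs by (intro sum.cong refl) (simp add: nn_integral_cmult_indicator ennreal_mult' e_def)
  also have "\<dots> = (\<integral>\<^sup>+u. (\<Sum>k<L. ennreal (e k) * indicator {q k<..q (Suc k)} u) \<partial>lborel)"
    by (intro nn_integral_sum[symmetric]) simp
  also have "\<dots> \<le> (\<integral>\<^sup>+u\<in>{0..t}. ennreal ((S u - H u \<omega>)\<^sup>2) \<partial>lborel)"
  proof (rule nn_integral_mono)
    fix u :: real
    show "(\<Sum>k<L. ennreal (e k) * indicator {q k<..q (Suc k)} u) \<le>
      ennreal ((S u - H u \<omega>)\<^sup>2) * indicator {0..t} u"
    proof (cases "\<exists>k<L. u \<in> {q k<..q (Suc k)}")
      case False
      then have "(\<Sum>k<L. ennreal (e k) * indicator {q k<..q (Suc k)} u) = 0"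
        by (intro sum.neutral) (auto simp: indicator_def)
      then show ?thesis by simp
    next
      case True
      then obtain k where k: "k < L" "u \<in> {q k<..q (Suc k)}" by blast
      have uniq: "u \<notin> {q l<..q (Suc l)}" if "l \<noteq> k" for l
        using that k(2) monoD[OF q(1), of "Suc l" k] monoD[OF q(1), of "Suc k" l]
        by (cases l k rule: linorder_cases) auto
      have "(\<Sum>l<L. ennreal (e l) * indicator {q l<..q (Suc l)} u) = (\<Sum>l<L. if l = k then ennreal (e k) else 0)"
      proof (intro sum.cong refl)
        fix l show "ennreal (e l) * indicator {q l<..q (Suc l)} u = (if l = k then ennreal (e k) else 0)"
          using k(2) uniq[of l] by (cases "l = k") (simp_all add: indicator_def del: greaterThanAtMost_iff)
      qed
      also have "\<dots> = ennreal (e k)" using k(1) by simp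
      finally have sum_eq: "(\<Sum>l<L. ennreal (e l) * indicator {q l<..q (Suc l)} u) = ennreal (e k)" .
      have "e k \<le> (S u - H u \<omega>)\<^sup>2"
      proof -
        have "S u = S (q (Suc k))"
          unfolding S_def using k(2) by (intro simple_process_const[where a="q k"] nb) auto
        moreover have "0 \<le> u" using k(2) q(2)[of k] by auto
        ultimately have "\<bar>clip a b (S (q (Suc k))) - S (q (Suc k))\<bar> \<le> \<bar>S u - H u \<omega>\<bar>"
          using clip_dist_le[of a "H u \<omega>" b "S u"] H[of u] by simp
        then show ?thesis unfolding e_def by (simp add: abs_le_square_iff)
      qed
      then show ?thesis unfolding sum_eq
        using k(2) q(2)[of k] q(3)[of "Suc k"] by (simp add: indicator_def ennreal_leI)
    qed
  qed
  finally show ?thesis by (simp add: e_def)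
qed

text \<open>The truncated expectations turn convergence in probability into convergence in L1, which
  adds up over several errors and yields almost surely convergent subsequences.\<close>

lemma null_in_probability_expectation_min:
  fixes U :: "nat \<Rightarrow> 'a \<Rightarrow> real"
  assumes [measurable]: "\<And>N. U N \<in> borel_measurable M"
    and U: "null_in_probability M (\<lambda>N \<omega>. ennreal \<bar>U N \<omega>\<bar>)"
  shows "(\<lambda>N. expectation (\<lambda>\<omega>. min 1 \<bar>U N \<omega>\<bar>)) \<longlonglongrightarrow> 0"
proof (rule LIMSEQ_I)
  fix r :: real assume r: "0 < r"
  have "(\<lambda>N. prob {\<omega>\<in>space M. ennreal (r / 2) < ennreal \<bar>U N \<omega>\<bar>}) \<longlonglongrightarrow> 0"
    using U r by (simp add: null_in_probability_def)
  then obtain N0 where N0: "\<And>N. N \<ge> N0 \<Longrightarrow> prob {\<omega>\<in>space M. ennreal (r / 2) < ennreal \<bar>U N \<omega>\<bar>} < r / 2"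
    using LIMSEQ_D[of _ 0 "r / 2"] r by fastforce
  have "norm (expectation (\<lambda>\<omega>. min 1 \<bar>U N \<omega>\<bar>) - 0) < r" if N: "N \<ge> N0" for N
  proof -
    define A where "A = {\<omega>\<in>space M. ennreal (r / 2) < ennreal \<bar>U N \<omega>\<bar>}"
    have A [measurable]: "A \<in> events" unfolding A_def by measurable
    have iA: "integrable M (indicat_real A)"
      by (rule integrable_bounded[where b=1]) (auto simp: indicator_def)
    have "expectation (\<lambda>\<omega>. min 1 \<bar>U N \<omega>\<bar>) \<le> expectation (\<lambda>\<omega>. indicator A \<omega> + r / 2)"
    proof (rule integral_mono)
      show "integrable M (\<lambda>\<omega>. min 1 \<bar>U N \<omega>\<bar>)" by (rule integrable_bounded[where b=1]) auto
      fix \<omega> assume "\<omega> \<in> space M"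
      then show "min 1 \<bar>U N \<omega>\<bar> \<le> indicator A \<omega> + r / 2"
        using r by (auto simp: A_def indicator_def not_less ennreal_le_iff)
    qed (use iA in simp)
    also have "\<dots> = prob A + r / 2" using iA A by (simp add: prob_space)
    also have "\<dots> < r" using N0[OF N] by (simp add: A_def)
    finally show ?thesis by (simp add: abs_of_nonneg)
  qed
  then show "\<exists>N0. \<forall>N\<ge>N0. norm (expectation (\<lambda>\<omega>. min 1 \<bar>U N \<omega>\<bar>) - 0) < r" by blast
qed

end

text \<open>A step of the approximation of \<open>\<integral> H dW\<close> on \<open>[s, t]\<close>: the grid \<open>q N\<close> refines the
  partition of the \<open>N\<close>th simple process. Clipping the integrand to \<open>[a, b]\<close>, where \<open>H\<close> takes its
  values, does not change the limit and makes the approximating integrands uniformly bounded above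
  and below.\<close>

locale clipped_approximation = usual_filtration M F for M :: "'a measure" and F +
  fixes H W I :: "real \<Rightarrow> 'a \<Rightarrow> real"
    and m :: "nat \<Rightarrow> nat" and \<tau> :: "nat \<Rightarrow> nat \<Rightarrow> real" and \<xi> :: "nat \<Rightarrow> nat \<Rightarrow> 'a \<Rightarrow> real"
    and q :: "nat \<Rightarrow> nat \<Rightarrow> real" and L :: "nat \<Rightarrow> nat" and s t a b :: real
  assumes W: "brownian_motion M F W" and H: "progressive F H" and I: "adapted F I"
    and sd: "\<And>N. simple_data F (m N) (\<tau> N) (\<xi> N)"
    and H_lim: "\<And>t. 0 \<le> t \<Longrightarrow> null_in_probability M (\<lambda>N \<omega>. \<integral>\<^sup>+s\<in>{0..t}.
             ennreal ((simple_process (m N) (\<tau> N) (\<xi> N) s \<omega> - H s \<omega>)\<^sup>2) \<partial>lborel)"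
    and I_lim: "\<And>t. 0 \<le> t \<Longrightarrow> null_in_probability M (\<lambda>N \<omega>.
             ennreal \<bar>simple_integral (m N) (\<tau> N) (\<xi> N) W t \<omega> - I t \<omega>\<bar>)"
    and ab: "0 \<le> a" "a \<le> b" and H_bounds: "AE \<omega> in M. \<forall>u\<ge>0. a \<le> H u \<omega> \<and> H u \<omega> \<le> b"
    and st: "0 \<le> s" "s \<le> t"
    and q_mono: "\<And>N. mono (q N)" and q_0: "\<And>N. q N 0 = s" and q_L: "\<And>N. q N (L N) = t"
    and q_ge: "\<And>N k. s \<le> q N k" and q_le: "\<And>N k. q N k \<le> t"
    and q_refines: "\<And>N k x. x \<in> \<tau> N ` {..m N} \<Longrightarrow> q N k < x \<Longrightarrow> q N (Suc k) \<le> x"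
begin

definition integrand :: "nat \<Rightarrow> nat \<Rightarrow> 'a \<Rightarrow> real" where
  "integrand N k \<omega> = clip a b (simple_process (m N) (\<tau> N) (\<xi> N) (q N (Suc k)) \<omega>)"

abbreviation approximant :: "nat \<Rightarrow> 'a \<Rightarrow> real" where
  "approximant N \<equiv> grid_integral (q N) (integrand N) W (L N)"

lemma integrand_bounds: "a \<le> integrand N k \<omega>" "integrand N k \<omega> \<le> b"
  using ab by (auto simp: integrand_def clip_bounds)

lemma simple_process_grid_measurable:
  "simple_process (m N) (\<tau> N) (\<xi> N) (q N (Suc k)) \<in> borel_measurable (F (q N k))"
  by (rule simple_process_predictable[OF sd q_refines])

lemma grid_data_integrand: "grid_data F (q N) (integrand N) b"
  unfolding grid_data_def
proof (intro conjI allI ballI)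
  show "mono (q N)" "0 \<le> q N 0" using q_mono q_0 st by auto
  show "integrand N k \<in> borel_measurable (F (q N k))" for k
    unfolding integrand_def[abs_def]
    by (rule measurable_compose[OF simple_process_grid_measurable clip_measurable])
  show "\<bar>integrand N k \<omega>\<bar> \<le> b" for k \<omega> using integrand_bounds[of N k \<omega>] ab by auto
qed

lemma approximant_measurable [measurable]: "approximant N \<in> borel_measurable M"
  by (rule borel_measurable_F[OF grid_integral_measurable[OF W grid_data_integrand]])

lemma increment_measurable [measurable]: "(\<lambda>\<omega>. I t \<omega> - I s \<omega>) \<in> borel_measurable M"
  using st by (intro borel_measurable_diff adapted_measurable[OF I]) auto

text \<open>By \<open>grid_integral_lenglart\<close> it suffices that the quadratic variation of the
  clipping error is small in probability. \<open>clipped_approximation_error\<close> bounds it by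
  the squared L2 distance between the simple process and H. The level \<open>\<eta>\<close> is
  chosen with sqrt \<eta> = r / 2.\<close>

lemma clipping_error_tendsto:
  "(\<lambda>N. expectation (\<lambda>\<omega>. min 1 \<bar>grid_integral (q N) (\<lambda>k \<omega>. integrand N k \<omega> -
     simple_process (m N) (\<tau> N) (\<xi> N) (q N (Suc k)) \<omega>) W (L N) \<omega>\<bar>)) \<longlonglongrightarrow> 0"
  (is "(\<lambda>N. expectation (\<lambda>\<omega>. min 1 \<bar>?G N \<omega>\<bar>)) \<longlonglongrightarrow> 0")
proof (rule LIMSEQ_I)
  fix r :: real assume r: "0 < r"
  define \<eta> where "\<eta> = (r / 2)\<^sup>2"
  have \<eta>: "0 < \<eta>" "sqrt \<eta> = r / 2" using r by (auto simp: \<eta>_def)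
  have t0: "0 \<le> t" using st by simp
  define Y where "Y N \<omega> = (\<integral>\<^sup>+s\<in>{0..t}.
    ennreal ((simple_process (m N) (\<tau> N) (\<xi> N) s \<omega> - H s \<omega>)\<^sup>2) \<partial>lborel)" for N \<omega>
  have [measurable]: "Y N \<in> borel_measurable M" for N
    unfolding Y_def[abs_def] by (rule approximation_error_measurable[OF H sd t0])
  have "(\<lambda>N. prob {\<omega>\<in>space M. ennreal \<eta> < Y N \<omega>}) \<longlonglongrightarrow> 0"
    using H_lim[OF t0] \<eta> by (simp add: null_in_probability_def Y_def)
  then obtain N0 where N0: "\<And>N. N \<ge> N0 \<Longrightarrow> prob {\<omega>\<in>space M. ennreal \<eta> < Y N \<omega>} < r / 2"
    using LIMSEQ_D[of _ 0 "r / 2"] r by fastforce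
  have "norm (expectation (\<lambda>\<omega>. min 1 \<bar>?G N \<omega>\<bar>) - 0) < r" if N: "N \<ge> N0" for N
  proof -
    define S where "S k = simple_process (m N) (\<tau> N) (\<xi> N) (q N (Suc k))" for k
    define e where "e k \<omega> = integrand N k \<omega> - S k \<omega>" for k \<omega>
    obtain B where B: "\<And>t \<omega>. \<omega> \<in> space M \<Longrightarrow> \<bar>simple_process (m N) (\<tau> N) (\<xi> N) t \<omega>\<bar> \<le> B"
      using simple_process_bounded[OF sd space_F_eq] by blast
    note gi = grid_data_integrand[of N]
    \<comment> \<open>The bound B depends on N, which is harmless: it does not occur in the estimate
      of \<open>grid_integral_lenglart\<close>.\<close>
    have ge: "grid_data F (q N) e (b + B)"
      unfolding grid_data_def
    proof (intro conjI allI ballI)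
      show "mono (q N)" "0 \<le> q N 0" using q_mono q_0 st by auto
      show "e k \<in> borel_measurable (F (q N k))" for k
        unfolding e_def[abs_def] S_def using grid_dataD(4)[OF gi] simple_process_grid_measurable by auto
      show "\<bar>e k \<omega>\<bar> \<le> b + B" if "\<omega> \<in> space (F (q N k))" for k \<omega>
        using grid_dataD(5)[OF gi, of \<omega> k] B[of \<omega> "q N (Suc k)"] that by (simp add: e_def S_def)
    qed
    have [measurable]: "e k \<in> borel_measurable M" for k
      by (rule borel_measurable_F[OF grid_dataD(4)[OF ge]])
    have "expectation (\<lambda>\<omega>. min 1 \<bar>?G N \<omega>\<bar>) \<le>
      prob {\<omega>\<in>space M. \<eta> < (\<Sum>k<L N. (e k \<omega>)\<^sup>2 * (q N (Suc k) - q N k))} + sqrt \<eta>"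
      using grid_integral_lenglart[OF W ge, of \<eta> "L N"] \<eta>(1) by (simp add: e_def[abs_def] S_def)
    also have "prob {\<omega>\<in>space M. \<eta> < (\<Sum>k<L N. (e k \<omega>)\<^sup>2 * (q N (Suc k) - q N k))} \<le>
      prob {\<omega>\<in>space M. ennreal \<eta> < Y N \<omega>}"
    proof (rule finite_measure_mono_AE)
      show "AE \<omega> in M. \<omega> \<in> {\<omega>\<in>space M. \<eta> < (\<Sum>k<L N. (e k \<omega>)\<^sup>2 * (q N (Suc k) - q N k))} \<longrightarrow>
        \<omega> \<in> {\<omega>\<in>space M. ennreal \<eta> < Y N \<omega>}"
        using H_bounds
      proof eventually_elim
        case (elim \<omega>)
        have "ennreal (\<Sum>k<L N. (e k \<omega>)\<^sup>2 * (q N (Suc k) - q N k)) \<le> Y N \<omega>"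
          unfolding e_def S_def Y_def integrand_def
          using elim st order.trans[OF st(1) q_ge]
          by (intro clipped_approximation_error q_mono q_le q_refines) auto
        then show ?case using \<eta> by (auto intro: less_le_trans[rotated] simp: ennreal_less_iff)
      qed
    qed measurable
    also have "\<dots> < r / 2" by (rule N0[OF N])
    finally show ?thesis using \<eta>(2) by (simp add: abs_of_nonneg)
  qed
  then show "\<exists>N0. \<forall>N\<ge>N0. norm (expectation (\<lambda>\<omega>. min 1 \<bar>?G N \<omega>\<bar>) - 0) < r" by blast
qed

text \<open>The error consists of the clipping error and the errors of the unclipped elementary
  integrals at the two ends t and s.\<close>

lemma approximant_tendsto:
  "(\<lambda>N. expectation (\<lambda>\<omega>. min 1 \<bar>approximant N \<omega> - (I t \<omega> - I s \<omega>)\<bar>)) \<longlonglongrightarrow> 0"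
proof -
  define G where "G N = grid_integral (q N) (\<lambda>k \<omega>. integrand N k \<omega> -
     simple_process (m N) (\<tau> N) (\<xi> N) (q N (Suc k)) \<omega>) W (L N)" for N
  define D where "D v N \<omega> = simple_integral (m N) (\<tau> N) (\<xi> N) W v \<omega> - I v \<omega>" for v N \<omega>
  have D_meas: "D v N \<in> borel_measurable M" if "0 \<le> v" for v N
    unfolding D_def
    by (rule borel_measurable_diff[OF simple_integral_measurable[OF W sd that] adapted_measurable[OF I that]])
  have t0: "0 \<le> t" using st by simp
  have G_eq: "approximant N \<omega> = G N \<omega> + (simple_integral (m N) (\<tau> N) (\<xi> N) W t \<omega> - simple_integral (m N) (\<tau> N) (\<xi> N) W s \<omega>)" for N \<omega>
  proof -
    have "mono (\<tau> N)" using sd by (simp add: simple_data_def)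
    from simple_integral_grid[where \<xi>="\<xi> N" and W=W and \<omega>=\<omega>, OF q_mono q_0 q_L q_ge q_le this q_refines]
    show ?thesis by (simp add: G_def grid_integral_def left_diff_distrib sum_subtractf)
  qed
  have [measurable]: "G N \<in> borel_measurable M" for N
  proof -
    have "G N = (\<lambda>\<omega>. approximant N \<omega> - (simple_integral (m N) (\<tau> N) (\<xi> N) W t \<omega> - simple_integral (m N) (\<tau> N) (\<xi> N) W s \<omega>))"
      by (simp add: G_eq)
    then show ?thesis
      using simple_integral_measurable[OF W sd] st by auto
  qed
  have [measurable]: "D t N \<in> borel_measurable M" "D s N \<in> borel_measurable M" for N
    using D_meas st by auto
  have le: "expectation (\<lambda>\<omega>. min 1 \<bar>approximant N \<omega> - (I t \<omega> - I s \<omega>)\<bar>) \<le>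
    expectation (\<lambda>\<omega>. min 1 \<bar>G N \<omega>\<bar>) + expectation (\<lambda>\<omega>. min 1 \<bar>D t N \<omega>\<bar>) + expectation (\<lambda>\<omega>. min 1 \<bar>D s N \<omega>\<bar>)" for N
  proof -
    have i: "integrable M (\<lambda>\<omega>. min 1 \<bar>f \<omega>\<bar>)" if "f \<in> borel_measurable M" for f :: "'a \<Rightarrow> real"
      by (rule integrable_bounded[where b=1]) (use that in auto)
    have "expectation (\<lambda>\<omega>. min 1 \<bar>approximant N \<omega> - (I t \<omega> - I s \<omega>)\<bar>) \<le>
      expectation (\<lambda>\<omega>. min 1 \<bar>G N \<omega>\<bar> + min 1 \<bar>D t N \<omega>\<bar> + min 1 \<bar>D s N \<omega>\<bar>)"
    proof (rule integral_mono)
      show "integrable M (\<lambda>\<omega>. min 1 \<bar>approximant N \<omega> - (I t \<omega> - I s \<omega>)\<bar>)"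
        by (rule i) (intro borel_measurable_diff[OF approximant_measurable increment_measurable])
      show "integrable M (\<lambda>\<omega>. min 1 \<bar>G N \<omega>\<bar> + min 1 \<bar>D t N \<omega>\<bar> + min 1 \<bar>D s N \<omega>\<bar>)"
        by (intro Bochner_Integration.integrable_add i) auto
      show "min 1 \<bar>approximant N \<omega> - (I t \<omega> - I s \<omega>)\<bar> \<le> min 1 \<bar>G N \<omega>\<bar> + min 1 \<bar>D t N \<omega>\<bar> + min 1 \<bar>D s N \<omega>\<bar>" for \<omega>
        using min_abs_add_le[of "G N \<omega>" "D t N \<omega>" "D s N \<omega>"] by (simp add: G_eq D_def algebra_simps)
    qed
    also have "\<dots> = expectation (\<lambda>\<omega>. min 1 \<bar>G N \<omega>\<bar>) + expectation (\<lambda>\<omega>. min 1 \<bar>D t N \<omega>\<bar>) + expectation (\<lambda>\<omega>. min 1 \<bar>D s N \<omega>\<bar>)"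
      by (simp add: i)
    finally show ?thesis .
  qed
  have "(\<lambda>N. expectation (\<lambda>\<omega>. min 1 \<bar>D v N \<omega>\<bar>)) \<longlonglongrightarrow> 0" if "0 \<le> v" for v
    using null_in_probability_expectation_min[of "D v"] D_meas[OF that] I_lim[OF that] by (simp add: D_def)
  from tendsto_add[OF tendsto_add[OF clipping_error_tendsto this[OF t0]] this[OF st(1)]]
  have "(\<lambda>N. expectation (\<lambda>\<omega>. min 1 \<bar>G N \<omega>\<bar>) + expectation (\<lambda>\<omega>. min 1 \<bar>D t N \<omega>\<bar>) + expectation (\<lambda>\<omega>. min 1 \<bar>D s N \<omega>\<bar>)) \<longlonglongrightarrow> 0"
    by (simp add: G_def)
  then show ?thesis
    by (rule tendsto_sandwich[OF _ _ tendsto_const, rotated -1]) (use le in \<open>auto intro!: always_eventually\<close>)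
qed

end

lemma tendsto_min_abs_imp:
  fixes x :: "nat \<Rightarrow> real"
  assumes "(\<lambda>N. min 1 \<bar>x N\<bar>) \<longlonglongrightarrow> 0"
  shows "x \<longlonglongrightarrow> 0"
proof -
  have "eventually (\<lambda>N. min 1 \<bar>x N\<bar> < 1) sequentially"
    using order_tendstoD(2)[OF assms, of 1] by simp
  then have "eventually (\<lambda>N. min 1 \<bar>x N\<bar> = \<bar>x N\<bar>) sequentially"
    by eventually_elim auto
  from tendsto_cong[OF this] assms show ?thesis by (simp add: tendsto_rabs_zero_iff)
qed

section \<open>Moments of the increments of Ito integrals\<close>

context usual_filtration
begin

text \<open>The grid refines the partitions of both approximating sequences, because the covariation
  formula requires both integrals to have the same cells.\<close>

lemma ito_joint_approximation:
  assumes W: "brownian_motion M F W" "brownian_motion M F W'"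
    and I: "ito_integral M F H W I" "ito_integral M F H' W' I'"
    and ab: "0 \<le> a" "a \<le> b"
    and H: "AE \<omega> in M. \<forall>u\<ge>0. a \<le> H u \<omega> \<and> H u \<omega> \<le> b" "AE \<omega> in M. \<forall>u\<ge>0. a \<le> H' u \<omega> \<and> H' u \<omega> \<le> b"
    and st: "0 \<le> s" "s \<le> t"
  obtains q L h h' where "\<And>N. grid_data F (q N) (h N) b" "\<And>N. grid_data F (q N) (h' N) b"
    "\<And>N k \<omega>. a \<le> h N k \<omega>" "\<And>N k \<omega>. h N k \<omega> \<le> b" "\<And>N. q N 0 = s" "\<And>N. q N (L N) = t"
    "AE \<omega> in M. (\<lambda>N. grid_integral (q N) (h N) W (L N) \<omega>) \<longlonglongrightarrow> I t \<omega> - I s \<omega>"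
    "AE \<omega> in M. (\<lambda>N. grid_integral (q N) (h' N) W' (L N) \<omega>) \<longlonglongrightarrow> I' t \<omega> - I' s \<omega>"
proof -
  obtain m \<tau> \<xi> where ex: "(\<forall>N. simple_data F (m N) (\<tau> N) (\<xi> N)) \<and> (\<forall>t\<ge>0.
      null_in_probability M (\<lambda>N \<omega>. \<integral>\<^sup>+s\<in>{0..t}.
             ennreal ((simple_process (m N) (\<tau> N) (\<xi> N) s \<omega> - H s \<omega>)\<^sup>2) \<partial>lborel) \<and>
      null_in_probability M (\<lambda>N \<omega>.
             ennreal \<bar>simple_integral (m N) (\<tau> N) (\<xi> N) W t \<omega> - I t \<omega>\<bar>))"
    using I(1) unfolding ito_integral_def by (elim conjE exE) (rule that, intro conjI, assumption+)
  obtain m' \<tau>' \<xi>' where ex': "(\<forall>N. simple_data F (m' N) (\<tau>' N) (\<xi>' N)) \<and> (\<forall>t\<ge>0.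
      null_in_probability M (\<lambda>N \<omega>. \<integral>\<^sup>+s\<in>{0..t}.
             ennreal ((simple_process (m' N) (\<tau>' N) (\<xi>' N) s \<omega> - H' s \<omega>)\<^sup>2) \<partial>lborel) \<and>
      null_in_probability M (\<lambda>N \<omega>.
             ennreal \<bar>simple_integral (m' N) (\<tau>' N) (\<xi>' N) W' t \<omega> - I' t \<omega>\<bar>))"
    using I(2) unfolding ito_integral_def by (elim conjE exE) (rule that, intro conjI, assumption+)
  have PI: "progressive F H" "adapted F I" "progressive F H'" "adapted F I'"
    using I by (simp_all add: ito_integral_def)
  have "\<exists>q L. mono q \<and> q 0 = s \<and> q L = t \<and> (\<forall>k. s \<le> q k \<and> q k \<le> t) \<and>
    (\<forall>k x. x \<in> \<tau> N ` {..m N} \<union> \<tau>' N ` {..m' N} \<longrightarrow> q k < x \<longrightarrow> q (Suc k) \<le> x)" for N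
  proof -
    have "finite (\<tau> N ` {..m N} \<union> \<tau>' N ` {..m' N})" by simp
    from refining_grid[OF st(2) this] obtain q :: "nat \<Rightarrow> real" and L where "mono q" "q 0 = s" "q L = t"
      "\<And>k. s \<le> q k" "\<And>k. q k \<le> t"
      "\<And>k x. x \<in> \<tau> N ` {..m N} \<union> \<tau>' N ` {..m' N} \<Longrightarrow> q k < x \<Longrightarrow> q (Suc k) \<le> x" by blast
    then show ?thesis by (intro exI[of _ q] exI[of _ L]) blast
  qed
  then obtain q L where qL: "\<And>N. mono (q N) \<and> q N 0 = s \<and> q N (L N) = t \<and> (\<forall>k. s \<le> q N k \<and> q N k \<le> t) \<and>
    (\<forall>k x. x \<in> \<tau> N ` {..m N} \<union> \<tau>' N ` {..m' N} \<longrightarrow> q N k < x \<longrightarrow> q N (Suc k) \<le> x)"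
    by metis
  have q: "\<And>N. mono (q N)" "\<And>N. q N 0 = s" "\<And>N. q N (L N) = t"
    "\<And>N k. s \<le> q N k" "\<And>N k. q N k \<le> t"
    "\<And>N k x. x \<in> \<tau> N ` {..m N} \<union> \<tau>' N ` {..m' N} \<Longrightarrow> q N k < x \<Longrightarrow> q N (Suc k) \<le> x"
    using qL by blast+
  interpret A: clipped_approximation M F H W I m \<tau> \<xi> q L s t a b
  proof (unfold_locales, goal_cases)
    case (4 N) then show ?case using ex by blast
  next
    case (5 t) then show ?case using ex by blast
  next
    case (6 t) then show ?case using ex by blast
  next
    case (17 N k x) then show ?case using q(6) by blast
  qed (fact W PI ab H st q)+
  interpret B: clipped_approximation M F H' W' I' m' \<tau>' \<xi>' q L s t a b
  proof (unfold_locales, goal_cases)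
    case (4 N) then show ?case using ex' by blast
  next
    case (5 t) then show ?case using ex' by blast
  next
    case (6 t) then show ?case using ex' by blast
  next
    case (17 N k x) then show ?case using q(6) by blast
  qed (fact W PI ab H st q)+
  \<comment> \<open>Adding the two errors makes a single subsequence work for both
    integrals.\<close>
  define u where "u N \<omega> = min 1 \<bar>A.approximant N \<omega> - (I t \<omega> - I s \<omega>)\<bar> + min 1 \<bar>B.approximant N \<omega> - (I' t \<omega> - I' s \<omega>)\<bar>" for N \<omega>
  have mA: "(\<lambda>\<omega>. A.approximant N \<omega> - (I t \<omega> - I s \<omega>)) \<in> borel_measurable M" for N
    by (intro borel_measurable_diff[OF A.approximant_measurable A.increment_measurable])
  have mB: "(\<lambda>\<omega>. B.approximant N \<omega> - (I' t \<omega> - I' s \<omega>)) \<in> borel_measurable M" for N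
    by (intro borel_measurable_diff[OF B.approximant_measurable B.increment_measurable])
  have i: "integrable M (\<lambda>\<omega>. min 1 \<bar>f \<omega>\<bar>)" if "f \<in> borel_measurable M" for f :: "'a \<Rightarrow> real"
    by (rule integrable_bounded[where b=1]) (use that in auto)
  have ui: "integrable M (u N)" for N
    unfolding u_def by (intro Bochner_Integration.integrable_add i mA mB)
  have "expectation (\<lambda>\<omega>. norm (u N \<omega>)) = expectation (\<lambda>\<omega>. min 1 \<bar>A.approximant N \<omega> - (I t \<omega> - I s \<omega>)\<bar>)
    + expectation (\<lambda>\<omega>. min 1 \<bar>B.approximant N \<omega> - (I' t \<omega> - I' s \<omega>)\<bar>)" for N
    unfolding u_def using i[OF mA] i[OF mB] by (simp add: abs_of_nonneg)
  then have "(\<lambda>N. expectation (\<lambda>\<omega>. norm (u N \<omega>))) \<longlonglongrightarrow> 0"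
    using tendsto_add[OF A.approximant_tendsto B.approximant_tendsto] by simp
  from tendsto_L1_AE_subseq[OF ui this] obtain r :: "nat \<Rightarrow> nat" where
    r: "AE \<omega> in M. (\<lambda>N. u (r N) \<omega>) \<longlonglongrightarrow> 0" by auto
  have AE: "AE \<omega> in M. (\<lambda>N. A.approximant (r N) \<omega>) \<longlonglongrightarrow> I t \<omega> - I s \<omega>"
    using r
  proof eventually_elim
    case (elim \<omega>)
    then have "(\<lambda>N. min 1 \<bar>A.approximant (r N) \<omega> - (I t \<omega> - I s \<omega>)\<bar>) \<longlonglongrightarrow> 0"
      by (rule tendsto_sandwich[OF _ _ tendsto_const, rotated -1]) (auto simp: u_def intro!: always_eventually)
    from tendsto_min_abs_imp[OF this] show ?case by (simp add: LIM_zero_iff)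
  qed
  have AE': "AE \<omega> in M. (\<lambda>N. B.approximant (r N) \<omega>) \<longlonglongrightarrow> I' t \<omega> - I' s \<omega>"
    using r
  proof eventually_elim
    case (elim \<omega>)
    then have "(\<lambda>N. min 1 \<bar>B.approximant (r N) \<omega> - (I' t \<omega> - I' s \<omega>)\<bar>) \<longlonglongrightarrow> 0"
      by (rule tendsto_sandwich[OF _ _ tendsto_const, rotated -1]) (auto simp: u_def intro!: always_eventually)
    from tendsto_min_abs_imp[OF this] show ?case by (simp add: LIM_zero_iff)
  qed
  show thesis
    by (rule that[OF A.grid_data_integrand B.grid_data_integrand A.integrand_bounds q(2) q(3) AE AE'])
qed

lemma ito_increment_measurable:
  assumes "ito_integral M F H W I" "0 \<le> s" "s \<le> t"
  shows "(\<lambda>\<omega>. I t \<omega> - I s \<omega>) \<in> borel_measurable M"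
proof -
  have I: "adapted F I" using assms(1) by (simp add: ito_integral_def)
  show ?thesis
    using assms(2,3) by (intro borel_measurable_diff adapted_measurable[OF I]) auto
qed

text \<open>Thanks to the clipping, the approximating grid integrals satisfy each property with
  constants that do not depend on N. The limits of first moments rest on second moment bounds, those
  of second moments on fourth moment bounds. The lower bound by a^2 is why the integrands are
  clipped from below as well.\<close>

lemma ito_increment_moments:
  assumes W: "brownian_motion M F W" and I: "ito_integral M F H W I"
    and ab: "0 \<le> a" "a \<le> b" and H: "AE \<omega> in M. \<forall>u\<ge>0. a \<le> H u \<omega> \<and> H u \<omega> \<le> b"
    and st: "0 \<le> s" "s \<le> t"
  shows "L4 M (\<lambda>\<omega>. I t \<omega> - I s \<omega>)"
    and "expectation (\<lambda>\<omega>. (I t \<omega> - I s \<omega>) ^ 4) \<le> 3 * b ^ 4 * (t - s)\<^sup>2"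
    and "\<And>\<zeta> B. \<zeta> \<in> borel_measurable (F s) \<Longrightarrow> (\<And>\<omega>. \<omega> \<in> space M \<Longrightarrow> \<bar>\<zeta> \<omega>\<bar> \<le> B) \<Longrightarrow>
      expectation (\<lambda>\<omega>. \<zeta> \<omega> * (I t \<omega> - I s \<omega>)) = 0"
    and "\<And>\<zeta> B. \<zeta> \<in> borel_measurable (F s) \<Longrightarrow> (\<And>\<omega>. \<omega> \<in> space M \<Longrightarrow> 0 \<le> \<zeta> \<omega>) \<Longrightarrow>
      (\<And>\<omega>. \<omega> \<in> space M \<Longrightarrow> \<zeta> \<omega> \<le> B) \<Longrightarrow>
      a\<^sup>2 * (t - s) * expectation \<zeta> \<le> expectation (\<lambda>\<omega>. \<zeta> \<omega> * (I t \<omega> - I s \<omega>)\<^sup>2)"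
    and "\<And>\<zeta> B. \<zeta> \<in> borel_measurable (F s) \<Longrightarrow> (\<And>\<omega>. \<omega> \<in> space M \<Longrightarrow> 0 \<le> \<zeta> \<omega>) \<Longrightarrow>
      (\<And>\<omega>. \<omega> \<in> space M \<Longrightarrow> \<zeta> \<omega> \<le> B) \<Longrightarrow>
      expectation (\<lambda>\<omega>. \<zeta> \<omega> * (I t \<omega> - I s \<omega>)\<^sup>2) \<le> b\<^sup>2 * (t - s) * expectation \<zeta>"
proof -
  obtain q L h where g: "\<And>N. grid_data F (q N) (h N) b"
    and h: "\<And>N k \<omega>. a \<le> h N k \<omega>" "\<And>N k \<omega>. h N k \<omega> \<le> b" and q: "\<And>N. q N 0 = s" "\<And>N. q N (L N) = t"
    and ae: "AE \<omega> in M. (\<lambda>N. grid_integral (q N) (h N) W (L N) \<omega>) \<longlonglongrightarrow> I t \<omega> - I s \<omega>"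
  proof (rule ito_joint_approximation[OF W W I I ab H H st], goal_cases)
    case (1 q L h h')
    show ?case by (rule that[OF 1(2,4-8)])
  qed
  define S where "S N = grid_integral (q N) (h N) W (L N)" for N
  define D where "D \<omega> = I t \<omega> - I s \<omega>" for \<omega>
  have ae: "AE \<omega> in M. (\<lambda>N. S N \<omega>) \<longlonglongrightarrow> D \<omega>" using ae by (simp add: S_def D_def)
  have DM [measurable]: "D \<in> borel_measurable M"
    unfolding D_def by (rule ito_increment_measurable[OF I st])
  have SL: "L4 M (S N)" for N unfolding S_def by (rule grid_integral_L4[OF W g])
  have SM [measurable]: "S N \<in> borel_measurable M" for N using SL by (auto simp: L4_def)
  have S4: "expectation (\<lambda>\<omega>. S N \<omega> ^ 4) \<le> 3 * b ^ 4 * (t - s)\<^sup>2" for N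
    using grid_integral_fourth_moment(1)[OF W g, of N "L N"] by (simp add: S_def q)
  have pow: "(x\<^sup>2)\<^sup>2 = x ^ 4" for x :: real by simp
  have ae2: "AE \<omega> in M. (\<lambda>N. (S N \<omega>)\<^sup>2) \<longlonglongrightarrow> (D \<omega>)\<^sup>2"
    using ae by eventually_elim (intro tendsto_power)
  have D4: "integrable M (\<lambda>\<omega>. D \<omega> ^ 4)" "expectation (\<lambda>\<omega>. D \<omega> ^ 4) \<le> 3 * b ^ 4 * (t - s)\<^sup>2"
    using L2_bounded_expectation_tendsto(1,2)[OF _ _ ae2, of "3 * b ^ 4 * (t - s)\<^sup>2"]
      SL S4 by (simp_all add: L4_def)
  show L: "L4 M (\<lambda>\<omega>. I t \<omega> - I s \<omega>)" using D4(1) DM by (simp add: L4_def D_def[abs_def])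
  show "expectation (\<lambda>\<omega>. (I t \<omega> - I s \<omega>) ^ 4) \<le> 3 * b ^ 4 * (t - s)\<^sup>2"
    using D4(2) by (simp add: D_def)
  have scale: "integrable M (\<lambda>\<omega>. (\<zeta> \<omega> * V \<omega>)\<^sup>2) \<and> expectation (\<lambda>\<omega>. (\<zeta> \<omega> * V \<omega>)\<^sup>2) \<le> B\<^sup>2 * C"
    if \<zeta>: "\<zeta> \<in> borel_measurable M" "\<And>\<omega>. \<omega> \<in> space M \<Longrightarrow> \<bar>\<zeta> \<omega>\<bar> \<le> B"
      and V: "integrable M (\<lambda>\<omega>. (V \<omega>)\<^sup>2)" "expectation (\<lambda>\<omega>. (V \<omega>)\<^sup>2) \<le> C" for \<zeta> V :: "'a \<Rightarrow> real" and B C :: real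
  proof
    have b2: "(\<zeta> \<omega>)\<^sup>2 \<le> B\<^sup>2" if "\<omega> \<in> space M" for \<omega>
      using power_mono[OF \<zeta>(2)[OF that], of 2] by simp
    show i: "integrable M (\<lambda>\<omega>. (\<zeta> \<omega> * V \<omega>)\<^sup>2)" unfolding power_mult_distrib
      by (rule integrable_bounded_mult[where b="B\<^sup>2"]) (use \<zeta>(1) b2 V(1) in auto)
    have "expectation (\<lambda>\<omega>. (\<zeta> \<omega> * V \<omega>)\<^sup>2) \<le> expectation (\<lambda>\<omega>. B\<^sup>2 * (V \<omega>)\<^sup>2)"
      by (intro integral_mono i) (use V(1) b2 in \<open>auto simp: power_mult_distrib intro!: mult_right_mono\<close>)
    also have "\<dots> \<le> B\<^sup>2 * C" using V by (simp add: mult_left_mono)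
    finally show "expectation (\<lambda>\<omega>. (\<zeta> \<omega> * V \<omega>)\<^sup>2) \<le> B\<^sup>2 * C" .
  qed
  { fix \<zeta> :: "'a \<Rightarrow> real" and B :: real assume \<zeta>: "\<zeta> \<in> borel_measurable (F s)" and B: "\<And>\<omega>. \<omega> \<in> space M \<Longrightarrow> \<bar>\<zeta> \<omega>\<bar> \<le> B"
    have \<zeta>M [measurable]: "\<zeta> \<in> borel_measurable M" by (rule borel_measurable_F[OF \<zeta>])
    have aez: "AE \<omega> in M. (\<lambda>N. \<zeta> \<omega> * S N \<omega>) \<longlonglongrightarrow> \<zeta> \<omega> * D \<omega>"
      using ae by eventually_elim (intro tendsto_intros)
    have "expectation (\<lambda>\<omega>. (S N \<omega>)\<^sup>2) \<le> b\<^sup>2 * (t - s)" for N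
      using grid_integral_fourth_moment(2)[OF W g, of N "L N"] by (simp add: S_def q)
    note sc = scale[OF \<zeta>M B L4_integrable_power[OF SL, of 2] this]
    have "(\<lambda>N. expectation (\<lambda>\<omega>. \<zeta> \<omega> * S N \<omega>)) \<longlonglongrightarrow> expectation (\<lambda>\<omega>. \<zeta> \<omega> * D \<omega>)"
      by (rule L2_bounded_expectation_tendsto(3)[OF _ _ aez, where C="B\<^sup>2 * (b\<^sup>2 * (t - s))"]) (use sc in auto)
    moreover have "expectation (\<lambda>\<omega>. \<zeta> \<omega> * S N \<omega>) = 0" for N
      unfolding S_def by (rule grid_integral_orthogonal[OF W g _ B]) (simp_all add: q \<zeta>)
    ultimately show "expectation (\<lambda>\<omega>. \<zeta> \<omega> * (I t \<omega> - I s \<omega>)) = 0"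
      by (simp add: LIMSEQ_const_iff D_def) }
  { fix \<zeta> :: "'a \<Rightarrow> real" and B :: real assume \<zeta>: "\<zeta> \<in> borel_measurable (F s)" and nn: "\<And>\<omega>. \<omega> \<in> space M \<Longrightarrow> 0 \<le> \<zeta> \<omega>"
      and B: "\<And>\<omega>. \<omega> \<in> space M \<Longrightarrow> \<zeta> \<omega> \<le> B"
    have \<zeta>M [measurable]: "\<zeta> \<in> borel_measurable M" by (rule borel_measurable_F[OF \<zeta>])
    have B': "\<bar>\<zeta> \<omega>\<bar> \<le> B" if "\<omega> \<in> space M" for \<omega> using nn[OF that] B[OF that] by simp
    have aez: "AE \<omega> in M. (\<lambda>N. \<zeta> \<omega> * (S N \<omega>)\<^sup>2) \<longlonglongrightarrow> \<zeta> \<omega> * (D \<omega>)\<^sup>2"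
      using ae by eventually_elim (intro tendsto_intros)
    have sc: "integrable M (\<lambda>\<omega>. (\<zeta> \<omega> * (S N \<omega>)\<^sup>2)\<^sup>2)"
      "expectation (\<lambda>\<omega>. (\<zeta> \<omega> * (S N \<omega>)\<^sup>2)\<^sup>2) \<le> B\<^sup>2 * (3 * b ^ 4 * (t - s)\<^sup>2)" for N
      using scale[OF \<zeta>M B', of "\<lambda>\<omega>. (S N \<omega>)\<^sup>2" "3 * b ^ 4 * (t - s)\<^sup>2"] SL[of N] S4[of N]
      by (simp_all only: pow L4_def)
    have lim: "(\<lambda>N. expectation (\<lambda>\<omega>. \<zeta> \<omega> * (S N \<omega>)\<^sup>2)) \<longlonglongrightarrow> expectation (\<lambda>\<omega>. \<zeta> \<omega> * (D \<omega>)\<^sup>2)"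
      by (rule L2_bounded_expectation_tendsto(3)[OF _ _ aez sc]) auto
    have h2: "a\<^sup>2 \<le> (h N k \<omega>)\<^sup>2" "(h N k \<omega>)\<^sup>2 \<le> b\<^sup>2" for N k \<omega>
      using h[of N k \<omega>] ab h(1)[of N k \<omega>] by (auto intro!: power_mono intro: order.trans)
    have \<zeta>q: "\<zeta> \<in> borel_measurable (F (q N 0))" for N using \<zeta> q by simp
    have bds: "a\<^sup>2 * (t - s) * expectation \<zeta> \<le> expectation (\<lambda>\<omega>. \<zeta> \<omega> * (S N \<omega>)\<^sup>2)"
      "expectation (\<lambda>\<omega>. \<zeta> \<omega> * (S N \<omega>)\<^sup>2) \<le> b\<^sup>2 * (t - s) * expectation \<zeta>" for N
      using grid_integral_second_moment_bounds[OF W g \<zeta>q B' nn h2, of N "L N"] by (simp_all add: S_def q)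
    show "a\<^sup>2 * (t - s) * expectation \<zeta> \<le> expectation (\<lambda>\<omega>. \<zeta> \<omega> * (I t \<omega> - I s \<omega>)\<^sup>2)"
      using LIMSEQ_le_const[OF lim] bds(1) by (auto simp: D_def)
    show "expectation (\<lambda>\<omega>. \<zeta> \<omega> * (I t \<omega> - I s \<omega>)\<^sup>2) \<le> b\<^sup>2 * (t - s) * expectation \<zeta>"
      using LIMSEQ_le_const2[OF lim] bds(2) by (auto simp: D_def) }
qed

text \<open>The approximations on a common grid are uncorrelated; their products are bounded in L2
  by the fourth moments, so the value zero passes to the limit.\<close>

lemma ito_increments_uncorrelated:
  assumes bm: "\<And>i. brownian_motion M F (W i)" and ind: "independent_processes M W" and ij: "i \<noteq> j"
    and I: "ito_integral M F H (W i) I" "ito_integral M F H' (W j) I'"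
    and ab: "0 \<le> a" "a \<le> b"
    and H: "AE \<omega> in M. \<forall>u\<ge>0. a \<le> H u \<omega> \<and> H u \<omega> \<le> b" "AE \<omega> in M. \<forall>u\<ge>0. a \<le> H' u \<omega> \<and> H' u \<omega> \<le> b"
    and st: "0 \<le> s" "s \<le> t"
    and \<zeta>: "\<zeta> \<in> borel_measurable (F s)" and B: "\<And>\<omega>. \<omega> \<in> space M \<Longrightarrow> \<bar>\<zeta> \<omega>\<bar> \<le> B"
  shows "expectation (\<lambda>\<omega>. \<zeta> \<omega> * ((I t \<omega> - I s \<omega>) * (I' t \<omega> - I' s \<omega>))) = 0"
proof -
  obtain q L h h' where g: "\<And>N. grid_data F (q N) (h N) b" "\<And>N. grid_data F (q N) (h' N) b"
    and q: "\<And>N. q N 0 = s" "\<And>N. q N (L N) = t"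
    and ae: "AE \<omega> in M. (\<lambda>N. grid_integral (q N) (h N) (W i) (L N) \<omega>) \<longlonglongrightarrow> I t \<omega> - I s \<omega>"
      "AE \<omega> in M. (\<lambda>N. grid_integral (q N) (h' N) (W j) (L N) \<omega>) \<longlonglongrightarrow> I' t \<omega> - I' s \<omega>"
  proof (rule ito_joint_approximation[OF bm bm I ab H st], goal_cases)
    case (1 q L h h')
    show ?case by (rule that[OF 1(2,3,6-9)])
  qed
  define S S' where "S N = grid_integral (q N) (h N) (W i) (L N)" and "S' N = grid_integral (q N) (h' N) (W j) (L N)" for N
  define D D' where "D \<omega> = I t \<omega> - I s \<omega>" and "D' \<omega> = I' t \<omega> - I' s \<omega>" for \<omega>
  have \<zeta>M [measurable]: "\<zeta> \<in> borel_measurable M" by (rule borel_measurable_F[OF \<zeta>])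
  have DM [measurable]: "D \<in> borel_measurable M" "D' \<in> borel_measurable M"
    unfolding D_def D'_def by (rule ito_increment_measurable[OF I(1) st], rule ito_increment_measurable[OF I(2) st])
  have SL: "L4 M (S N)" "L4 M (S' N)" for N
    unfolding S_def S'_def by (rule grid_integral_L4[OF bm g(1)], rule grid_integral_L4[OF bm g(2)])
  have SM [measurable]: "S N \<in> borel_measurable M" "S' N \<in> borel_measurable M" for N using SL by (auto simp: L4_def)
  have S4: "expectation (\<lambda>\<omega>. S N \<omega> ^ 4) \<le> 3 * b ^ 4 * (t - s)\<^sup>2"
    "expectation (\<lambda>\<omega>. S' N \<omega> ^ 4) \<le> 3 * b ^ 4 * (t - s)\<^sup>2" for N
    using grid_integral_fourth_moment(1)[OF bm g(1), of N i "L N"]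
      grid_integral_fourth_moment(1)[OF bm g(2), of N j "L N"] by (simp_all add: S_def S'_def q)
  have aez: "AE \<omega> in M. (\<lambda>N. \<zeta> \<omega> * (S N \<omega> * S' N \<omega>)) \<longlonglongrightarrow> \<zeta> \<omega> * (D \<omega> * D' \<omega>)"
    using ae unfolding S_def S'_def D_def D'_def by eventually_elim (intro tendsto_intros)
  have le: "(z * (x * y))\<^sup>2 \<le> B\<^sup>2 * (x ^ 4 + y ^ 4)" if "\<bar>z\<bar> \<le> B" for x y z :: real
  proof -
    have "2 * (x * y)\<^sup>2 \<le> x ^ 4 + y ^ 4"
      using sum_squares_bound[of "x\<^sup>2" "y\<^sup>2"] by (simp add: power_mult_distrib mult.assoc)
    then have "(x * y)\<^sup>2 \<le> x ^ 4 + y ^ 4" using zero_le_power2[of "x * y"] by linarith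
    moreover have "z\<^sup>2 \<le> B\<^sup>2" using power_mono[OF that, of 2] by simp
    ultimately show ?thesis unfolding power_mult_distrib[of z] by (intro mult_mono) auto
  qed
  have i4: "integrable M (\<lambda>\<omega>. B\<^sup>2 * (S N \<omega> ^ 4 + S' N \<omega> ^ 4))" for N
    using SL by (simp add: L4_def)
  have int: "integrable M (\<lambda>\<omega>. (\<zeta> \<omega> * (S N \<omega> * S' N \<omega>))\<^sup>2)" for N
  proof (rule Bochner_Integration.integrable_bound[OF i4])
    show "AE \<omega> in M. norm ((\<zeta> \<omega> * (S N \<omega> * S' N \<omega>))\<^sup>2) \<le> norm (B\<^sup>2 * (S N \<omega> ^ 4 + S' N \<omega> ^ 4))"
    proof (intro AE_I2)
      fix \<omega> assume "\<omega> \<in> space M"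
      then have "(\<zeta> \<omega> * (S N \<omega> * S' N \<omega>))\<^sup>2 \<le> B\<^sup>2 * (S N \<omega> ^ 4 + S' N \<omega> ^ 4)" by (intro le B)
      also have "\<dots> \<le> norm (B\<^sup>2 * (S N \<omega> ^ 4 + S' N \<omega> ^ 4))" by (simp only: real_norm_def abs_ge_self)
      finally show "norm ((\<zeta> \<omega> * (S N \<omega> * S' N \<omega>))\<^sup>2) \<le> norm (B\<^sup>2 * (S N \<omega> ^ 4 + S' N \<omega> ^ 4))"
        by (simp only: real_norm_def abs_power2)
    qed
  qed measurable
  have C: "expectation (\<lambda>\<omega>. (\<zeta> \<omega> * (S N \<omega> * S' N \<omega>))\<^sup>2) \<le> B\<^sup>2 * (3 * b ^ 4 * (t - s)\<^sup>2 + 3 * b ^ 4 * (t - s)\<^sup>2)" for N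
  proof -
    have "expectation (\<lambda>\<omega>. (\<zeta> \<omega> * (S N \<omega> * S' N \<omega>))\<^sup>2) \<le> expectation (\<lambda>\<omega>. B\<^sup>2 * (S N \<omega> ^ 4 + S' N \<omega> ^ 4))"
      by (intro integral_mono int i4 le B)
    also have "\<dots> = B\<^sup>2 * (expectation (\<lambda>\<omega>. S N \<omega> ^ 4) + expectation (\<lambda>\<omega>. S' N \<omega> ^ 4))"
      using SL by (simp add: L4_def)
    also have "\<dots> \<le> B\<^sup>2 * (3 * b ^ 4 * (t - s)\<^sup>2 + 3 * b ^ 4 * (t - s)\<^sup>2)"
      by (intro mult_left_mono add_mono S4) simp
    finally show ?thesis .
  qed
  have "(\<lambda>N. expectation (\<lambda>\<omega>. \<zeta> \<omega> * (S N \<omega> * S' N \<omega>))) \<longlonglongrightarrow> expectation (\<lambda>\<omega>. \<zeta> \<omega> * (D \<omega> * D' \<omega>))"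
    by (rule L2_bounded_expectation_tendsto(3)[OF _ _ aez int C]) auto
  moreover have "expectation (\<lambda>\<omega>. \<zeta> \<omega> * (S N \<omega> * S' N \<omega>)) = 0" for N
    unfolding S_def S'_def
    by (rule grid_integrals_uncorrelated[OF bm ind ij g _ B]) (simp_all add: q \<zeta>)
  ultimately show ?thesis by (simp add: LIMSEQ_const_iff D_def D'_def)
qed

end

section \<open>The spread of a finite family\<close>

text \<open>R is to be read as the spread of a configuration z, D as that of an increment, and B as
  the inner product of the increment with the deviations of z. Then \<open>r u\<close> is the spread
  after the fraction u of the increment, and the claim is Maclaurin's formula of order three for
  \<open>(r u + e) powr (-d)\<close> between 0 and 1.\<close>

lemma powr_taylor_bound:
  fixes R B D e d :: real
  assumes R: "0 \<le> R" and D: "0 \<le> D" and B: "B\<^sup>2 \<le> R * D" and e: "0 < e" and d: "0 < d"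
  shows "(R + 2 * B + D + e) powr (-d) \<le> (R + e) powr (-d) - d * (R + e) powr (-d - 1) * (2 * B + D)
    + 2 * d * (d + 1) * (R + e) powr (-d - 2) * B\<^sup>2
    + (4 / 3 * d * (d + 1) * (d + 2) + 2 * d * (d + 1)) * e powr (-d - 3 / 2) * (D * sqrt D)"
proof -
  define r where "r u = R + 2 * u * B + u\<^sup>2 * D" for u
  define r' where "r' u = 2 * B + 2 * u * D" for u
  \<comment> \<open>Up to the factor 4 this says (B + u D)^2 \<le> D r u, which reduces to the
    hypothesis on B. It yields both the nonnegativity of r and the control of the remainder.\<close>
  have CS: "(r' u)\<^sup>2 \<le> 4 * (r u * D)" for u
    using B by (simp add: r_def r'_def power2_eq_square algebra_simps)
  have r_nn: "0 \<le> r u" for u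
  proof (cases "D = 0")
    case True
    then show ?thesis using B R by (simp add: r_def)
  next
    case False
    have "0 \<le> r u * D" using CS[of u] zero_le_power2[of "r' u"] by linarith
    then show ?thesis using False D by (simp add: zero_le_mult_iff)
  qed
  have pos: "0 < r u + e" for u using r_nn[of u] e by simp
  define diff where "diff m u =
    (if m = 0 then (r u + e) powr (-d)
     else if m = 1 then -d * (r u + e) powr (-d - 1) * r' u
     else if m = 2 then d * (d + 1) * (r u + e) powr (-d - 2) * (r' u)\<^sup>2 - 2 * d * D * (r u + e) powr (-d - 1)
     else - (d * (d + 1) * (d + 2)) * (r u + e) powr (-d - 3) * (r' u) ^ 3
       + 6 * d * (d + 1) * D * (r u + e) powr (-d - 2) * r' u)" for m :: nat and u
  have dr: "(r has_real_derivative r' u) (at u)" for u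
    unfolding r_def r'_def by (auto intro!: derivative_eq_intros)
  have dr': "(r' has_real_derivative 2 * D) (at u)" for u
    unfolding r'_def by (auto intro!: derivative_eq_intros)
  have dp: "((\<lambda>u. (r u + e) powr p) has_real_derivative p * (r u + e) powr (p - 1) * r' u) (at u)" for p u
  proof -
    have "((\<lambda>u. r u + e) has_real_derivative r' u) (at u)"
      using DERIV_add[OF dr DERIV_const] by simp
    from DERIV_powr[OF this pos DERIV_const, of p] show ?thesis
      using pos[of u] by (simp add: powr_diff field_simps)
  qed
  have "\<forall>m t. m < 3 \<and> 0 \<le> t \<and> t \<le> 1 \<longrightarrow> (diff m has_real_derivative diff (Suc m) t) (at t)"
  proof (intro allI impI)
    fix m :: nat and t :: real assume "m < 3 \<and> 0 \<le> t \<and> t \<le> 1"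
    then consider "m = 0" | "m = 1" | "m = 2" by linarith
    then show "(diff m has_real_derivative diff (Suc m) t) (at t)"
    proof cases
      case 1
      then show ?thesis using dp[of "-d" t] by (simp add: diff_def[abs_def])
    next
      case 2
      have "((\<lambda>u. -d * ((r u + e) powr (-d - 1) * r' u)) has_real_derivative
        -d * ((-d - 1) * (r t + e) powr (-d - 1 - 1) * r' t * r' t + 2 * D * (r t + e) powr (-d - 1))) (at t)"
        by (intro DERIV_cmult DERIV_mult dp dr')
      then show ?thesis using 2
        by (simp add: diff_def[abs_def] algebra_simps power2_eq_square)
    next
      case 3
      have "((\<lambda>u. d * (d + 1) * ((r u + e) powr (-d - 2) * (r' u * r' u)) - 2 * d * D * (r u + e) powr (-d - 1))
        has_real_derivative
        d * (d + 1) * ((-d - 2) * (r t + e) powr (-d - 2 - 1) * r' t * (r' t * r' t) + (2 * D * r' t + 2 * D * r' t) * (r t + e) powr (-d - 2))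
        - 2 * d * D * ((-d - 1) * (r t + e) powr (-d - 1 - 1) * r' t)) (at t)"
        by (intro DERIV_cmult DERIV_mult DERIV_diff dp dr')
      then show ?thesis using 3
        by (simp add: diff_def[abs_def] algebra_simps power2_eq_square power3_eq_cube)
    qed
  qed
  then obtain t where t: "0 < t" "t < 1" "diff 0 1 = (\<Sum>m<3. diff m 0 / fact m * 1 ^ m) + diff 3 t / fact 3 * 1 ^ 3"
    using Maclaurin[of 1 3 diff "diff 0"] by auto
  \<comment> \<open>Each factor r' in the third derivative is at most twice sqrt (r + e) times sqrt
    D. After this replacement both of its terms carry the same power -d - 3 / 2 of r + e.\<close>
  define E where "E = e powr (-d - 3 / 2)"
  have bound: "(r t + e) powr (-d - 3 / 2) \<le> E"
    unfolding E_def by (rule powr_mono2') (use d e r_nn[of t] in auto)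
  have sq: "sqrt (r t) \<le> (r t + e) powr (1 / 2)"
    using e r_nn[of t] by (simp add: powr_half_sqrt)
  have r'_le: "\<bar>r' t\<bar> \<le> 2 * (sqrt (r t) * sqrt D)"
  proof -
    have "\<bar>r' t\<bar> = sqrt ((r' t)\<^sup>2)" by simp
    also have "\<dots> \<le> sqrt (4 * (r t * D))" by (intro real_sqrt_le_mono CS)
    finally show ?thesis by (simp add: real_sqrt_mult)
  qed
  have r'_le2: "\<bar>r' t\<bar> \<le> 2 * ((r t + e) powr (1 / 2) * sqrt D)"
    using r'_le sq D by (smt (verit) mult_right_mono real_sqrt_ge_zero)
  have ex: "-d - 2 + 1 / 2 = -d - 3 / 2" "-d - 3 + 3 / 2 = -d - 3 / 2" by simp_all
  have p1: "(r t + e) powr (-d - 2) * \<bar>r' t\<bar> \<le> 2 * E * sqrt D"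
  proof -
    have "(r t + e) powr (-d - 2) * \<bar>r' t\<bar> \<le> (r t + e) powr (-d - 2) * (2 * ((r t + e) powr (1 / 2) * sqrt D))"
      by (intro mult_left_mono r'_le2) simp
    also have "\<dots> = 2 * ((r t + e) powr (-d - 2) * (r t + e) powr (1 / 2)) * sqrt D" by simp
    also have "(r t + e) powr (-d - 2) * (r t + e) powr (1 / 2) = (r t + e) powr (-d - 3 / 2)"
      by (simp only: powr_add[symmetric] ex)
    also have "2 * (r t + e) powr (-d - 3 / 2) * sqrt D \<le> 2 * E * sqrt D"
      using bound D by (intro mult_right_mono mult_left_mono) auto
    finally show ?thesis .
  qed
  have p3: "(r t + e) powr (-d - 3) * \<bar>r' t\<bar> ^ 3 \<le> 8 * E * (D * sqrt D)"
  proof -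
    have "(r t + e) powr (-d - 3) * \<bar>r' t\<bar> ^ 3 \<le> (r t + e) powr (-d - 3) * (2 * ((r t + e) powr (1 / 2) * sqrt D)) ^ 3"
      by (intro mult_left_mono power_mono r'_le2) auto
    also have "\<dots> = 8 * ((r t + e) powr (-d - 3) * ((r t + e) powr (1 / 2)) ^ 3) * (D * sqrt D)"
      using D by (simp add: power_mult_distrib power3_eq_cube)
    also have "((r t + e) powr (1 / 2)) ^ 3 = (r t + e) powr (3 / 2)"
      using pos[of t] by (simp add: powr_power)
    also have "(r t + e) powr (-d - 3) * (r t + e) powr (3 / 2) = (r t + e) powr (-d - 3 / 2)"
      by (simp only: powr_add[symmetric] ex)
    also have "8 * (r t + e) powr (-d - 3 / 2) * (D * sqrt D) \<le> 8 * E * (D * sqrt D)"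
      using bound D by (intro mult_right_mono mult_left_mono) auto
    finally show ?thesis .
  qed
  have "diff 3 t \<le> \<bar>d * (d + 1) * (d + 2) * ((r t + e) powr (-d - 3) * (r' t) ^ 3)\<bar>
      + \<bar>6 * d * (d + 1) * D * ((r t + e) powr (-d - 2) * r' t)\<bar>"
    by (simp add: diff_def mult.assoc)
  also have "\<dots> = d * (d + 1) * (d + 2) * ((r t + e) powr (-d - 3) * \<bar>r' t\<bar> ^ 3)
      + 6 * d * (d + 1) * D * ((r t + e) powr (-d - 2) * \<bar>r' t\<bar>)"
    using d D by (simp add: abs_mult power_abs)
  also have "\<dots> \<le> d * (d + 1) * (d + 2) * (8 * E * (D * sqrt D)) + 6 * d * (d + 1) * D * (2 * E * sqrt D)"
    using d D by (intro add_mono mult_left_mono p1 p3) auto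
  \<comment> \<open>The coefficients are 8 / 6 and 12 / 6, from the bounds \<open>p3\<close> and
    \<open>p1\<close> divided by the factorial of 3.\<close>
  finally have d3: "diff 3 t / 6 \<le> (4 / 3 * d * (d + 1) * (d + 2) + 2 * d * (d + 1)) * E * (D * sqrt D)"
    by (simp add: field_simps)
  define T where "T = (R + e) powr (-d) - d * (R + e) powr (-d - 1) * (2 * B + D)
    + 2 * d * (d + 1) * (R + e) powr (-d - 2) * B\<^sup>2"
  have "(R + 2 * B + D + e) powr (-d) = diff 0 1" by (simp add: diff_def r_def)
  also have "\<dots> = diff 0 0 + diff 1 0 + diff 2 0 / 2 + diff 3 t / 6"
    using t(3) by (simp add: eval_nat_numeral)
  also have "diff 0 0 + diff 1 0 + diff 2 0 / 2 = T"
    by (simp add: diff_def r_def r'_def T_def power_mult_distrib field_simps)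
  finally show ?thesis using d3 unfolding T_def E_def by linarith
qed

section \<open>Algebra of the spread\<close>

definition mean :: "'i set \<Rightarrow> ('i \<Rightarrow> real) \<Rightarrow> real" where
  "mean J z = (\<Sum>i\<in>J. z i) / real (card J)"

text \<open>The squared Euclidean norm of the projection orthogonal to the constant vectors. Being a
  nonnegative quadratic form, it obeys a polarisation identity and the Cauchy-Schwarz
  inequality.\<close>

definition spread :: "'i set \<Rightarrow> ('i \<Rightarrow> real) \<Rightarrow> real" where
  "spread J z = (\<Sum>i\<in>J. (z i - mean J z)\<^sup>2)"

lemma spread_nonneg: "0 \<le> spread J z"
  by (simp add: spread_def sum_nonneg)

lemma spread_eq_0:
  assumes "finite J" "J \<noteq> {}" "\<And>i. i \<in> J \<Longrightarrow> z i = c"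
  shows "spread J z = 0"
proof -
  have "mean J z = c" using assms by (simp add: mean_def)
  then show ?thesis using assms by (simp add: spread_def)
qed

context
  fixes J :: "'i set"
  assumes J: "finite J" "J \<noteq> {}"
begin

lemma sum_minus_mean: "(\<Sum>i\<in>J. z i - mean J z) = 0"
  using J by (simp add: mean_def sum_subtractf)

text \<open>In \<open>one_step\<close> this separates the squares of the increments from the square
  of their sum.\<close>

lemma spread_eq: "spread J z = (\<Sum>i\<in>J. (z i)\<^sup>2) - (\<Sum>i\<in>J. z i)\<^sup>2 / card J"
proof -
  have "spread J z = (\<Sum>i\<in>J. (z i)\<^sup>2 - 2 * mean J z * z i + (mean J z)\<^sup>2)"
    unfolding spread_def by (intro sum.cong refl) (simp add: power2_diff)
  also have "\<dots> = (\<Sum>i\<in>J. (z i)\<^sup>2) - 2 * mean J z * (\<Sum>i\<in>J. z i) + card J * (mean J z)\<^sup>2"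
    by (simp add: sum.distrib sum_subtractf sum_distrib_left)
  finally have "spread J z = (\<Sum>i\<in>J. (z i)\<^sup>2) - 2 * mean J z * (\<Sum>i\<in>J. z i) + card J * (mean J z)\<^sup>2" .
  then show ?thesis using J by (simp add: mean_def power2_eq_square field_simps)
qed

lemma spread_le: "spread J z \<le> (\<Sum>i\<in>J. (z i)\<^sup>2)"
  unfolding spread_eq by simp

text \<open>Deviations from the mean sum to zero, so centring the second factor changes
  nothing.\<close>

lemma sum_minus_mean_mult: "(\<Sum>i\<in>J. (z i - mean J z) * d i) = (\<Sum>i\<in>J. (z i - mean J z) * (d i - mean J d))"
proof -
  have e: "(\<Sum>i\<in>J. z i - mean J z) * mean J d = (\<Sum>i\<in>J. (z i - mean J z) * mean J d)"
    by (rule sum_distrib_right)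
  have "(\<Sum>i\<in>J. (z i - mean J z) * (d i - mean J d)) =
    (\<Sum>i\<in>J. (z i - mean J z) * d i) - (\<Sum>i\<in>J. z i - mean J z) * mean J d"
    unfolding e by (simp only: right_diff_distrib sum_subtractf)
  then show ?thesis by (simp add: sum_minus_mean)
qed

lemma spread_add: "spread J (\<lambda>i. z i + d i) = spread J z + 2 * (\<Sum>i\<in>J. (z i - mean J z) * d i) + spread J d"
proof -
  have m: "mean J (\<lambda>i. z i + d i) = mean J z + mean J d"
    by (simp add: mean_def sum.distrib add_divide_distrib)
  have "spread J (\<lambda>i. z i + d i) = (\<Sum>i\<in>J. ((z i - mean J z) + (d i - mean J d))\<^sup>2)"
    unfolding spread_def m by (intro sum.cong refl) (simp add: algebra_simps)
  also have "\<dots> = spread J z + spread J d + 2 * (\<Sum>i\<in>J. (z i - mean J z) * (d i - mean J d))"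
    by (simp only: spread_def power2_sum sum.distrib sum_distrib_left mult.assoc)
  finally show ?thesis by (simp only: sum_minus_mean_mult[of z d] add_ac)
qed

lemma spread_Cauchy_Schwarz: "(\<Sum>i\<in>J. (z i - mean J z) * d i)\<^sup>2 \<le> spread J z * spread J d"
  unfolding sum_minus_mean_mult[of z d] spread_def by (rule Cauchy_Schwarz_ineq_sum)

lemma spread_Cauchy_Schwarz': "(\<Sum>i\<in>J. (z i - mean J z) * d i)\<^sup>2 \<le> spread J z * (\<Sum>i\<in>J. (d i)\<^sup>2)"
  unfolding spread_def by (rule Cauchy_Schwarz_ineq_sum)

text \<open>Young's inequality for the cross term. The weight r is later the square root of the time
  step: drift increments b of size r^2 then cost only r^3.\<close>

lemma spread_add_ge:
  assumes r: "0 < r"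
  shows "spread J a - (r * spread J a + spread J b / r) \<le> spread J (\<lambda>i. a i + b i)"
proof -
  define X where "X = (\<Sum>i\<in>J. (a i - mean J a) * b i)"
  have "X\<^sup>2 \<le> spread J a * spread J b" unfolding X_def by (rule spread_Cauchy_Schwarz)
  then have "\<bar>X\<bar> \<le> sqrt (spread J a * spread J b)"
    using real_sqrt_le_mono[of "X\<^sup>2"] by simp
  also have "\<dots> = sqrt ((r * spread J a) * (spread J b / r))" using r by simp
  also have "\<dots> \<le> (r * spread J a + spread J b / r) / 2" (is "_ \<le> ?Y / 2")
    using r by (intro arith_geo_mean_sqrt) (auto simp: spread_nonneg)
  finally have "\<bar>X\<bar> \<le> ?Y / 2" .
  moreover have "- X \<le> \<bar>X\<bar>" by simp
  ultimately have "- X \<le> ?Y / 2" by (rule order.trans[rotated])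
  then have "- (2 * X) \<le> ?Y" by simp
  then show ?thesis using spread_nonneg[of J b] by (simp add: spread_add X_def)
qed

text \<open>One step of the Ito expansion of \<open>(spread + e) powr (-d)\<close>, with martingale increments \<open>a\<close> and
  drift increments \<open>b\<close> over a time interval of length \<open>r\<^sup>2\<close>.\<close>

lemma spread_powr_step:
  assumes e: "0 < e" and d: "0 < d" and G: "0 \<le> G"
  obtains K where "0 \<le> K" "\<And>z a b r. 0 < r \<Longrightarrow> r \<le> 1 \<Longrightarrow> (\<And>i. i \<in> J \<Longrightarrow> \<bar>b i\<bar> \<le> G * r\<^sup>2) \<Longrightarrow>
    (spread J (\<lambda>i. z i + (a i + b i)) + e) powr (-d) \<le> (spread J z + e) powr (-d)
      - 2 * d * (spread J z + e) powr (-d - 1) * (\<Sum>i\<in>J. (z i - mean J z) * a i)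
      + 2 * d * (d + 1) * (spread J z + e) powr (-d - 2) * (\<Sum>i\<in>J. (z i - mean J z) * a i)\<^sup>2
      - d * (spread J z + e) powr (-d - 1) * spread J a
      + 2 * d * (spread J z + e) powr (-d - 1) * (sqrt (spread J z) * sqrt (card J) * G * r\<^sup>2)
      + K * (r * (\<Sum>i\<in>J. (a i)\<^sup>2) + (\<Sum>i\<in>J. a i ^ 4) / r + r ^ 3)"
proof -
  define n where "n = real (card J)"
  have n: "1 \<le> n" using J by (simp add: n_def Suc_leI card_gt_0_iff)
  \<comment> \<open>\<open>C\<close> is the coefficient of the Taylor remainder; \<open>q1\<close>
    and \<open>q3\<close> will bound \<open>P1\<close> and \<open>P2 * R\<close> uniformly in
    z.\<close>
  define C where "C = (4 / 3 * d * (d + 1) * (d + 2) + 2 * d * (d + 1)) * e powr (-d - 3 / 2)"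
  define q1 where "q1 = d * e powr (-d - 1)"
  define q3 where "q3 = 2 * d * (d + 1) * e powr (-d - 1)"
  have nn: "0 \<le> C" "0 \<le> q1" "0 \<le> q3" using d by (auto simp: C_def q1_def q3_def)
  \<comment> \<open>The factors in front of \<open>q1\<close>, \<open>q3\<close> and
    \<open>C\<close> collect the errors in \<open>t2\<close>, \<open>t3\<close> and
    \<open>t4\<close>. This K depends on e, which is harmless because the mesh tends to 0 while e is
    fixed.\<close>
  define K where "K = q1 * (1 + n * G\<^sup>2) + q3 * (1 + 2 * (n * G\<^sup>2)) + C * (4 * n + 1 + n * G\<^sup>2 + 4 * n * (n * G ^ 4))"
  have "0 \<le> K" using nn n by (simp add: K_def)
  moreover have "(spread J (\<lambda>i. z i + (a i + b i)) + e) powr (-d) \<le> (spread J z + e) powr (-d)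
      - 2 * d * (spread J z + e) powr (-d - 1) * (\<Sum>i\<in>J. (z i - mean J z) * a i)
      + 2 * d * (d + 1) * (spread J z + e) powr (-d - 2) * (\<Sum>i\<in>J. (z i - mean J z) * a i)\<^sup>2
      - d * (spread J z + e) powr (-d - 1) * spread J a
      + 2 * d * (spread J z + e) powr (-d - 1) * (sqrt (spread J z) * sqrt (card J) * G * r\<^sup>2)
      + K * (r * (\<Sum>i\<in>J. (a i)\<^sup>2) + (\<Sum>i\<in>J. a i ^ 4) / r + r ^ 3)"
    if r: "0 < r" "r \<le> 1" and b: "\<And>i. i \<in> J \<Longrightarrow> \<bar>b i\<bar> \<le> G * r\<^sup>2" for z a b r
  proof -
    define R where "R = spread J z"
    define P1 where "P1 = d * (R + e) powr (-d - 1)"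
    define P2 where "P2 = 2 * d * (d + 1) * (R + e) powr (-d - 2)"
    define y where "y i = z i - mean J z" for i
    define Xa Xb where "Xa = (\<Sum>i\<in>J. y i * a i)" and "Xb = (\<Sum>i\<in>J. y i * b i)"
    define A2 A4 where "A2 = (\<Sum>i\<in>J. (a i)\<^sup>2)" and "A4 = (\<Sum>i\<in>J. a i ^ 4)"
    define \<beta> where "\<beta> = n * G\<^sup>2 * r ^ 4"
    define D where "D = spread J (\<lambda>i. a i + b i)"
    have R: "0 \<le> R" and D: "0 \<le> D" by (simp_all add: R_def D_def spread_nonneg)
    have A: "0 \<le> A2" "0 \<le> A4" by (simp_all add: A2_def A4_def sum_nonneg)
    have \<beta>0: "0 \<le> \<beta>" using n by (simp add: \<beta>_def)
    have r4: "r ^ 4 \<le> r ^ 3" "r ^ 7 \<le> r ^ 3" "r ^ 5 \<le> r ^ 3"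
    proof -
      show "r ^ 4 \<le> r ^ 3" "r ^ 7 \<le> r ^ 3" "r ^ 5 \<le> r ^ 3"
        using r by (auto intro!: power_decreasing)
    qed
    have P1: "0 \<le> P1" "P1 \<le> q1"
      using d e R by (auto simp: P1_def q1_def intro!: mult_left_mono powr_mono2')
    have P2: "0 \<le> P2" using d by (simp add: P2_def)
    have P2R: "P2 * R \<le> q3"
    proof -
      have "P2 * R \<le> P2 * (R + e)" using P2 e by (intro mult_left_mono) auto
      also have "\<dots> = 2 * d * (d + 1) * (R + e) powr (-d - 1)"
      proof -
        have "(R + e) powr (-d - 2) * (R + e) = (R + e) powr (-d - 1)"
          using R e by (simp add: powr_diff power2_eq_square)
        then show ?thesis by (simp add: P2_def)
      qed
      also have "\<dots> \<le> q3" unfolding q3_def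
        using d e R by (intro mult_left_mono powr_mono2') auto
      finally show ?thesis .
    qed
    have b2: "(\<Sum>i\<in>J. (b i)\<^sup>2) \<le> \<beta>"
    proof -
      have "(\<Sum>i\<in>J. (b i)\<^sup>2) \<le> (\<Sum>i\<in>J. (G * r\<^sup>2)\<^sup>2)"
        using power_mono[OF b, of _ 2] by (intro sum_mono) simp
      then show ?thesis by (simp add: \<beta>_def n_def power_mult_distrib)
    qed
    have b4: "(\<Sum>i\<in>J. b i ^ 4) \<le> n * G ^ 4 * r ^ 8"
    proof -
      have "(\<Sum>i\<in>J. b i ^ 4) \<le> (\<Sum>i\<in>J. (G * r\<^sup>2) ^ 4)"
        using power_mono[OF b, of _ 4] by (intro sum_mono) (simp add: power_even_abs)
      then show ?thesis by (simp add: n_def power_mult_distrib)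
    qed
    have Xa2: "Xa\<^sup>2 \<le> R * A2" and Xb2: "Xb\<^sup>2 \<le> R * \<beta>"
    proof -
      show "Xa\<^sup>2 \<le> R * A2" unfolding Xa_def R_def A2_def y_def by (rule spread_Cauchy_Schwarz')
      have "Xb\<^sup>2 \<le> R * (\<Sum>i\<in>J. (b i)\<^sup>2)" unfolding Xb_def R_def y_def by (rule spread_Cauchy_Schwarz')
      also have "\<dots> \<le> R * \<beta>" using R b2 by (rule mult_left_mono[rotated])
      finally show "Xb\<^sup>2 \<le> R * \<beta>" .
    qed
    have X_eq: "(\<Sum>i\<in>J. (z i - mean J z) * (a i + b i)) = Xa + Xb"
      by (simp add: Xa_def Xb_def y_def distrib_left sum.distrib)
    have "(Xa + Xb)\<^sup>2 \<le> R * D"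
      unfolding X_eq[symmetric] R_def D_def by (rule spread_Cauchy_Schwarz)
    note taylor = powr_taylor_bound[OF R D this e d]
    have eq: "spread J (\<lambda>i. z i + (a i + b i)) = R + 2 * (Xa + Xb) + D"
      unfolding R_def D_def X_eq[symmetric] by (rule spread_add)
    have main: "(spread J (\<lambda>i. z i + (a i + b i)) + e) powr (-d) \<le>
        (R + e) powr (-d) - P1 * (2 * (Xa + Xb) + D) + P2 * (Xa + Xb)\<^sup>2 + C * (D * sqrt D)"
      unfolding eq P1_def P2_def C_def by (rule taylor)
    \<comment> \<open>The one contribution of the drift that is of first order in the time step r^2.
      It is kept with its factor sqrt R, on which \<open>drift_bound\<close> relies.\<close>
    have t1: "- (P1 * (2 * Xb)) \<le> 2 * P1 * (sqrt R * sqrt n * G * r\<^sup>2)"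
    proof -
      have "\<bar>Xb\<bar> \<le> sqrt (R * \<beta>)" using real_sqrt_le_mono[OF Xb2] by simp
      also have "\<dots> = sqrt R * (sqrt n * sqrt ((G * r\<^sup>2)\<^sup>2))"
        by (simp only: \<beta>_def power_mult_distrib power_mult[symmetric] real_sqrt_mult mult.assoc) simp
      also have "sqrt ((G * r\<^sup>2)\<^sup>2) = G * r\<^sup>2"
        unfolding real_sqrt_abs using G by (intro abs_of_nonneg) simp
      also have "sqrt R * (sqrt n * (G * r\<^sup>2)) = sqrt R * sqrt n * G * r\<^sup>2" by (simp only: mult.assoc)
      finally have "- Xb \<le> sqrt R * sqrt n * G * r\<^sup>2" by linarith
      from mult_left_mono[OF this, of "2 * P1"] show ?thesis using P1(1) by simp
    qed
    have \<beta>r: "\<beta> / r = n * G\<^sup>2 * r ^ 3" using r by (simp add: \<beta>_def eval_nat_numeral)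
    have \<beta>r3: "\<beta> \<le> n * G\<^sup>2 * r ^ 3" unfolding \<beta>_def using r4(1) n by (intro mult_left_mono) auto
    have t2: "- (P1 * D) \<le> - (P1 * spread J a) + q1 * (r * A2 + n * G\<^sup>2 * r ^ 3)"
    proof -
      have "spread J a - (r * spread J a + spread J b / r) \<le> D"
        unfolding D_def by (rule spread_add_ge[OF r(1)])
      moreover have "r * spread J a \<le> r * A2" unfolding A2_def using r by (intro mult_left_mono spread_le) auto
      moreover have "spread J b / r \<le> \<beta> / r" using r order.trans[OF spread_le b2] by (intro divide_right_mono) auto
      ultimately have "spread J a - (r * A2 + n * G\<^sup>2 * r ^ 3) \<le> D" using \<beta>r by linarith
      from mult_left_mono[OF this P1(1)]
      have "- (P1 * D) \<le> - (P1 * spread J a) + P1 * (r * A2 + n * G\<^sup>2 * r ^ 3)" by (simp add: algebra_simps)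
      also have "P1 * (r * A2 + n * G\<^sup>2 * r ^ 3) \<le> q1 * (r * A2 + n * G\<^sup>2 * r ^ 3)"
        using P1(2) r A n by (intro mult_right_mono) auto
      finally show ?thesis by simp
    qed
    have t3: "P2 * (Xa + Xb)\<^sup>2 \<le> P2 * Xa\<^sup>2 + q3 * (r * A2 + 2 * (n * G\<^sup>2) * r ^ 3)"
    proof -
      \<comment> \<open>Young's inequality with weight r makes the mixed term of order r^3 in
        expectation.\<close>
      have "2 * Xa * Xb \<le> r * Xa\<^sup>2 + Xb\<^sup>2 / r"
      proof -
        have "0 \<le> (r * Xa - Xb)\<^sup>2 / r" using r by simp
        also have "\<dots> = r * Xa\<^sup>2 + Xb\<^sup>2 / r - 2 * Xa * Xb"
          using r by (simp add: power2_eq_square field_simps)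
        finally show ?thesis by simp
      qed
      also have "\<dots> \<le> r * (R * A2) + R * \<beta> / r"
        using r Xa2 Xb2 by (intro add_mono mult_left_mono divide_right_mono) auto
      finally have "(Xa + Xb)\<^sup>2 \<le> Xa\<^sup>2 + (r * (R * A2) + R * \<beta> / r) + R * \<beta>"
        using Xb2 by (simp add: power2_sum)
      also have "\<dots> = Xa\<^sup>2 + R * (r * A2 + (\<beta> / r + \<beta>))" by (simp add: algebra_simps)
      also have "\<dots> \<le> Xa\<^sup>2 + R * (r * A2 + 2 * (n * G\<^sup>2) * r ^ 3)"
        using \<beta>r \<beta>r3 R by (intro add_left_mono mult_left_mono) auto
      finally have "P2 * (Xa + Xb)\<^sup>2 \<le> P2 * (Xa\<^sup>2 + R * (r * A2 + 2 * (n * G\<^sup>2) * r ^ 3))"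
        using P2 by (rule mult_left_mono)
      also have "\<dots> = P2 * Xa\<^sup>2 + P2 * R * (r * A2 + 2 * (n * G\<^sup>2) * r ^ 3)" by (simp add: algebra_simps)
      also have "P2 * R * (r * A2 + 2 * (n * G\<^sup>2) * r ^ 3) \<le> q3 * (r * A2 + 2 * (n * G\<^sup>2) * r ^ 3)"
        using P2R r A n by (intro mult_right_mono) auto
      finally show ?thesis by simp
    qed
    have t4: "D * sqrt D \<le> (4 * n + 1 + n * G\<^sup>2 + 4 * n * (n * G ^ 4)) * (r * A2 + A4 / r + r ^ 3)"
    proof -
      define Q2 Q4 where "Q2 = (\<Sum>i\<in>J. (a i + b i)\<^sup>2)" and "Q4 = (\<Sum>i\<in>J. (a i + b i) ^ 4)"
      have "D \<le> Q2" unfolding D_def Q2_def by (rule spread_le)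
      have Q2: "Q2 \<le> 2 * A2 + 2 * \<beta>"
      proof -
        have "(x + y)\<^sup>2 \<le> 2 * x\<^sup>2 + 2 * y\<^sup>2" for x y :: real
          using sum_squares_bound[of x y] by (simp add: power2_sum)
        then have "Q2 \<le> (\<Sum>i\<in>J. 2 * (a i)\<^sup>2 + 2 * (b i)\<^sup>2)" unfolding Q2_def by (intro sum_mono)
        then show ?thesis using b2 by (simp add: A2_def sum.distrib sum_distrib_left[symmetric])
      qed
      have Q4: "Q4 \<le> 8 * A4 + 8 * (n * G ^ 4 * r ^ 8)"
      proof -
        have "Q4 \<le> (\<Sum>i\<in>J. 8 * a i ^ 4 + 8 * b i ^ 4)" unfolding Q4_def by (intro sum_mono power4_add_le)
        then show ?thesis using b4 by (simp add: A4_def sum.distrib sum_distrib_left[symmetric])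
      qed
      have "D\<^sup>2 \<le> Q2\<^sup>2" using \<open>D \<le> Q2\<close> D by (intro power_mono)
      also have "\<dots> \<le> n * Q4"
        using Cauchy_Schwarz_ineq_sum[of "\<lambda>_. 1" "\<lambda>i. (a i + b i)\<^sup>2" J] by (simp add: Q2_def Q4_def n_def)
      also have "\<dots> \<le> n * (8 * A4 + 8 * (n * G ^ 4 * r ^ 8))" using Q4 n by (intro mult_left_mono) auto
      finally have D2: "D\<^sup>2 / r \<le> n * (8 * A4 + 8 * (n * G ^ 4 * r ^ 8)) / r" using r by (intro divide_right_mono) auto
      \<comment> \<open>The cubic remainder is split by the arithmetic-geometric mean inequality
        into a fourth moment divided by r and a second moment times r; both are of order r^3 in
        expectation.\<close>
      have "D * sqrt D = sqrt (D\<^sup>2 / r * (D * r))" using D r by (simp add: real_sqrt_mult real_sqrt_divide)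
      also have "\<dots> \<le> (D\<^sup>2 / r + D * r) / 2" using D r by (intro arith_geo_mean_sqrt) auto
      also have "\<dots> \<le> (n * (8 * A4 + 8 * (n * G ^ 4 * r ^ 8)) / r + (2 * A2 + 2 * \<beta>) * r) / 2"
      proof -
        have "D * r \<le> (2 * A2 + 2 * \<beta>) * r" using \<open>D \<le> Q2\<close> Q2 r by (intro mult_right_mono) auto
        then show ?thesis by (intro divide_right_mono add_mono D2) simp_all
      qed
      also have "\<dots> = 4 * n * (A4 / r) + 4 * n * (n * G ^ 4) * r ^ 7 + r * A2 + n * G\<^sup>2 * r ^ 5"
        using r by (simp add: \<beta>_def field_simps eval_nat_numeral)
      also have "\<dots> \<le> 4 * n * (A4 / r) + 4 * n * (n * G ^ 4) * r ^ 3 + r * A2 + n * G\<^sup>2 * r ^ 3"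
        using r r4 n G by (intro add_mono mult_left_mono) auto
      also have "\<dots> \<le> (4 * n + 1 + n * G\<^sup>2 + 4 * n * (n * G ^ 4)) * (r * A2 + A4 / r + r ^ 3)"
      proof -
        define S where "S = r * A2 + A4 / r + r ^ 3"
        have "A4 / r \<le> S" "r ^ 3 \<le> S" "r * A2 \<le> S" using r A by (auto simp: S_def)
        have "4 * n * (A4 / r) + 4 * n * (n * G ^ 4) * r ^ 3 + r * A2 + n * G\<^sup>2 * r ^ 3 \<le>
          4 * n * S + 4 * n * (n * G ^ 4) * S + S + n * G\<^sup>2 * S"
          using n G \<open>A4 / r \<le> S\<close> \<open>r ^ 3 \<le> S\<close> \<open>r * A2 \<le> S\<close> by (intro add_mono mult_left_mono) auto
        also have "\<dots> = (4 * n + 1 + n * G\<^sup>2 + 4 * n * (n * G ^ 4)) * S" by (simp add: algebra_simps)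
        finally show ?thesis by (simp only: S_def)
      qed
      finally show ?thesis .
    qed
    define S where "S = r * A2 + A4 / r + r ^ 3"
    have S: "r * A2 + c * r ^ 3 \<le> (1 + c) * S" if "0 \<le> c" for c
    proof -
      have "r * A2 \<le> S" "r ^ 3 \<le> S" using r A by (auto simp: S_def)
      then have "r * A2 + c * r ^ 3 \<le> S + c * S" using that by (intro add_mono mult_left_mono)
      then show ?thesis by (simp add: algebra_simps)
    qed
    have "q1 * (r * A2 + n * G\<^sup>2 * r ^ 3) \<le> q1 * ((1 + n * G\<^sup>2) * S)"
      using nn n by (intro mult_left_mono S) auto
    moreover have "q3 * (r * A2 + 2 * (n * G\<^sup>2) * r ^ 3) \<le> q3 * ((1 + 2 * (n * G\<^sup>2)) * S)"
      using nn n by (intro mult_left_mono S) auto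
    moreover have "C * (D * sqrt D) \<le> C * ((4 * n + 1 + n * G\<^sup>2 + 4 * n * (n * G ^ 4)) * S)"
      using nn t4 by (intro mult_left_mono) (auto simp: S_def)
    moreover have "K * S = q1 * ((1 + n * G\<^sup>2) * S) + q3 * ((1 + 2 * (n * G\<^sup>2)) * S) + C * ((4 * n + 1 + n * G\<^sup>2 + 4 * n * (n * G ^ 4)) * S)"
      by (simp add: K_def algebra_simps)
    ultimately have err: "q1 * (r * A2 + n * G\<^sup>2 * r ^ 3) + q3 * (r * A2 + 2 * (n * G\<^sup>2) * r ^ 3) + C * (D * sqrt D) \<le> K * S"
      by linarith
    have "P1 * (2 * (Xa + Xb) + D) = P1 * (2 * Xa) + P1 * (2 * Xb) + P1 * D" by (simp add: algebra_simps)
    with main t1 t2 t3 err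
    have "(spread J (\<lambda>i. z i + (a i + b i)) + e) powr (-d) \<le> (R + e) powr (-d) - P1 * (2 * Xa) + P2 * Xa\<^sup>2
      - P1 * spread J a + 2 * P1 * (sqrt R * sqrt n * G * r\<^sup>2) + K * S" by linarith
    then show ?thesis
      by (simp add: P1_def P2_def R_def Xa_def y_def n_def S_def A2_def A4_def mult_ac)
  qed
  ultimately show thesis by (rule that)
qed

end

section \<open>Absence of collisions in a finite cluster\<close>

text \<open>The \<open>I i\<close> are the martingale parts of the particles \<open>X i\<close>. The exponent \<open>d\<close> is chosen such that
  \<open>(spread + e) powr (-d)\<close> is almost a supermartingale.\<close>

locale particle_cluster = usual_filtration M F for M :: "'a measure" and F +
  fixes J :: "nat set" and X I :: "nat \<Rightarrow> real \<Rightarrow> 'a \<Rightarrow> real" and G a b d :: real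
  assumes J: "finite J" "J \<noteq> {}" and G: "0 \<le> G" and d: "0 < d"
    and X_adapted: "\<And>i. i \<in> J \<Longrightarrow> adapted F (X i)" and X_cont: "\<And>i. i \<in> J \<Longrightarrow> continuous_paths M (X i)"
    and drift: "\<And>i s t. i \<in> J \<Longrightarrow> 0 \<le> s \<Longrightarrow> s \<le> t \<Longrightarrow>
      AE \<omega> in M. \<bar>X i t \<omega> - X i s \<omega> - (I i t \<omega> - I i s \<omega>)\<bar> \<le> G * (t - s)"
    and I_L4: "\<And>i s t. i \<in> J \<Longrightarrow> 0 \<le> s \<Longrightarrow> s \<le> t \<Longrightarrow> L4 M (\<lambda>\<omega>. I i t \<omega> - I i s \<omega>)"
    and I_fourth: "\<And>i s t. i \<in> J \<Longrightarrow> 0 \<le> s \<Longrightarrow> s \<le> t \<Longrightarrow>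
      expectation (\<lambda>\<omega>. (I i t \<omega> - I i s \<omega>) ^ 4) \<le> 3 * b ^ 4 * (t - s)\<^sup>2"
    and I_centered: "\<And>i s t \<zeta> B. i \<in> J \<Longrightarrow> 0 \<le> s \<Longrightarrow> s \<le> t \<Longrightarrow> \<zeta> \<in> borel_measurable (F s) \<Longrightarrow>
      (\<And>\<omega>. \<omega> \<in> space M \<Longrightarrow> \<bar>\<zeta> \<omega>\<bar> \<le> B) \<Longrightarrow> expectation (\<lambda>\<omega>. \<zeta> \<omega> * (I i t \<omega> - I i s \<omega>)) = 0"
    and I_lower: "\<And>i s t \<zeta> B. i \<in> J \<Longrightarrow> 0 \<le> s \<Longrightarrow> s \<le> t \<Longrightarrow> \<zeta> \<in> borel_measurable (F s) \<Longrightarrow>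
      (\<And>\<omega>. \<omega> \<in> space M \<Longrightarrow> 0 \<le> \<zeta> \<omega>) \<Longrightarrow> (\<And>\<omega>. \<omega> \<in> space M \<Longrightarrow> \<zeta> \<omega> \<le> B) \<Longrightarrow>
      a\<^sup>2 * (t - s) * expectation \<zeta> \<le> expectation (\<lambda>\<omega>. \<zeta> \<omega> * (I i t \<omega> - I i s \<omega>)\<^sup>2)"
    and I_upper: "\<And>i s t \<zeta> B. i \<in> J \<Longrightarrow> 0 \<le> s \<Longrightarrow> s \<le> t \<Longrightarrow> \<zeta> \<in> borel_measurable (F s) \<Longrightarrow>
      (\<And>\<omega>. \<omega> \<in> space M \<Longrightarrow> 0 \<le> \<zeta> \<omega>) \<Longrightarrow> (\<And>\<omega>. \<omega> \<in> space M \<Longrightarrow> \<zeta> \<omega> \<le> B) \<Longrightarrow>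
      expectation (\<lambda>\<omega>. \<zeta> \<omega> * (I i t \<omega> - I i s \<omega>)\<^sup>2) \<le> b\<^sup>2 * (t - s) * expectation \<zeta>"
    and I_uncorrelated: "\<And>i j s t \<zeta> B. i \<in> J \<Longrightarrow> j \<in> J \<Longrightarrow> i \<noteq> j \<Longrightarrow> 0 \<le> s \<Longrightarrow> s \<le> t \<Longrightarrow>
      \<zeta> \<in> borel_measurable (F s) \<Longrightarrow> (\<And>\<omega>. \<omega> \<in> space M \<Longrightarrow> \<bar>\<zeta> \<omega>\<bar> \<le> B) \<Longrightarrow>
      expectation (\<lambda>\<omega>. \<zeta> \<omega> * ((I i t \<omega> - I i s \<omega>) * (I j t \<omega> - I j s \<omega>))) = 0"
    and gap: "2 * (1 + d) * b\<^sup>2 < (real (card J) - 1) * a\<^sup>2"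
begin

text \<open>The slack in the gap condition. Without particle drift, the generator applied to V is at
  most -c d times \<open>(R + e) powr (-d - 1)\<close>.\<close>

definition c :: real where "c = (real (card J) - 1) * a\<^sup>2 - 2 * (1 + d) * b\<^sup>2"

lemma c_pos: "0 < c" using gap by (simp add: c_def)

text \<open>The growth rate left over when the square is completed in
  \<open>drift_bound\<close>.\<close>

definition K :: real where "K = d * G\<^sup>2 * real (card J) / c"

lemma K_nonneg: "0 \<le> K" using c_pos d by (simp add: K_def)

definition R :: "real \<Rightarrow> 'a \<Rightarrow> real" where
  "R t \<omega> = spread J (\<lambda>i. X i t \<omega>)"

lemma R_nonneg: "0 \<le> R t \<omega>" by (simp add: R_def spread_nonneg)

lemma mean_measurable: "0 \<le> t \<Longrightarrow> (\<lambda>\<omega>. mean J (\<lambda>i. X i t \<omega>)) \<in> borel_measurable (F t)"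
  unfolding mean_def using X_adapted
  by (intro borel_measurable_divide borel_measurable_sum) (auto simp: adapted_def)

lemma R_measurable: "0 \<le> t \<Longrightarrow> R t \<in> borel_measurable (F t)"
  unfolding R_def[abs_def] spread_def using X_adapted mean_measurable[of t]
  by (intro borel_measurable_sum borel_measurable_power borel_measurable_diff) (auto simp: adapted_def)

definition V :: "real \<Rightarrow> real \<Rightarrow> 'a \<Rightarrow> real" where
  "V e t \<omega> = (R t \<omega> + e) powr (-d)"

lemma V_bounds: "0 < e \<Longrightarrow> 0 \<le> V e t \<omega>" "0 < e \<Longrightarrow> V e t \<omega> \<le> e powr (-d)"
  using d R_nonneg[of t \<omega>] by (auto simp: V_def intro!: powr_mono2')

lemma V_measurable: "0 \<le> t \<Longrightarrow> V e t \<in> borel_measurable (F t)"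
  unfolding V_def[abs_def] using R_measurable[of t] by measurable

lemma V_integrable:
  assumes "0 < e" "0 \<le> t" "A \<in> events"
  shows "integrable M (\<lambda>\<omega>. indicator A \<omega> * V e t \<omega>)"
proof (rule integrable_bounded[where b="e powr (-d)"])
  show "(\<lambda>\<omega>. indicator A \<omega> * V e t \<omega>) \<in> borel_measurable M"
    using borel_measurable_F[OF V_measurable[OF assms(2)]] assms(3) by auto
  show "\<bar>indicator A \<omega> * V e t \<omega>\<bar> \<le> e powr (-d)" for \<omega>
    using V_bounds[OF assms(1), of t \<omega>] by (auto simp: indicator_def)
qed

text \<open>The left side bounds the generator on V at spread \<open>\<rho>\<close>. Since P2 \<rho>
  \<le> 2 (d + 1) P1, its first two terms are at most -c P1, and 2 sqrt (\<rho> n) G \<le> c +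
  \<rho> n G^2 / c absorbs the drift. For \<open>\<rho> = 0\<close> the drift term vanishes, nothing
  has to be absorbed, and -c P1 survives as the killing term.\<close>

lemma drift_bound:
  assumes \<rho>: "0 \<le> \<rho>" and e: "0 < e"
  defines "P1 \<equiv> d * (\<rho> + e) powr (-d - 1)" and "P2 \<equiv> 2 * d * (d + 1) * (\<rho> + e) powr (-d - 2)"
  shows "b\<^sup>2 * (P2 * \<rho>) - (real (card J) - 1) * a\<^sup>2 * P1 + 2 * P1 * (sqrt \<rho> * sqrt (card J) * G) \<le>
    K * (\<rho> + e) powr (-d) - d * c * e powr (-d - 1) * of_bool (\<rho> = 0)"
proof -
  define n where "n = real (card J)"
  have pos: "0 < \<rho> + e" using \<rho> e by simp
  have P: "0 \<le> P1" "0 \<le> P2" using d by (auto simp: P1_def P2_def)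
  have P2e: "P2 * (\<rho> + e) = 2 * (d + 1) * P1"
    using pos by (simp add: P1_def P2_def powr_diff power2_eq_square)
  have P1e: "P1 * (\<rho> + e) = d * (\<rho> + e) powr (-d)"
    using pos by (simp add: P1_def powr_diff)
  have "P2 * \<rho> \<le> P2 * (\<rho> + e)" using P e by (intro mult_left_mono) auto
  then have "b\<^sup>2 * (P2 * \<rho>) \<le> b\<^sup>2 * (2 * (d + 1) * P1)" unfolding P2e by (intro mult_left_mono) auto
  then have 1: "b\<^sup>2 * (P2 * \<rho>) - (n - 1) * a\<^sup>2 * P1 + 2 * P1 * (sqrt \<rho> * sqrt n * G) \<le>
    P1 * (2 * (sqrt \<rho> * sqrt n * G) - c)"
    by (simp add: c_def n_def algebra_simps)
  show ?thesis
  proof (cases "\<rho> = 0")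
    case True
    have "0 \<le> K * (\<rho> + e) powr (-d)" using K_nonneg by simp
    then show ?thesis using 1 True by (simp add: n_def P1_def mult_ac)
  next
    case False
    have "0 \<le> (sqrt \<rho> * sqrt n * G - c)\<^sup>2 / c" using c_pos by simp
    also have "\<dots> = \<rho> * n * G\<^sup>2 / c - 2 * (sqrt \<rho> * sqrt n * G) + c"
      using \<rho> c_pos by (simp add: n_def power2_diff power_mult_distrib field_simps power2_eq_square[of c])
    finally have "2 * (sqrt \<rho> * sqrt n * G) - c \<le> \<rho> * n * G\<^sup>2 / c" by simp
    also have "\<dots> \<le> (\<rho> + e) * n * G\<^sup>2 / c"
      using e c_pos by (intro divide_right_mono mult_right_mono) (auto simp: n_def)
    finally have "P1 * (2 * (sqrt \<rho> * sqrt n * G) - c) \<le> P1 * ((\<rho> + e) * n * G\<^sup>2 / c)"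
      using P by (intro mult_left_mono)
    also have "\<dots> = P1 * (\<rho> + e) * (n * G\<^sup>2 / c)" by simp
    also have "\<dots> = K * (\<rho> + e) powr (-d)" unfolding P1e by (simp add: K_def n_def)
    finally show ?thesis using 1 False by (simp add: n_def)
  qed
qed

text \<open>\<open>spread_powr_step\<close> tested against an event known at time s. The linear
  terms vanish, the quadratic ones are controlled by second moments, and \<open>drift_bound\<close>
  combines them. \<open>C\<close> depends on e but not on s, h or A, so the errors of many small
  steps add up to a multiple of sqrt h.\<close>

lemma one_step:
  assumes e: "0 < e"
  obtains C where "0 \<le> C" "\<And>s h A. 0 \<le> s \<Longrightarrow> 0 < h \<Longrightarrow> h \<le> 1 \<Longrightarrow> A \<in> sets (F s) \<Longrightarrow>
    expectation (\<lambda>\<omega>. indicator A \<omega> * V e (s + h) \<omega>) + d * c * e powr (-d - 1) * h * prob {\<omega>\<in>A. R s \<omega> = 0} \<le>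
    (1 + K * h) * expectation (\<lambda>\<omega>. indicator A \<omega> * V e s \<omega>) + C * (h * sqrt h)"
proof -
  define n where "n = real (card J)"
  have n: "1 \<le> n" using J by (simp add: n_def Suc_leI card_gt_0_iff)
  obtain K0 where K0: "0 \<le> K0" and step: "\<And>z a b r. 0 < r \<Longrightarrow> r \<le> 1 \<Longrightarrow> (\<And>i. i \<in> J \<Longrightarrow> \<bar>b i\<bar> \<le> G * r\<^sup>2) \<Longrightarrow>
    (spread J (\<lambda>i. z i + (a i + b i)) + e) powr (-d) \<le> (spread J z + e) powr (-d)
      - 2 * d * (spread J z + e) powr (-d - 1) * (\<Sum>i\<in>J. (z i - mean J z) * a i)
      + 2 * d * (d + 1) * (spread J z + e) powr (-d - 2) * (\<Sum>i\<in>J. (z i - mean J z) * a i)\<^sup>2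
      - d * (spread J z + e) powr (-d - 1) * spread J a
      + 2 * d * (spread J z + e) powr (-d - 1) * (sqrt (spread J z) * sqrt (card J) * G * r\<^sup>2)
      + K0 * (r * (\<Sum>i\<in>J. (a i)\<^sup>2) + (\<Sum>i\<in>J. a i ^ 4) / r + r ^ 3)"
    using spread_powr_step[OF J e d G] by blast
  define C where "C = K0 * (n * b\<^sup>2 + 3 * (n * b ^ 4) + 1)"
  have "0 \<le> C" using K0 n by (simp add: C_def)
  moreover have "expectation (\<lambda>\<omega>. indicator A \<omega> * V e (s + h) \<omega>) + d * c * e powr (-d - 1) * h * prob {\<omega>\<in>A. R s \<omega> = 0} \<le>
    (1 + K * h) * expectation (\<lambda>\<omega>. indicator A \<omega> * V e s \<omega>) + C * (h * sqrt h)"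
    if s: "0 \<le> s" and h: "0 < h" "h \<le> 1" and A: "A \<in> sets (F s)" for s h A
  proof -
    \<comment> \<open>With this weight the three error terms of \<open>spread_powr_step\<close> all
      have expectation of order h * sqrt h.\<close>
    define r where "r = sqrt h"
    have r: "0 < r" "r \<le> 1" "r\<^sup>2 = h" "r ^ 3 = h * sqrt h"
      using h by (auto simp: r_def eval_nat_numeral)
    define x where "x i \<omega> = I i (s + h) \<omega> - I i s \<omega>" for i \<omega>
    define y where "y i \<omega> = X i s \<omega> - mean J (\<lambda>i. X i s \<omega>)" for i \<omega>
    define P1 where "P1 \<omega> = d * (R s \<omega> + e) powr (-d - 1)" for \<omega>
    define P2 where "P2 \<omega> = 2 * d * (d + 1) * (R s \<omega> + e) powr (-d - 2)" for \<omega>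
    \<comment> \<open>\<open>q1\<close>, \<open>q0\<close> and \<open>q3\<close> will bound
      \<open>P1\<close>, \<open>P1\<close> (1 + R) and \<open>P2\<close> R. The deviations y are
      unbounded, but their products with \<open>P1\<close> and \<open>P2\<close> are not, and the
      moment estimates require bounded multipliers.\<close>
    define q1 where "q1 = d * e powr (-d - 1)"
    define q0 where "q0 = q1 + d * e powr (-d)"
    define q3 where "q3 = 2 * d * (d + 1) * e powr (-d - 1)"
    have q0: "0 \<le> q0" using d by (simp add: q0_def q1_def)
    define z where "z \<omega> = indicat_real A \<omega>" for \<omega>
    have sh: "0 \<le> s" "s \<le> s + h" "0 \<le> s + h" using s h by auto
    have AM: "A \<in> events" using A sets_F_subset by auto
    have z: "0 \<le> z \<omega>" "z \<omega> \<le> 1" for \<omega> by (auto simp: z_def indicator_def)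
    have mF [measurable]: "z \<in> borel_measurable (F s)" "R s \<in> borel_measurable (F s)"
      using A R_measurable[OF s] by (auto simp: z_def[abs_def])
    have yF: "y i \<in> borel_measurable (F s)" if "i \<in> J" for i
      unfolding y_def using X_adapted[OF that] mean_measurable[OF s] s by (auto simp: adapted_def)
    have P1F [measurable]: "P1 \<in> borel_measurable (F s)" and P2F [measurable]: "P2 \<in> borel_measurable (F s)"
      unfolding P1_def[abs_def] P2_def[abs_def] by measurable
    have pos: "0 < R s \<omega> + e" for \<omega> using R_nonneg[of s \<omega>] e by simp
    have y2: "(y i \<omega>)\<^sup>2 \<le> R s \<omega>" if "i \<in> J" for i \<omega>
      unfolding R_def spread_def y_def using J that
      by (intro member_le_sum[where f="\<lambda>i. (X i s \<omega> - mean J (\<lambda>i. X i s \<omega>))\<^sup>2"]) auto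
    have P1: "0 \<le> P1 \<omega>" "P1 \<omega> \<le> q1" for \<omega>
      using d e R_nonneg[of s \<omega>] by (auto simp: P1_def q1_def intro!: mult_left_mono powr_mono2')
    have P2: "0 \<le> P2 \<omega>" for \<omega> using d by (simp add: P2_def)
    have P1R: "P1 \<omega> * (1 + R s \<omega>) \<le> q0" for \<omega>
    proof -
      have "P1 \<omega> * (1 + R s \<omega>) \<le> P1 \<omega> + P1 \<omega> * (R s \<omega> + e)"
        using P1[of \<omega>] e by (simp add: algebra_simps)
      also have "P1 \<omega> * (R s \<omega> + e) = d * (R s \<omega> + e) powr (-d)"
        using pos[of \<omega>] by (simp add: P1_def powr_diff)
      also have "\<dots> \<le> d * e powr (-d)"
        using V_bounds(2)[OF e, of s \<omega>] d by (simp add: V_def)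
      finally show ?thesis using P1(2)[of \<omega>] by (simp add: q0_def)
    qed
    have P2R: "P2 \<omega> * R s \<omega> \<le> q3" for \<omega>
    proof -
      have "P2 \<omega> * R s \<omega> \<le> P2 \<omega> * (R s \<omega> + e)" using P2[of \<omega>] e by (intro mult_left_mono) auto
      also have "\<dots> = 2 * (d + 1) * P1 \<omega>"
        using pos[of \<omega>] by (simp add: P1_def P2_def powr_diff power2_eq_square)
      also have "\<dots> \<le> 2 * (d + 1) * q1" using P1 d by (intro mult_left_mono) auto
      finally show ?thesis by (simp add: q1_def q3_def mult_ac)
    qed
    have y1: "\<bar>y i \<omega>\<bar> \<le> 1 + R s \<omega>" if "i \<in> J" for i \<omega>
    proof -
      have "\<bar>y i \<omega>\<bar> \<le> 1 + (y i \<omega>)\<^sup>2" using sum_squares_bound[of 1 "\<bar>y i \<omega>\<bar>"] by simp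
      then show ?thesis using y2[OF that, of \<omega>] by simp
    qed
    have yy: "\<bar>y i \<omega> * y j \<omega>\<bar> \<le> R s \<omega>" if "i \<in> J" "j \<in> J" for i j \<omega>
    proof -
      have "2 * \<bar>y i \<omega> * y j \<omega>\<bar> \<le> (y i \<omega>)\<^sup>2 + (y j \<omega>)\<^sup>2"
        using sum_squares_bound[of "\<bar>y i \<omega>\<bar>" "\<bar>y j \<omega>\<bar>"] by (simp add: abs_mult mult.assoc)
      then show ?thesis using y2[OF that(1), of \<omega>] y2[OF that(2), of \<omega>] by linarith
    qed
    \<comment> \<open>The multipliers of the linear term, of the squared linear term and of the
      spread of the increments.\<close>
    define \<alpha> where "\<alpha> i \<omega> = z \<omega> * (2 * (P1 \<omega> * y i \<omega>))" for i \<omega>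
    define v where "v i j \<omega> = z \<omega> * (P2 \<omega> * (y i \<omega> * y j \<omega>))" for i j \<omega>
    define w where "w \<omega> = z \<omega> * P1 \<omega>" for \<omega>
    have \<alpha>F: "\<alpha> i \<in> borel_measurable (F s)" if "i \<in> J" for i
      unfolding \<alpha>_def using yF[OF that] by measurable
    have vF: "v i j \<in> borel_measurable (F s)" if "i \<in> J" "j \<in> J" for i j
      unfolding v_def using yF[OF that(1)] yF[OF that(2)] by measurable
    have wF: "w \<in> borel_measurable (F s)" unfolding w_def by measurable
    have \<alpha>b: "\<bar>\<alpha> i \<omega>\<bar> \<le> 2 * q0" if "i \<in> J" for i \<omega>
    proof -
      have "P1 \<omega> * \<bar>y i \<omega>\<bar> \<le> P1 \<omega> * (1 + R s \<omega>)" using P1 y1[OF that] by (intro mult_left_mono) auto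
      then have "P1 \<omega> * \<bar>y i \<omega>\<bar> \<le> q0" using P1R[of \<omega>] by linarith
      then have "z \<omega> * (2 * (P1 \<omega> * \<bar>y i \<omega>\<bar>)) \<le> 1 * (2 * q0)"
        using z P1 by (intro mult_mono) auto
      then show ?thesis using z[of \<omega>] P1[of \<omega>] by (simp add: \<alpha>_def abs_mult)
    qed
    have vb: "\<bar>v i j \<omega>\<bar> \<le> q3" if "i \<in> J" "j \<in> J" for i j \<omega>
    proof -
      have "P2 \<omega> * \<bar>y i \<omega> * y j \<omega>\<bar> \<le> P2 \<omega> * R s \<omega>" using P2 yy[OF that] by (intro mult_left_mono) auto
      then have "P2 \<omega> * \<bar>y i \<omega> * y j \<omega>\<bar> \<le> q3" using P2R[of \<omega>] by linarith
      then have "z \<omega> * (P2 \<omega> * \<bar>y i \<omega> * y j \<omega>\<bar>) \<le> 1 * q3"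
        using z P2 by (intro mult_mono) auto
      then show ?thesis using z[of \<omega>] P2[of \<omega>] by (simp add: v_def abs_mult)
    qed
    have w: "0 \<le> w \<omega>" "w \<omega> \<le> q1" for \<omega>
    proof -
      show "0 \<le> w \<omega>" using z P1 by (simp add: w_def)
      have "z \<omega> * P1 \<omega> \<le> 1 * q1" using z P1 by (intro mult_mono) auto
      then show "w \<omega> \<le> q1" by (simp add: w_def)
    qed
    have xL: "L4 M (x i)" if "i \<in> J" for i unfolding x_def by (rule I_L4[OF that sh(1,2)])
    have wi: "integrable M (\<lambda>\<omega>. u \<omega> * x i \<omega> ^ p)"
      if "u \<in> borel_measurable (F s)" "\<And>\<omega>. \<bar>u \<omega>\<bar> \<le> B" "i \<in> J" "p \<le> 4" for u i p and B :: real
      by (rule integrable_bounded_mult[OF borel_measurable_F[OF that(1)] that(2) L4_integrable_power[OF xL[OF that(3)] that(4)]])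
    have double_int: "integrable M (\<lambda>\<omega>. u \<omega> * (x i \<omega> * x j \<omega>))"
      if "u \<in> borel_measurable (F s)" "\<And>\<omega>. \<bar>u \<omega>\<bar> \<le> B" "i \<in> J" "j \<in> J" for u i j and B :: real
      by (rule integrable_bounded_mult[OF borel_measurable_F[OF that(1)] that(2) L4_integrable_mult[OF xL[OF that(3)] xL[OF that(4)]]])
    \<comment> \<open>Off-diagonal pairs drop out because the martingale increments of different
      particles are uncorrelated given the past.\<close>
    have double: "expectation (\<lambda>\<omega>. \<Sum>i\<in>J. \<Sum>j\<in>J. u i j \<omega> * (x i \<omega> * x j \<omega>)) = (\<Sum>i\<in>J. expectation (\<lambda>\<omega>. u i i \<omega> * (x i \<omega>)\<^sup>2))"
      if u: "\<And>i j. i \<in> J \<Longrightarrow> j \<in> J \<Longrightarrow> u i j \<in> borel_measurable (F s)" "\<And>i j \<omega>. i \<in> J \<Longrightarrow> j \<in> J \<Longrightarrow> \<bar>u i j \<omega>\<bar> \<le> B"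
      for u and B :: real
    proof -
      have di: "integrable M (\<lambda>\<omega>. u i j \<omega> * (x i \<omega> * x j \<omega>))" if "i \<in> J" "j \<in> J" for i j
        by (rule double_int[OF u(1)[OF that] u(2)[OF that] that])
      have "expectation (\<lambda>\<omega>. \<Sum>i\<in>J. \<Sum>j\<in>J. u i j \<omega> * (x i \<omega> * x j \<omega>)) =
        (\<Sum>i\<in>J. \<Sum>j\<in>J. expectation (\<lambda>\<omega>. u i j \<omega> * (x i \<omega> * x j \<omega>)))"
        using di by (simp add: Bochner_Integration.integral_sum)
      also have "\<dots> = (\<Sum>i\<in>J. \<Sum>j\<in>J. if j = i then expectation (\<lambda>\<omega>. u i i \<omega> * (x i \<omega>)\<^sup>2) else 0)"
      proof (intro sum.cong refl)
        fix i j assume ij: "i \<in> J" "j \<in> J"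
        show "expectation (\<lambda>\<omega>. u i j \<omega> * (x i \<omega> * x j \<omega>)) = (if j = i then expectation (\<lambda>\<omega>. u i i \<omega> * (x i \<omega>)\<^sup>2) else 0)"
        proof (cases "j = i")
          case True
          then show ?thesis by (simp add: power2_eq_square)
        next
          case False
          then show ?thesis
            using I_uncorrelated[OF ij _ sh(1,2) u(1)[OF ij] u(2)[OF ij]] by (simp add: x_def)
        qed
      qed
      also have "\<dots> = (\<Sum>i\<in>J. expectation (\<lambda>\<omega>. u i i \<omega> * (x i \<omega>)\<^sup>2))" using J by simp
      finally show ?thesis .
    qed
    \<comment> \<open>\<open>T1\<close> and \<open>T2\<close> are the first and second order terms
      in the inner product, \<open>T3 - T4 / n\<close> the spread of the increments,
      \<open>h * T5\<close> the drift term and \<open>T6\<close> the error.\<close>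
    define T1 where "T1 \<omega> = (\<Sum>i\<in>J. \<alpha> i \<omega> * x i \<omega>)" for \<omega>
    define T2 where "T2 \<omega> = (\<Sum>i\<in>J. \<Sum>j\<in>J. v i j \<omega> * (x i \<omega> * x j \<omega>))" for \<omega>
    define T3 where "T3 \<omega> = (\<Sum>i\<in>J. w \<omega> * (x i \<omega>)\<^sup>2)" for \<omega>
    define T4 where "T4 \<omega> = (\<Sum>i\<in>J. \<Sum>j\<in>J. w \<omega> * (x i \<omega> * x j \<omega>))" for \<omega>
    define T5 where "T5 \<omega> = z \<omega> * (2 * P1 \<omega> * (sqrt (R s \<omega>) * sqrt n * G))" for \<omega>
    define T6 where "T6 \<omega> = K0 * (r * (\<Sum>i\<in>J. (x i \<omega>)\<^sup>2) + (\<Sum>i\<in>J. x i \<omega> ^ 4) / r + r ^ 3)" for \<omega>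
    have i0: "integrable M (\<lambda>\<omega>. z \<omega> * V e s \<omega>)" "integrable M (\<lambda>\<omega>. z \<omega> * V e (s + h) \<omega>)"
      using V_integrable[OF e _ AM] sh by (auto simp: z_def)
    have \<alpha>_int: "integrable M (\<lambda>\<omega>. \<alpha> i \<omega> * x i \<omega>)" if "i \<in> J" for i
      using wi[OF \<alpha>F[OF that] \<alpha>b[OF that] that, of 1] by simp
    have i1: "integrable M T1"
      unfolding T1_def by (intro Bochner_Integration.integrable_sum \<alpha>_int)
    have i2: "integrable M T2"
      unfolding T2_def by (intro Bochner_Integration.integrable_sum double_int[OF vF vb])
    have w': "\<bar>w \<omega>\<bar> \<le> q1" for \<omega> using w[of \<omega>] by simp
    have w_int: "integrable M (\<lambda>\<omega>. w \<omega> * (x i \<omega>)\<^sup>2)" if "i \<in> J" for i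
      by (rule wi[OF wF w' that]) simp
    have i3: "integrable M T3"
      unfolding T3_def by (intro Bochner_Integration.integrable_sum w_int)
    have i4: "integrable M T4"
      unfolding T4_def by (intro Bochner_Integration.integrable_sum double_int[OF wF w'])
    have i5: "integrable M T5"
    proof (rule integrable_bounded[where b="2 * q0 * (sqrt n * G)"])
      show "T5 \<in> borel_measurable M"
        unfolding T5_def by (rule borel_measurable_F[of _ s]) measurable
      fix \<omega>
      have "sqrt (R s \<omega>) \<le> 1 + R s \<omega>"
        using sum_squares_bound[of 1 "sqrt (R s \<omega>)"] R_nonneg[of s \<omega>] by simp
      then have "P1 \<omega> * sqrt (R s \<omega>) \<le> P1 \<omega> * (1 + R s \<omega>)" using P1 by (intro mult_left_mono) auto
      then have "P1 \<omega> * sqrt (R s \<omega>) \<le> q0" using P1R[of \<omega>] by linarith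
      then have "z \<omega> * (2 * (P1 \<omega> * sqrt (R s \<omega>)) * (sqrt n * G)) \<le> 1 * (2 * q0 * (sqrt n * G))"
        using z P1 G n R_nonneg[of s \<omega>] q0 by (intro mult_mono) auto
      then show "\<bar>T5 \<omega>\<bar> \<le> 2 * q0 * (sqrt n * G)"
        using z[of \<omega>] P1[of \<omega>] R_nonneg[of s \<omega>] G n by (simp add: T5_def abs_mult mult_ac)
    qed
    have x2i: "integrable M (\<lambda>\<omega>. (x i \<omega>)\<^sup>2)" "integrable M (\<lambda>\<omega>. x i \<omega> ^ 4)" if "i \<in> J" for i
      using L4_integrable_power[OF xL[OF that]] by auto
    have i6: "integrable M T6"
      unfolding T6_def
      by (intro integrable_mult_right Bochner_Integration.integrable_add Bochner_Integration.integrable_sum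
        integrable_divide_zero integrable_const) (use x2i in auto)
    have "AE \<omega> in M. \<forall>i\<in>J. \<bar>X i (s + h) \<omega> - X i s \<omega> - x i \<omega>\<bar> \<le> G * r\<^sup>2"
      using drift[OF _ sh(1,2)] J(1) by (intro AE_finite_allI) (auto simp: x_def r)
    then have ae: "AE \<omega> in M. z \<omega> * V e (s + h) \<omega> \<le>
      z \<omega> * V e s \<omega> - T1 \<omega> + T2 \<omega> - T3 \<omega> + T4 \<omega> / n + h * T5 \<omega> + T6 \<omega>"
    proof eventually_elim
      case (elim \<omega>)
      have A6: "0 \<le> T6 \<omega>" unfolding T6_def using K0 r by (intro mult_nonneg_nonneg add_nonneg_nonneg divide_nonneg_nonneg sum_nonneg) auto
      show ?case
      proof (cases "\<omega> \<in> A")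
        case False
        then have "z \<omega> = 0" by (simp add: z_def)
        then show ?thesis using A6 by (simp add: T1_def T2_def T3_def T4_def T5_def \<alpha>_def v_def w_def)
      next
        case True
        then have z1: "z \<omega> = 1" by (simp add: z_def)
        have "V e (s + h) \<omega> = (spread J (\<lambda>i. X i s \<omega> + (x i \<omega> + (X i (s + h) \<omega> - X i s \<omega> - x i \<omega>))) + e) powr (-d)"
          by (simp add: V_def R_def)
        also have "\<dots> \<le> V e s \<omega> - 2 * P1 \<omega> * (\<Sum>i\<in>J. y i \<omega> * x i \<omega>) + P2 \<omega> * (\<Sum>i\<in>J. y i \<omega> * x i \<omega>)\<^sup>2
            - P1 \<omega> * spread J (\<lambda>i. x i \<omega>) + 2 * P1 \<omega> * (sqrt (R s \<omega>) * sqrt n * G * h) + T6 \<omega>"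
          using step[OF r(1,2), of "\<lambda>i. X i (s + h) \<omega> - X i s \<omega> - x i \<omega>" "\<lambda>i. X i s \<omega>" "\<lambda>i. x i \<omega>"] elim
          by (simp add: V_def R_def[symmetric] P1_def P2_def y_def n_def T6_def r(3) mult.assoc)
        also have "2 * P1 \<omega> * (\<Sum>i\<in>J. y i \<omega> * x i \<omega>) = T1 \<omega>"
          by (simp add: T1_def \<alpha>_def z1 sum_distrib_left mult.assoc)
        also have "P2 \<omega> * (\<Sum>i\<in>J. y i \<omega> * x i \<omega>)\<^sup>2 = T2 \<omega>"
          by (simp add: T2_def v_def z1 power2_eq_square sum_product sum_distrib_left mult_ac)
        also have "P1 \<omega> * spread J (\<lambda>i. x i \<omega>) = T3 \<omega> - T4 \<omega> / n"
        proof -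
          have "T3 \<omega> = P1 \<omega> * (\<Sum>i\<in>J. (x i \<omega>)\<^sup>2)" by (simp add: T3_def w_def z1 sum_distrib_left)
          moreover have "T4 \<omega> = P1 \<omega> * (\<Sum>i\<in>J. x i \<omega>)\<^sup>2"
            by (simp only: T4_def w_def z1 mult_1 power2_eq_square sum_product) (simp only: sum_distrib_left)
          ultimately show ?thesis by (simp add: spread_eq[OF J] n_def right_diff_distrib)
        qed
        also have "2 * P1 \<omega> * (sqrt (R s \<omega>) * sqrt n * G * h) = h * T5 \<omega>" by (simp add: T5_def z1)
        finally show ?thesis by (simp add: z1)
      qed
    qed
    have "expectation (\<lambda>\<omega>. z \<omega> * V e (s + h) \<omega>) \<le>
      expectation (\<lambda>\<omega>. z \<omega> * V e s \<omega> - T1 \<omega> + T2 \<omega> - T3 \<omega> + T4 \<omega> / n + h * T5 \<omega> + T6 \<omega>)"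
      by (rule integral_mono_AE[OF _ _ ae]) (use i0 i1 i2 i3 i4 i5 i6 in auto)
    also have "\<dots> = expectation (\<lambda>\<omega>. z \<omega> * V e s \<omega>) - expectation T1 + expectation T2 - expectation T3
        + expectation T4 / n + h * expectation T5 + expectation T6"
      using i0 i1 i2 i3 i4 i5 i6 by simp
    finally have total: "expectation (\<lambda>\<omega>. z \<omega> * V e (s + h) \<omega>) \<le> expectation (\<lambda>\<omega>. z \<omega> * V e s \<omega>) - expectation T1
      + expectation T2 - expectation T3 + expectation T4 / n + h * expectation T5 + expectation T6" .
    have E1: "expectation T1 = 0"
    proof -
      have "expectation (\<lambda>\<omega>. \<alpha> i \<omega> * x i \<omega>) = 0" if "i \<in> J" for i
        unfolding x_def by (rule I_centered[OF that sh(1,2) \<alpha>F[OF that] \<alpha>b[OF that]])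
      then show ?thesis
        unfolding T1_def using \<alpha>_int by (subst Bochner_Integration.integral_sum) auto
    qed
    have zP2i: "integrable M (\<lambda>\<omega>. z \<omega> * (P2 \<omega> * R s \<omega>))"
    proof (rule integrable_bounded[where b=q3])
      show "(\<lambda>\<omega>. z \<omega> * (P2 \<omega> * R s \<omega>)) \<in> borel_measurable M" by (rule borel_measurable_F[of _ s]) measurable
      show "\<bar>z \<omega> * (P2 \<omega> * R s \<omega>)\<bar> \<le> q3" for \<omega>
        using mult_mono[of "z \<omega>" 1 "P2 \<omega> * R s \<omega>" q3] z[of \<omega>] P2[of \<omega>] P2R[of \<omega>] R_nonneg[of s \<omega>] by (simp add: abs_mult)
    qed
    have E2: "expectation T2 \<le> b\<^sup>2 * h * expectation (\<lambda>\<omega>. z \<omega> * (P2 \<omega> * R s \<omega>))"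
    proof -
      have vi: "integrable M (v i i)" if "i \<in> J" for i
        by (rule integrable_bounded[OF borel_measurable_F[OF vF[OF that that]] vb[OF that that]])
      have "expectation T2 = (\<Sum>i\<in>J. expectation (\<lambda>\<omega>. v i i \<omega> * (x i \<omega>)\<^sup>2))"
        unfolding T2_def by (rule double[OF vF vb])
      also have "\<dots> \<le> (\<Sum>i\<in>J. b\<^sup>2 * (s + h - s) * expectation (v i i))"
      proof (rule sum_mono)
        fix i assume i: "i \<in> J"
        show "expectation (\<lambda>\<omega>. v i i \<omega> * (x i \<omega>)\<^sup>2) \<le> b\<^sup>2 * (s + h - s) * expectation (v i i)"
          unfolding x_def
        proof (rule I_upper[OF i sh(1,2) vF[OF i i], where B=q3])
          show "0 \<le> v i i \<omega>" for \<omega> using z P2 by (simp add: v_def)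
          show "v i i \<omega> \<le> q3" for \<omega> using vb[OF i i, of \<omega>] by simp
        qed
      qed
      also have "\<dots> = b\<^sup>2 * h * expectation (\<lambda>\<omega>. \<Sum>i\<in>J. v i i \<omega>)"
        using vi by (simp add: sum_distrib_left)
      also have "(\<lambda>\<omega>. \<Sum>i\<in>J. v i i \<omega>) = (\<lambda>\<omega>. z \<omega> * (P2 \<omega> * R s \<omega>))"
        by (simp add: v_def R_def spread_def y_def power2_eq_square sum_distrib_left)
      finally show ?thesis .
    qed
    have wint: "integrable M w" by (rule integrable_bounded[OF borel_measurable_F[OF wF] w'])
    \<comment> \<open>The double sum has the same expectation as its diagonal. Hence
      \<open>T3 - T4 / n\<close> has the expectation of \<open>T3\<close> times (n - 1) / n, which
      produces the factor n - 1 of the gap condition.\<close>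
    have E4: "expectation T4 = expectation T3"
    proof -
      have "expectation T4 = (\<Sum>i\<in>J. expectation (\<lambda>\<omega>. w \<omega> * (x i \<omega>)\<^sup>2))"
        unfolding T4_def by (rule double[of "\<lambda>i j. w", OF wF w'])
      also have "\<dots> = expectation T3"
        unfolding T3_def using w_int by (subst Bochner_Integration.integral_sum) auto
      finally show ?thesis .
    qed
    have E3: "n * (a\<^sup>2 * h * expectation w) \<le> expectation T3"
    proof -
      have "n * (a\<^sup>2 * h * expectation w) = (\<Sum>i\<in>J. a\<^sup>2 * (s + h - s) * expectation w)" by (simp add: n_def)
      also have "\<dots> \<le> (\<Sum>i\<in>J. expectation (\<lambda>\<omega>. w \<omega> * (x i \<omega>)\<^sup>2))"
        unfolding x_def by (intro sum_mono I_lower[OF _ sh(1,2) wF w])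
      also have "\<dots> = expectation T3"
        unfolding T3_def using w_int by (subst Bochner_Integration.integral_sum) auto
      finally show ?thesis .
    qed
    have E34: "- expectation T3 + expectation T4 / n \<le> - ((n - 1) * a\<^sup>2 * h * expectation w)"
    proof -
      have "- expectation T3 + expectation T4 / n = - ((n - 1) / n * expectation T3)"
        using n by (simp add: E4 field_simps)
      moreover have "(n - 1) / n * (n * (a\<^sup>2 * h * expectation w)) \<le> (n - 1) / n * expectation T3"
        using n by (intro mult_left_mono E3) auto
      moreover have "(n - 1) / n * (n * (a\<^sup>2 * h * expectation w)) = (n - 1) * a\<^sup>2 * h * expectation w"
        using n by simp
      ultimately show ?thesis by linarith
    qed
    have E6: "expectation T6 \<le> C * (h * sqrt h)"
    proof -
      have x2: "expectation (\<lambda>\<omega>. (x i \<omega>)\<^sup>2) \<le> b\<^sup>2 * h" if "i \<in> J" for i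
        using I_upper[OF that sh(1,2), of "\<lambda>_. 1" 1] by (simp add: x_def prob_space)
      have x4: "expectation (\<lambda>\<omega>. x i \<omega> ^ 4) \<le> 3 * b ^ 4 * h\<^sup>2" if "i \<in> J" for i
        using I_fourth[OF that sh(1,2)] by (simp add: x_def)
      have "expectation T6 = K0 * (r * (\<Sum>i\<in>J. expectation (\<lambda>\<omega>. (x i \<omega>)\<^sup>2)) + (\<Sum>i\<in>J. expectation (\<lambda>\<omega>. x i \<omega> ^ 4)) / r + r ^ 3)"
        unfolding T6_def using x2i by (simp add: prob_space)
      also have "\<dots> \<le> K0 * (r * (\<Sum>i\<in>J. b\<^sup>2 * h) + (\<Sum>i\<in>J. 3 * b ^ 4 * h\<^sup>2) / r + r ^ 3)"
        using K0 r x2 x4 by (intro mult_left_mono add_mono divide_right_mono sum_mono) auto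
      also have "\<dots> = K0 * (n * b\<^sup>2 * (r * h) + 3 * (n * b ^ 4) * (h\<^sup>2 / r) + r ^ 3)"
        by (simp add: n_def)
      also have "r * h = h * sqrt h" by (simp add: r_def)
      also have "h\<^sup>2 / r = h * sqrt h"
        using h by (simp add: r_def power2_eq_square field_simps)
      finally show ?thesis unfolding C_def r(4) by (simp add: algebra_simps)
    qed
    have E0: "h * (b\<^sup>2 * expectation (\<lambda>\<omega>. z \<omega> * (P2 \<omega> * R s \<omega>)) - (n - 1) * a\<^sup>2 * expectation w + expectation T5) \<le>
      h * (K * expectation (\<lambda>\<omega>. z \<omega> * V e s \<omega>) - d * c * e powr (-d - 1) * prob {\<omega>\<in>A. R s \<omega> = 0})"
    proof (rule mult_left_mono)
      define N where "N = {\<omega>\<in>A. R s \<omega> = 0}"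
      have "N = A \<inter> {\<omega>\<in>space (F s). R s \<omega> = 0}"
        using sets.sets_into_space[OF A] by (auto simp: N_def)
      moreover have "{\<omega>\<in>space (F s). R s \<omega> = 0} \<in> sets (F s)" by measurable
      ultimately have "N \<in> sets (F s)" using A by auto
      then have NM: "N \<in> events" using sets_F_subset by auto
      have Ni: "integrable M (indicat_real N)"
        by (rule integrable_bounded[where b=1]) (use NM in \<open>auto simp: indicator_def\<close>)
      have "b\<^sup>2 * expectation (\<lambda>\<omega>. z \<omega> * (P2 \<omega> * R s \<omega>)) - (n - 1) * a\<^sup>2 * expectation w + expectation T5 =
        expectation (\<lambda>\<omega>. b\<^sup>2 * (z \<omega> * (P2 \<omega> * R s \<omega>)) - (n - 1) * a\<^sup>2 * w \<omega> + T5 \<omega>)"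
        using zP2i wint i5 by simp
      also have "\<dots> \<le> expectation (\<lambda>\<omega>. K * (z \<omega> * V e s \<omega>) - d * c * e powr (-d - 1) * indicator N \<omega>)"
      proof (rule integral_mono)
        fix \<omega>
        show "b\<^sup>2 * (z \<omega> * (P2 \<omega> * R s \<omega>)) - (n - 1) * a\<^sup>2 * w \<omega> + T5 \<omega> \<le>
          K * (z \<omega> * V e s \<omega>) - d * c * e powr (-d - 1) * indicator N \<omega>"
        proof (cases "\<omega> \<in> A")
          case True
          then have "indicat_real N \<omega> = of_bool (R s \<omega> = 0)" "z \<omega> = 1" by (auto simp: N_def z_def indicator_def)
          then show ?thesis
            using drift_bound[OF R_nonneg e, of s \<omega>]
            by (simp only: w_def T5_def P1_def P2_def V_def n_def mult_1)
        qed (simp add: z_def w_def T5_def N_def)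
      qed (use zP2i wint i5 i0 Ni in auto)
      also have "\<dots> = K * expectation (\<lambda>\<omega>. z \<omega> * V e s \<omega>) - d * c * e powr (-d - 1) * prob N"
        using i0 Ni NM by simp
      finally show "b\<^sup>2 * expectation (\<lambda>\<omega>. z \<omega> * (P2 \<omega> * R s \<omega>)) - (n - 1) * a\<^sup>2 * expectation w + expectation T5 \<le>
        K * expectation (\<lambda>\<omega>. z \<omega> * V e s \<omega>) - d * c * e powr (-d - 1) * prob {\<omega>\<in>A. R s \<omega> = 0}"
        by (simp add: N_def)
    qed (use h in simp)
    have eq: "h * (u - v + w') = u * h - v * h + h * w'" for u v w' :: real by (simp add: algebra_simps)
    have "expectation (\<lambda>\<omega>. z \<omega> * V e (s + h) \<omega>) \<le> expectation (\<lambda>\<omega>. z \<omega> * V e s \<omega>)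
      + h * (b\<^sup>2 * expectation (\<lambda>\<omega>. z \<omega> * (P2 \<omega> * R s \<omega>)) - (n - 1) * a\<^sup>2 * expectation w + expectation T5)
      + C * (h * sqrt h)"
      using total E1 E2 E34 E6 unfolding eq by (simp add: mult_ac)
    also note E0
    finally show ?thesis by (simp add: z_def algebra_simps)
  qed
  ultimately show thesis by (rule that)
qed

end

section \<open>From one step to time intervals\<close>

text \<open>Gronwall's inequality that also accumulates the killed amounts p; carrying them along
  costs nothing since the growth factor is at least 1.\<close>

lemma discrete_gronwall:
  fixes u p :: "nat \<Rightarrow> real"
  assumes step: "\<And>k. k < N \<Longrightarrow> u (Suc k) + \<kappa> * p k \<le> (1 + q) * u k + \<epsilon>"
    and q: "0 \<le> q" and \<epsilon>: "0 \<le> \<epsilon>" and \<kappa>: "0 \<le> \<kappa>" and p: "\<And>k. 0 \<le> p k"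
  shows "u N + \<kappa> * (\<Sum>k<N. p k) \<le> (1 + q) ^ N * (u 0 + N * \<epsilon>)"
proof -
  have "k \<le> N \<Longrightarrow> u k + \<kappa> * (\<Sum>j<k. p j) \<le> (1 + q) ^ k * (u 0 + k * \<epsilon>)" for k
  proof (induction k)
    case 0
    then show ?case by simp
  next
    case (Suc k)
    define S where "S = \<kappa> * (\<Sum>j<k. p j)"
    have S: "0 \<le> S" using \<kappa> p by (simp add: S_def sum_nonneg)
    have "u (Suc k) + \<kappa> * (\<Sum>j<Suc k. p j) = (u (Suc k) + \<kappa> * p k) + S" by (simp add: S_def algebra_simps)
    also have "\<dots> \<le> (1 + q) * u k + \<epsilon> + S" using step[of k] Suc.prems by simp
    also have "\<dots> \<le> (1 + q) * (u k + S) + \<epsilon>" using q S by (simp add: algebra_simps)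
    also have "\<dots> \<le> (1 + q) * ((1 + q) ^ k * (u 0 + k * \<epsilon>)) + (1 + q) ^ Suc k * \<epsilon>"
    proof (intro add_mono mult_left_mono)
      have "1 \<le> (1 + q) ^ Suc k" using q by (intro one_le_power) simp
      from mult_right_mono[OF this \<epsilon>] show "\<epsilon> \<le> (1 + q) ^ Suc k * \<epsilon>" by simp
    qed (use Suc q in \<open>auto simp: S_def\<close>)
    also have "\<dots> = (1 + q) ^ Suc k * (u 0 + Suc k * \<epsilon>)" by (simp add: algebra_simps)
    finally show ?case .
  qed
  then show ?thesis by simp
qed

text \<open>Completeness of M. It allows events that quantify over uncountably many times to be
  covered by null sets without a separate proof of measurability.\<close>

lemma (in usual_filtration) null_sets_subset: "N \<in> null_sets M \<Longrightarrow> S \<subseteq> N \<Longrightarrow> S \<in> null_sets M"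
  using null_subset_in_F sets_F_subset by (blast intro: null_sets_subset)

context particle_cluster
begin

text \<open>N equal steps of length h, with total error C (t - s) sqrt h, which disappears as N
  grows. The number p is a common lower bound for the killing probabilities: p = 0 gives the
  supermartingale property, p = P(R t = 0) the estimate behind \<open>prob_zero\<close>.\<close>

lemma multi_step:
  assumes e: "0 < e" and st: "0 \<le> s" "s < t" and A: "A \<in> sets (F s)"
    and p: "0 \<le> p" "\<And>u. s \<le> u \<Longrightarrow> u < t \<Longrightarrow> p \<le> prob {\<omega>\<in>A. R u \<omega> = 0}"
  shows "expectation (\<lambda>\<omega>. indicator A \<omega> * V e t \<omega>) + d * c * e powr (-d - 1) * (t - s) * p \<le>
    exp (K * (t - s)) * expectation (\<lambda>\<omega>. indicator A \<omega> * V e s \<omega>)"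
proof -
  define \<kappa> where "\<kappa> = d * c * e powr (-d - 1)"
  have \<kappa>: "0 \<le> \<kappa>" using d c_pos by (simp add: \<kappa>_def)
  obtain C where C: "0 \<le> C" and step: "\<And>s h A. 0 \<le> s \<Longrightarrow> 0 < h \<Longrightarrow> h \<le> 1 \<Longrightarrow> A \<in> sets (F s) \<Longrightarrow>
    expectation (\<lambda>\<omega>. indicator A \<omega> * V e (s + h) \<omega>) + \<kappa> * h * prob {\<omega>\<in>A. R s \<omega> = 0} \<le>
    (1 + K * h) * expectation (\<lambda>\<omega>. indicator A \<omega> * V e s \<omega>) + C * (h * sqrt h)"
    unfolding \<kappa>_def using one_step[OF e] by blast
  define U where "U u = expectation (\<lambda>\<omega>. indicator A \<omega> * V e u \<omega>)" for u
  have U_nn: "0 \<le> U u" for u unfolding U_def using V_bounds[OF e] by (simp add: integral_nonneg_AE)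
  have bound: "U t + \<kappa> * (t - s) * p \<le> exp (K * (t - s)) * (U s + C * (t - s) * sqrt ((t - s) / N))"
    if N: "0 < N" "t - s \<le> real N" for N :: nat
  proof -
    define h where "h = (t - s) / N"
    have h: "0 < h" "h \<le> 1" "N * h = t - s" using st N by (auto simp: h_def field_simps)
    have sk: "s \<le> s + k * h" "0 \<le> s + k * h" for k :: nat using h st by auto
    have "U (s + real N * h) + (\<kappa> * h) * (\<Sum>k<N. prob {\<omega>\<in>A. R (s + real k * h) \<omega> = 0}) \<le>
      (1 + K * h) ^ N * (U (s + real 0 * h) + N * (C * (h * sqrt h)))"
    proof (rule discrete_gronwall[where u="\<lambda>k. U (s + real k * h)" and p="\<lambda>k. prob {\<omega>\<in>A. R (s + real k * h) \<omega> = 0}"])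
      fix k assume "k < N"
      have "A \<in> sets (F (s + k * h))" using A sets_F_mono[OF sk(1)] by auto
      from step[OF sk(2) h(1,2) this]
      show "U (s + real (Suc k) * h) + (\<kappa> * h) * prob {\<omega>\<in>A. R (s + real k * h) \<omega> = 0} \<le>
        (1 + K * h) * U (s + real k * h) + C * (h * sqrt h)"
        by (simp add: U_def algebra_simps)
    qed (use K_nonneg h C \<kappa> in auto)
    moreover have "N * p \<le> (\<Sum>k<N. prob {\<omega>\<in>A. R (s + real k * h) \<omega> = 0})"
    proof -
      have "(\<Sum>k<N. p) \<le> (\<Sum>k<N. prob {\<omega>\<in>A. R (s + real k * h) \<omega> = 0})"
      proof (intro sum_mono p(2) sk)
        fix k assume "k \<in> {..<N}"
        then have "real k * h < N * h" using h by (intro mult_strict_right_mono) auto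
        then show "s + real k * h < t" using h by simp
      qed
      then show ?thesis by simp
    qed
    then have "\<kappa> * h * (N * p) \<le> \<kappa> * h * (\<Sum>k<N. prob {\<omega>\<in>A. R (s + real k * h) \<omega> = 0})"
      using \<kappa> h by (intro mult_left_mono) auto
    moreover have "\<kappa> * h * (N * p) = \<kappa> * (t - s) * p" using h(3)[symmetric] by (simp add: mult_ac)
    moreover have "U (s + N * h) = U t" using h(3) by simp
    ultimately have "U t + \<kappa> * (t - s) * p \<le> (1 + K * h) ^ N * (U s + N * (C * (h * sqrt h)))" by simp
    also have "N * (C * (h * sqrt h)) = C * (t - s) * sqrt h" using h(3)[symmetric] by (simp add: mult_ac)
    also have "(1 + K * h) ^ N * (U s + C * (t - s) * sqrt h) \<le> exp (K * (t - s)) * (U s + C * (t - s) * sqrt h)"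
    proof (rule mult_right_mono)
      have "(1 + K * h) ^ N \<le> exp (K * h) ^ N"
        using exp_ge_add_one_self[of "K * h"] K_nonneg h by (intro power_mono) auto
      also have "\<dots> = exp (K * (t - s))" using h(3)[symmetric] by (simp add: exp_of_nat_mult[symmetric] mult_ac)
      finally show "(1 + K * h) ^ N \<le> exp (K * (t - s))" .
    qed (use U_nn C st h in auto)
    finally show ?thesis by (simp add: h_def)
  qed
  have "(\<lambda>N. exp (K * (t - s)) * (U s + C * (t - s) * sqrt ((t - s) / real N))) \<longlonglongrightarrow>
    exp (K * (t - s)) * (U s + C * (t - s) * sqrt 0)"
    by (intro tendsto_intros lim_const_over_n)
  then have "U t + \<kappa> * (t - s) * p \<le> exp (K * (t - s)) * (U s + C * (t - s) * sqrt 0)"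
  proof (rule LIMSEQ_le_const)
    obtain N0 :: nat where N0: "t - s \<le> real N0" using real_arch_simple by blast
    show "\<exists>N0. \<forall>N\<ge>N0. U t + \<kappa> * (t - s) * p \<le> exp (K * (t - s)) * (U s + C * (t - s) * sqrt ((t - s) / real N))"
      by (intro exI[of _ "max 1 N0"] allI impI bound) (use N0 in auto)
  qed
  then show ?thesis by (simp add: U_def \<kappa>_def)
qed

lemma V_supermartingale:
  assumes e: "0 < e" and st: "0 \<le> s" "s \<le> t" and A: "A \<in> sets (F s)"
  shows "expectation (\<lambda>\<omega>. indicator A \<omega> * V e t \<omega>) \<le> exp (K * (t - s)) * expectation (\<lambda>\<omega>. indicator A \<omega> * V e s \<omega>)"
  using multi_step[OF e st(1) _ A, of t 0] st by (cases "s = t") auto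

text \<open>Doob's maximal inequality on an equidistant grid for the supermartingale exp (-K t) V.
  \<open>Q k\<close> collects the paths that have stayed below the level l through step k.\<close>

lemma V_maximal:
  fixes N :: nat and h :: real
  assumes e: "0 < e" and s: "0 \<le> s" "0 \<le> h" and A: "A \<in> sets (F s)" and l: "0 \<le> l"
  shows "l * prob {\<omega>\<in>A. \<exists>k\<le>N. l \<le> V e (s + real k * h) \<omega>} \<le>
    exp (K * (N * h)) * expectation (\<lambda>\<omega>. indicator A \<omega> * V e s \<omega>)"
proof -
  define Q where "Q k = {\<omega>\<in>A. \<forall>j\<le>k. V e (s + real j * h) \<omega> < l}" for k :: nat
  define W where "W k = V e (s + real k * h)" for k :: nat
  have sk: "0 \<le> s + real k * h" for k using s by simp
  have QF: "Q k \<in> sets (F (s + real k * h))" for k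
  proof -
    have "{\<omega>\<in>space (F (s + real k * h)). V e (s + real j * h) \<omega> < l} \<in> sets (F (s + real k * h))" if "j \<le> k" for j
    proof -
      have "s + real j * h \<le> s + real k * h" using that s by (simp add: mult_right_mono)
      from borel_measurable_F_mono[OF V_measurable[OF sk] this, of e] show ?thesis by measurable
    qed
    then have "(\<Inter>j\<in>{..k}. {\<omega>\<in>space (F (s + real k * h)). V e (s + real j * h) \<omega> < l}) \<in> sets (F (s + real k * h))"
      by (intro sets.finite_INT) auto
    moreover have "A \<in> sets (F (s + real k * h))" using A sets_F_mono[of s "s + real k * h"] s by auto
    ultimately have "A \<inter> (\<Inter>j\<in>{..k}. {\<omega>\<in>space (F (s + real k * h)). V e (s + real j * h) \<omega> < l}) \<in> sets (F (s + real k * h))"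
      by (rule sets.Int[rotated])
    also have "A \<inter> (\<Inter>j\<in>{..k}. {\<omega>\<in>space (F (s + real k * h)). V e (s + real j * h) \<omega> < l}) = Q k"
      using sets.sets_into_space[OF A] by (auto simp: Q_def)
    finally show ?thesis .
  qed
  have QM: "Q k \<in> events" "A \<in> events" for k using QF[of k] A sets_F_subset by auto
  have int: "integrable M (\<lambda>\<omega>. indicator B \<omega> * W k \<omega>)" if "B \<in> events" for B k
    unfolding W_def by (rule V_integrable[OF e sk that])
  have indi: "integrable M (\<lambda>\<omega>. l * indicat_real B \<omega>)" if "B \<in> events" for B
    by (intro integrable_mult_right integrable_bounded[where b=1]) (use that in \<open>auto simp: indicator_def\<close>)
  have split: "expectation (\<lambda>\<omega>. indicator B \<omega> * W k \<omega>) + l * prob B' =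
    expectation (\<lambda>\<omega>. indicator B \<omega> * W k \<omega> + l * indicator B' \<omega>)" if "B \<in> events" "B' \<in> events" for B B' k
    using int[OF that(1)] indi[OF that(2)] that by simp
  have W_nn: "0 \<le> W k \<omega>" for k \<omega> using V_bounds[OF e] by (simp add: W_def)
  \<comment> \<open>The invariant: the integral of V over the paths still below l, plus l times the
    probability of the others, grows at most by the factor exp (K h) per step. A path that first
    reaches l gives up a value of at least l in exchange for l.\<close>
  have claim: "expectation (\<lambda>\<omega>. indicator (Q k) \<omega> * W k \<omega>) + l * prob (A - Q k) \<le>
    exp (K * (k * h)) * expectation (\<lambda>\<omega>. indicator A \<omega> * V e s \<omega>)" for k
  proof (induction k)
    case 0
    have "expectation (\<lambda>\<omega>. indicator (Q 0) \<omega> * W 0 \<omega> + l * indicator (A - Q 0) \<omega>) \<le>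
      expectation (\<lambda>\<omega>. indicator A \<omega> * W 0 \<omega>)"
      by (intro integral_mono Bochner_Integration.integrable_add int indi sets.Diff QM)
         (use l in \<open>auto simp: Q_def W_def indicator_def not_less\<close>)
    then show ?case using split[OF QM(1)[of 0] sets.Diff[OF QM(2) QM(1)[of 0]], of 0] by (simp add: W_def)
  next
    case (Suc k)
    have step: "expectation (\<lambda>\<omega>. indicator (Q k) \<omega> * W (Suc k) \<omega>) \<le> exp (K * h) * expectation (\<lambda>\<omega>. indicator (Q k) \<omega> * W k \<omega>)"
      using V_supermartingale[OF e sk[of k] _ QF[of k], of "s + real (Suc k) * h"] s
      by (simp add: W_def algebra_simps)
    have "expectation (\<lambda>\<omega>. indicator (Q (Suc k)) \<omega> * W (Suc k) \<omega> + l * indicator (A - Q (Suc k)) \<omega>) \<le>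
      expectation (\<lambda>\<omega>. indicator (Q k) \<omega> * W (Suc k) \<omega> + l * indicator (A - Q k) \<omega>)"
    proof (intro integral_mono Bochner_Integration.integrable_add int indi sets.Diff QM)
      fix \<omega>
      consider "\<omega> \<notin> A" | "\<omega> \<in> A" "\<omega> \<notin> Q k" "\<omega> \<notin> Q (Suc k)" | "\<omega> \<in> Q k" "\<omega> \<in> Q (Suc k)"
        | "\<omega> \<in> A" "\<omega> \<in> Q k" "\<omega> \<notin> Q (Suc k)" "l \<le> W (Suc k) \<omega>"
        by (fastforce simp: Q_def W_def le_Suc_eq not_less simp del: of_nat_Suc)
      then show "indicator (Q (Suc k)) \<omega> * W (Suc k) \<omega> + l * indicator (A - Q (Suc k)) \<omega> \<le>
        indicator (Q k) \<omega> * W (Suc k) \<omega> + l * indicator (A - Q k) \<omega>"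
      proof cases
        case 1
        then have "\<omega> \<notin> Q k" "\<omega> \<notin> Q (Suc k)" by (auto simp: Q_def)
        with 1 show ?thesis by simp
      qed simp_all
    qed
    then have "expectation (\<lambda>\<omega>. indicator (Q (Suc k)) \<omega> * W (Suc k) \<omega>) + l * prob (A - Q (Suc k)) \<le>
      expectation (\<lambda>\<omega>. indicator (Q k) \<omega> * W (Suc k) \<omega>) + l * prob (A - Q k)"
      unfolding split[OF QM(1) sets.Diff[OF QM(2) QM(1)]] .
    also have "\<dots> \<le> exp (K * h) * expectation (\<lambda>\<omega>. indicator (Q k) \<omega> * W k \<omega>) + exp (K * h) * (l * prob (A - Q k))"
    proof (intro add_mono step)
      have "1 \<le> exp (K * h)" using K_nonneg s by simp
      from mult_right_mono[OF this, of "l * prob (A - Q k)"] l show "l * prob (A - Q k) \<le> exp (K * h) * (l * prob (A - Q k))" by simp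
    qed
    also have "\<dots> = exp (K * h) * (expectation (\<lambda>\<omega>. indicator (Q k) \<omega> * W k \<omega>) + l * prob (A - Q k))"
      by (simp add: distrib_left)
    also have "\<dots> \<le> exp (K * h) * (exp (K * (k * h)) * expectation (\<lambda>\<omega>. indicator A \<omega> * V e s \<omega>))"
      by (intro mult_left_mono Suc.IH) simp
    also have "\<dots> = exp (K * (Suc k * h)) * expectation (\<lambda>\<omega>. indicator A \<omega> * V e s \<omega>)"
      by (simp add: algebra_simps exp_add)
    finally show ?case .
  qed
  have "{\<omega>\<in>A. \<exists>k\<le>N. l \<le> V e (s + real k * h) \<omega>} = A - Q N" by (auto simp: Q_def not_less)
  moreover have "0 \<le> expectation (\<lambda>\<omega>. indicator (Q N) \<omega> * W N \<omega>)" using W_nn by (simp add: integral_nonneg_AE)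
  ultimately show ?thesis using claim[of N] by simp
qed

section \<open>Collisions in continuous time\<close>

lemma V_continuous:
  assumes "\<omega> \<in> space M" "0 < e"
  shows "continuous_on {0..} (\<lambda>t. V e t \<omega>)"
proof -
  have "continuous_on {0..} (\<lambda>t. X i t \<omega>)" if "i \<in> J" for i
    using X_cont[OF that] assms by (simp add: continuous_paths_def)
  then have "continuous_on {0..} (\<lambda>t. R t \<omega>)"
    unfolding R_def spread_def mean_def using J by (intro continuous_intros) auto
  moreover have "R t \<omega> + e \<noteq> 0" for t using R_nonneg[of t \<omega>] assms by linarith
  ultimately show ?thesis unfolding V_def by (intro continuous_intros) auto
qed

text \<open>At a collision V attains its maximum \<open>e powr (-d)\<close>. By continuity it
  exceeds half of that nearby, and a sufficiently fine dyadic grid has a point there, namely the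
  last one not after t.\<close>

lemma collision_on_dyadic_grid:
  assumes \<omega>: "\<omega> \<in> space M" and e: "0 < e" and t: "0 \<le> s" "s < T" "s \<le> t" "t \<le> T" and R0: "R t \<omega> = 0"
  shows "\<exists>N. \<exists>k\<le>2 ^ N. e powr (-d) / 2 \<le> V e (s + real k * ((T - s) / 2 ^ N)) \<omega>"
proof -
  define l where "l = e powr (-d) / 2"
  have l: "0 < l" "V e t \<omega> = 2 * l" using e by (auto simp: l_def V_def R0)
  obtain \<delta> where \<delta>: "0 < \<delta>" "\<And>u. 0 \<le> u \<Longrightarrow> dist u t < \<delta> \<Longrightarrow> dist (V e u \<omega>) (V e t \<omega>) < l"
    using V_continuous[OF \<omega> e] t l(1) unfolding continuous_on_iff
    by (metis atLeast_iff order.trans)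
  obtain N where N: "(1 / 2) ^ N < \<delta> / (T - s)"
    using real_arch_pow_inv[of "\<delta> / (T - s)" "1 / 2"] \<delta>(1) t by auto
  define h where "h = (T - s) / 2 ^ N"
  have h: "0 < h" "h < \<delta>" "2 ^ N * h = T - s" using N t by (auto simp: h_def field_simps power_divide)
  define k where "k = nat \<lfloor>(t - s) / h\<rfloor>"
  have k0: "0 \<le> (t - s) / h" using t h by simp
  have k1: "real k \<le> (t - s) / h" "(t - s) / h < real k + 1" using k0 by (auto simp: k_def)
  have kh: "real k * h \<le> t - s" "t - s < real k * h + h" using k1 h by (auto simp: field_simps)
  have "real k * h \<le> 2 ^ N * h" using kh h t by linarith
  then have "real k \<le> 2 ^ N" by (rule mult_right_le_imp_le[OF _ h(1)])
  then have "k \<le> 2 ^ N" by (metis of_nat_le_iff of_nat_numeral of_nat_power)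
  moreover have "dist (V e (s + real k * h) \<omega>) (V e t \<omega>) < l"
    by (rule \<delta>(2)) (use kh h t in \<open>auto simp: dist_real_def\<close>)
  then have "l \<le> V e (s + real k * h) \<omega>" using l by (auto simp: dist_real_def)
  ultimately show ?thesis unfolding l_def h_def by blast
qed

text \<open>If the spread is at least \<open>\<eta>\<close> at time s, then V starts below
  \<open>\<eta> powr (-d)\<close> for every e, whereas a collision forces it above
  \<open>e powr (-d) / 2\<close> on some dyadic grid. By the maximal inequality this has probability
  at most a constant times \<open>e powr d\<close>, which vanishes with e.\<close>

lemma no_collision_after:
  assumes s: "0 \<le> s" "s < T" and \<eta>: "0 < \<eta>"
  shows "{\<omega>\<in>space M. \<eta> \<le> R s \<omega> \<and> (\<exists>t\<in>{s..T}. R t \<omega> = 0)} \<in> null_sets M"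
proof -
  define A where "A = {\<omega>\<in>space (F s). \<eta> \<le> R s \<omega>}"
  have AF: "A \<in> sets (F s)" unfolding A_def using R_measurable[OF s(1)] by measurable
  then have AM: "A \<in> events" using sets_F_subset by auto
  define E where "E e N = {\<omega>\<in>A. \<exists>k\<le>2 ^ N. e powr (-d) / 2 \<le> V e (s + real k * ((T - s) / 2 ^ N)) \<omega>}" for e and N :: nat
  define B where "B e = (\<Union>N. E e N)" for e
  define C where "C = 2 * (exp (K * (T - s)) * \<eta> powr (-d))"
  have EM: "E e N \<in> events" for e N
  proof -
    have m: "{\<omega>\<in>space M. e powr (-d) / 2 \<le> V e (s + real k * ((T - s) / 2 ^ N)) \<omega>} \<in> events" for k
    proof -
      have "V e (s + real k * ((T - s) / 2 ^ N)) \<in> borel_measurable M"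
        using s by (intro borel_measurable_F[OF V_measurable]) auto
      then show ?thesis by measurable
    qed
    have "A \<inter> (\<Union>k\<in>{..2 ^ N}. {\<omega>\<in>space M. e powr (-d) / 2 \<le> V e (s + real k * ((T - s) / 2 ^ N)) \<omega>}) \<in> events"
      by (rule sets.Int[OF AM sets.finite_UN[OF finite_atMost m]])
    also have "A \<inter> (\<Union>k\<in>{..2 ^ N}. {\<omega>\<in>space M. e powr (-d) / 2 \<le> V e (s + real k * ((T - s) / 2 ^ N)) \<omega>}) = E e N"
      by (auto simp: E_def A_def)
    finally show ?thesis .
  qed
  have prob_E: "prob (E e N) \<le> C * e powr d" if e: "0 < e" for e N
  proof -
    have "e powr (-d) / 2 * prob (E e N) \<le> exp (K * (T - s)) * expectation (\<lambda>\<omega>. indicator A \<omega> * V e s \<omega>)"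
      using V_maximal[OF e s(1) _ AF, where h="(T - s) / 2 ^ N" and l="e powr (-d) / 2" and N="2 ^ N"] s by (simp add: E_def)
    also have "expectation (\<lambda>\<omega>. indicator A \<omega> * V e s \<omega>) \<le> expectation (\<lambda>_. \<eta> powr (-d))"
    proof (intro integral_mono V_integrable e s(1) AM)
      fix \<omega>
      have "(R s \<omega> + e) powr (-d) \<le> \<eta> powr (-d)" if "\<eta> \<le> R s \<omega>"
        using that e d \<eta> by (intro powr_mono2') auto
      then show "indicator A \<omega> * V e s \<omega> \<le> \<eta> powr (-d)" by (auto simp: A_def V_def indicator_def)
    qed simp
    finally have "e powr (-d) * prob (E e N) \<le> C" by (simp add: C_def prob_space)
    then have "e powr d * (e powr (-d) * prob (E e N)) \<le> e powr d * C" by (intro mult_left_mono) auto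
    moreover have "e powr d * (e powr (-d) * prob (E e N)) = prob (E e N)"
      using e by (simp add: mult.assoc[symmetric] powr_add[symmetric])
    ultimately show ?thesis by (simp add: mult.commute)
  qed
  \<comment> \<open>The dyadic grids are nested, so the bound for a single grid passes to the union
    over all of them.\<close>
  have inc: "incseq (E e)" for e
  proof (rule incseq_SucI)
    fix N
    show "E e N \<subseteq> E e (Suc N)"
    proof
      fix \<omega> assume "\<omega> \<in> E e N"
      then obtain k where k: "\<omega> \<in> A" "k \<le> 2 ^ N" "e powr (-d) / 2 \<le> V e (s + real k * ((T - s) / 2 ^ N)) \<omega>"
        by (auto simp: E_def)
      moreover have "s + real (2 * k) * ((T - s) / 2 ^ Suc N) = s + real k * ((T - s) / 2 ^ N)" by simp
      ultimately show "\<omega> \<in> E e (Suc N)" unfolding E_def by (intro CollectI conjI exI[of _ "2 * k"]) auto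
    qed
  qed
  have BM: "B e \<in> events" for e unfolding B_def using EM by auto
  have prob_B: "prob (B e) \<le> C * e powr d" if e: "0 < e" for e
  proof (rule LIMSEQ_le_const2)
    show "(\<lambda>N. prob (E e N)) \<longlonglongrightarrow> prob (B e)"
      unfolding B_def using EM inc by (intro finite_Lim_measure_incseq) auto
    show "\<exists>N0. \<forall>N\<ge>N0. prob (E e N) \<le> C * e powr d" using prob_E[OF e] by blast
  qed
  \<comment> \<open>For these e the bound C \<open>e powr d\<close> equals C / (m + 1).\<close>
  define D where "D = (\<Inter>m. B (inverse (real (Suc m)) powr (1 / d)))"
  have DM: "D \<in> events" unfolding D_def using BM by auto
  have "prob D \<le> C * inverse (real (Suc m))" for m
  proof -
    have "prob D \<le> prob (B (inverse (real (Suc m)) powr (1 / d)))"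
      by (rule finite_measure_mono) (auto simp: D_def BM)
    also have "\<dots> \<le> C * (inverse (real (Suc m)) powr (1 / d)) powr d" by (rule prob_B) simp
    finally show ?thesis using d by (simp add: powr_powr)
  qed
  moreover have "(\<lambda>m. C * inverse (real (Suc m))) \<longlonglongrightarrow> C * 0"
    by (intro tendsto_intros LIMSEQ_inverse_real_of_nat)
  ultimately have "prob D \<le> C * 0" by (intro LIMSEQ_le_const) auto
  then have "prob D = 0" using measure_nonneg[of M D] by simp
  then have "D \<in> null_sets M" using DM by (simp add: null_sets_def emeasure_eq_measure)
  moreover have "{\<omega>\<in>space M. \<eta> \<le> R s \<omega> \<and> (\<exists>t\<in>{s..T}. R t \<omega> = 0)} \<subseteq> D"
  proof safe
    fix \<omega> t assume w: "\<omega> \<in> space M" "\<eta> \<le> R s \<omega>" "t \<in> {s..T}" "R t \<omega> = 0"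
    have "\<omega> \<in> B e" if e: "0 < e" for e
      using collision_on_dyadic_grid[OF w(1) e s _ _ w(4)] w by (auto simp: B_def E_def A_def)
    then show "\<omega> \<in> D" by (simp add: D_def)
  qed
  ultimately show ?thesis by (rule null_sets_subset)
qed

lemma R_zero_event: "0 \<le> t \<Longrightarrow> {\<omega>\<in>space M. R t \<omega> = 0} \<in> events"
  using borel_measurable_F[OF R_measurable[of t]] by measurable

text \<open>A path with positive spread at time s almost surely does not collide up to time t, so a
  collision at t is almost surely also one at s. Letting \<open>\<eta>\<close> run through 1 / (m +
  1) exhausts the positive values of the spread.\<close>

lemma prob_zero_antimono:
  assumes "0 \<le> s" "s < t"
  shows "prob {\<omega>\<in>space M. R t \<omega> = 0} \<le> prob {\<omega>\<in>space M. R s \<omega> = 0}"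
proof (rule finite_measure_mono_AE)
  have "AE \<omega> in M. \<forall>m. \<not> (inverse (real (Suc m)) \<le> R s \<omega> \<and> (\<exists>u\<in>{s..t}. R u \<omega> = 0))"
  proof (subst AE_all_countable, intro allI)
    fix m
    from AE_not_in[OF no_collision_after[OF assms, of "inverse (real (Suc m))"]]
    show "AE \<omega> in M. \<not> (inverse (real (Suc m)) \<le> R s \<omega> \<and> (\<exists>u\<in>{s..t}. R u \<omega> = 0))"
      by (rule AE_mp) (auto intro!: AE_I2)
  qed
  then show "AE \<omega> in M. \<omega> \<in> {\<omega>\<in>space M. R t \<omega> = 0} \<longrightarrow> \<omega> \<in> {\<omega>\<in>space M. R s \<omega> = 0}"
  proof eventually_elim
    case (elim \<omega>)
    show ?case
    proof safe
      assume 0: "R t \<omega> = 0"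
      show "R s \<omega> = 0"
      proof (rule ccontr)
        assume "R s \<omega> \<noteq> 0"
        then have "0 < R s \<omega>" using R_nonneg[of s \<omega>] by simp
        then obtain m where "inverse (real (Suc m)) < R s \<omega>" using reals_Archimedean by blast
        then show False using elim 0 assms by (metis atLeastAtMost_iff less_imp_le order.refl)
      qed
    qed
  qed
qed (use assms in \<open>auto intro: R_zero_event\<close>)

text \<open>Monotonicity makes P(R t = 0) a lower bound for the killing probability on all of [0,
  t). The accumulated killing is of order \<open>e powr (-d - 1)\<close>, but V is at most
  \<open>e powr (-d)\<close> at time 0 even if the particles start together; the quotient tends to 0
  with e.\<close>

lemma prob_zero:
  assumes t: "0 < t"
  shows "prob {\<omega>\<in>space M. R t \<omega> = 0} = 0"
proof -
  define p where "p = prob {\<omega>\<in>space M. R t \<omega> = 0}"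
  have p: "0 \<le> p" by (simp add: p_def)
  have bound: "d * c * t * p \<le> exp (K * t) * e" if e: "0 < e" for e
  proof -
    have "space M \<in> sets (F 0)" using sets.top[of "F 0"] by simp
    then have "expectation (\<lambda>\<omega>. indicator (space M) \<omega> * V e t \<omega>) + d * c * e powr (-d - 1) * (t - 0) * p \<le>
      exp (K * (t - 0)) * expectation (\<lambda>\<omega>. indicator (space M) \<omega> * V e 0 \<omega>)"
      by (intro multi_step e p t) (auto simp: p_def intro: prob_zero_antimono)
    moreover have "0 \<le> expectation (\<lambda>\<omega>. indicator (space M) \<omega> * V e t \<omega>)"
      using V_bounds[OF e] by (simp add: integral_nonneg_AE)
    ultimately have "d * c * e powr (-d - 1) * t * p \<le> exp (K * t) * expectation (\<lambda>\<omega>. indicator (space M) \<omega> * V e 0 \<omega>)"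
      by simp
    also have "expectation (\<lambda>\<omega>. indicator (space M) \<omega> * V e 0 \<omega>) \<le> expectation (\<lambda>_. e powr (-d))"
      by (intro integral_mono V_integrable e) (use V_bounds[OF e] in \<open>auto simp: indicator_def\<close>)
    finally have "d * c * e powr (-d - 1) * t * p \<le> exp (K * t) * e powr (-d)" by (simp add: prob_space)
    then have "e powr (d + 1) * (d * c * e powr (-d - 1) * t * p) \<le> e powr (d + 1) * (exp (K * t) * e powr (-d))"
      by (intro mult_left_mono) auto
    moreover have "e powr (d + 1) * (d * c * e powr (-d - 1) * t * p) = (e powr (d + 1) * e powr (-d - 1)) * (d * c * t * p)"
      by (simp only: mult_ac)
    moreover have "e powr (d + 1) * e powr (-d - 1) = 1" using e by (simp add: powr_add[symmetric])
    moreover have "e powr (d + 1) * (exp (K * t) * e powr (-d)) = exp (K * t) * (e powr (d + 1) * e powr (-d))"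
      by (simp only: mult_ac)
    moreover have "e powr (d + 1) * e powr (-d) = e" using e by (simp add: powr_add[symmetric])
    ultimately show ?thesis by simp
  qed
  have "d * c * t * p \<le> 0"
  proof (rule field_le_epsilon)
    fix r :: real assume "0 < r"
    then show "d * c * t * p \<le> 0 + r" using bound[of "r / exp (K * t)"] by simp
  qed
  moreover have "0 < d * c * t" using d c_pos t by simp
  ultimately have "p \<le> 0" using mult_pos_pos[of "d * c * t" p] by linarith
  with p have "p = 0" by linarith
  then show ?thesis by (simp add: p_def)
qed

text \<open>A collision at t > 0 comes after some time \<epsilon> m. Either the spread vanishes at
  \<epsilon> m, excluded by \<open>prob_zero\<close>, or it is positive there, excluded by
  \<open>no_collision_after\<close>. Countably many choices of starting time, threshold and horizon
  suffice.\<close>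

lemma no_collision: "{\<omega>\<in>space M. \<exists>t>0. R t \<omega> = 0} \<in> null_sets M"
proof -
  define \<epsilon> where "\<epsilon> m = inverse (real (Suc m))" for m
  have \<epsilon>: "0 < \<epsilon> m" for m by (simp add: \<epsilon>_def)
  have small: "\<exists>m. \<epsilon> m < x" if "0 < x" for x using reals_Archimedean[OF that] by (simp add: \<epsilon>_def)
  define Z where "Z m = {\<omega>\<in>space M. R (\<epsilon> m) \<omega> = 0}" for m
  \<comment> \<open>The horizon exceeds every given t for large k; the summand 1 keeps the time
    interval nondegenerate for k = 0.\<close>
  define S where "S m l k = {\<omega>\<in>space M. \<epsilon> l \<le> R (\<epsilon> m) \<omega> \<and> (\<exists>t\<in>{\<epsilon> m..\<epsilon> m + (1 + real k)}. R t \<omega> = 0)}" for m l k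
  have "Z m \<in> null_sets M" for m
    using prob_zero[OF \<epsilon>, of m] R_zero_event[of "\<epsilon> m"] \<epsilon>[of m]
    by (simp add: Z_def null_sets_def emeasure_eq_measure)
  moreover have "S m l k \<in> null_sets M" for m l k
    unfolding S_def using \<epsilon>[of m] by (intro no_collision_after \<epsilon>) auto
  ultimately have "(\<Union>m. Z m) \<union> (\<Union>m. \<Union>l. \<Union>k. S m l k) \<in> null_sets M" by (intro null_sets.Un null_sets_UN) auto
  moreover have "{\<omega>\<in>space M. \<exists>t>0. R t \<omega> = 0} \<subseteq> (\<Union>m. Z m) \<union> (\<Union>m. \<Union>l. \<Union>k. S m l k)"
  proof safe
    fix \<omega> t assume w: "\<omega> \<in> space M" "0 < t" "R t \<omega> = 0" and n: "\<omega> \<notin> (\<Union>m. \<Union>l. \<Union>k. S m l k)"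
    obtain m where m: "\<epsilon> m < t" using small[OF w(2)] by blast
    show "\<omega> \<in> (\<Union>m. Z m)"
    proof (cases "R (\<epsilon> m) \<omega> = 0")
      case True
      then show ?thesis using w by (auto simp: Z_def)
    next
      case False
      then have "0 < R (\<epsilon> m) \<omega>" using R_nonneg[of "\<epsilon> m" \<omega>] by simp
      then obtain l where l: "\<epsilon> l < R (\<epsilon> m) \<omega>" using small by blast
      obtain k :: nat where "t \<le> real k" using real_arch_simple by blast
      then have "t \<in> {\<epsilon> m..\<epsilon> m + (1 + real k)}" using m \<epsilon>[of m] by auto
      then have "\<omega> \<in> S m l k" using w l by (auto simp: S_def)
      then show ?thesis using n by blast
    qed
  qed
  ultimately show ?thesis by (rule null_sets_subset)
qed

end

section \<open>Competing Brownian particles\<close>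

text \<open>The ranking is a bijection, so exactly one rank belongs to particle i. Bounds on the
  sequence c thus become bounds on the coefficient process.\<close>

lemma rank_coeff_eq:
  assumes "rankable (\<lambda>i. X i t \<omega>)"
  shows "\<exists>k. rank_coeff X c i t \<omega> = c k"
proof -
  obtain p where p: "is_ranking (\<lambda>i. X i t \<omega>) p" using assms by (auto simp: rankable_def)
  have r: "ranking (\<lambda>i. X i t \<omega>) = p" by (rule ranking_eqI[OF p])
  have "bij p" using p by (simp add: is_ranking_def)
  then obtain k where k: "p k = i" by (metis bij_pointE)
  have uniq: "l = k" if "p l = i" for l using that k \<open>bij p\<close> by (metis bij_pointE)
  have "rank_coeff X c i t \<omega> = (\<Sum>l. of_bool (p l = i) * c l)"
    by (simp add: rank_coeff_def has_rank_def r)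
  also have "\<dots> = (\<Sum>l\<in>{k}. of_bool (p l = i) * c l)"
    by (rule suminf_finite) (use uniq in auto)
  also have "\<dots> = c k" by (simp add: k)
  finally show ?thesis by blast
qed

lemma set_integral_increment_bound:
  fixes f :: "real \<Rightarrow> real"
  assumes int: "set_integrable lborel {0..t} f" and st: "0 \<le> s" "s \<le> t"
    and G: "\<And>u. 0 \<le> u \<Longrightarrow> \<bar>f u\<bar> \<le> G"
  shows "\<bar>(LINT u:{0..t}|lborel. f u) - (LINT u:{0..s}|lborel. f u)\<bar> \<le> G * (t - s)"
proof -
  have i1: "set_integrable lborel {0..s} f" and i2: "set_integrable lborel {s<..t} f"
    using st by (auto intro: set_integrable_subset[OF int])
  have "{0..t} = {0..s} \<union> {s<..t}" "{0..s} \<inter> {s<..t} = {}" using st by auto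
  then have "(LINT u:{0..t}|lborel. f u) = (LINT u:{0..s}|lborel. f u) + (LINT u:{s<..t}|lborel. f u)"
    using set_integral_Un[OF _ i1 i2] by simp
  moreover have "\<bar>LINT u:{s<..t}|lborel. f u\<bar> \<le> G * (t - s)"
  proof -
    have "\<bar>LINT u:{s<..t}|lborel. f u\<bar> \<le> (\<integral>u. \<bar>indicator {s<..t} u * f u\<bar> \<partial>lborel)"
      unfolding set_lebesgue_integral_def by (simp add: integral_abs_bound)
    also have "\<dots> \<le> (\<integral>u. G * indicator {s<..t} u \<partial>lborel)"
    proof (rule integral_mono)
      show "integrable lborel (\<lambda>u. \<bar>indicator {s<..t} u * f u\<bar>)"
        using i2 by (intro integrable_abs) (simp add: set_integrable_def)
      show "integrable lborel (\<lambda>u. G * indicator {s<..t} u)" using st by simp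
      show "\<bar>indicator {s<..t} u * f u\<bar> \<le> G * indicator {s<..t} u" for u
        using G[of u] st by (auto simp: indicator_def)
    qed
    also have "\<dots> = G * (t - s)" using st by simp
    finally show ?thesis .
  qed
  ultimately show ?thesis by simp
qed

theorem theorem4p2:
  fixes M :: "'a measure" and F :: "real \<Rightarrow> 'a measure"
    and g \<sigma> x :: "nat \<Rightarrow> real"
    and W X :: "nat \<Rightarrow> real \<Rightarrow> 'a \<Rightarrow> real" and n :: nat
  assumes "\<And>k. \<sigma> k > 0"
    and "competing_brownian_particles M F g \<sigma> W X"
    and "bdd_above (range (\<lambda>k. \<bar>g k\<bar>))"
    and "bdd_above (range (\<lambda>k. (\<sigma> k)\<^sup>2))"
    and "AE \<omega> in M. \<forall>i. X i 0 \<omega> = x i"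
    and "\<And>\<alpha>. \<alpha> > 0 \<Longrightarrow> summable (\<lambda>i. exp (- \<alpha> * (x i)\<^sup>2))"
    and "n \<ge> 4"
    and "(SUP k. (\<sigma> k)\<^sup>2) < (real n - 1) / 2 * (INF k. (\<sigma> k)\<^sup>2)"
  shows "no_tuple_collisions M n X"
proof -
  note cbp = assms(2)[unfolded competing_brownian_particles_def]
  interpret usual_filtration M F using cbp by blast
  have bm: "brownian_motion M F (W i)" for i using cbp by blast
  have ind: "independent_processes M W" using cbp by blast
  have X: "adapted F (X i)" "continuous_paths M (X i)" for i using cbp by blast+
  have rank: "AE \<omega> in M. \<forall>t\<ge>0. rankable (\<lambda>i. X i t \<omega>)" using cbp by blast
  have "\<forall>i. \<exists>I. ito_integral M F (rank_coeff X \<sigma> i) (W i) I \<and>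
        (AE \<omega> in M. \<forall>t\<ge>0.
           set_integrable lborel {0..t} (\<lambda>s. rank_coeff X g i s \<omega>) \<and>
           X i t \<omega> = X i 0 \<omega> + (LINT s:{0..t}|lborel. rank_coeff X g i s \<omega>) + I t \<omega>)"
    using cbp by blast
  then obtain I where I: "\<forall>i. ito_integral M F (rank_coeff X \<sigma> i) (W i) (I i) \<and>
        (AE \<omega> in M. \<forall>t\<ge>0.
           set_integrable lborel {0..t} (\<lambda>s. rank_coeff X g i s \<omega>) \<and>
           X i t \<omega> = X i 0 \<omega> + (LINT s:{0..t}|lborel. rank_coeff X g i s \<omega>) + I i t \<omega>)"
    by (rule choice[THEN exE])
  have ito: "ito_integral M F (rank_coeff X \<sigma> i) (W i) (I i)" for i using I by blast
  have eq: "AE \<omega> in M. \<forall>t\<ge>0. set_integrable lborel {0..t} (\<lambda>s. rank_coeff X g i s \<omega>) \<and>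
      X i t \<omega> = X i 0 \<omega> + (LINT s:{0..t}|lborel. rank_coeff X g i s \<omega>) + I i t \<omega>" for i
    using I by blast
  define up lo where "up = (SUP k. (\<sigma> k)\<^sup>2)" and "lo = (INF k. (\<sigma> k)\<^sup>2)"
  \<comment> \<open>The integrands are the \<sigma>'s themselves, so their range is bounded by the
    square roots.\<close>
  define a b where "a = sqrt lo" and "b = sqrt up"
  have up: "(\<sigma> k)\<^sup>2 \<le> up" for k unfolding up_def by (rule cSUP_upper[OF UNIV_I assms(4)])
  have lo: "lo \<le> (\<sigma> k)\<^sup>2" for k
    unfolding lo_def by (rule cINF_lower[OF bdd_belowI2[of _ 0] UNIV_I]) simp
  have up_pos: "0 < up" using up[of 0] assms(1)[of 0] by (meson less_le_trans zero_less_power)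
  have n: "2 \<le> real n - 1" using assms(7) by simp
  have gap: "2 * up < (real n - 1) * lo" using assms(8) by (simp add: up_def lo_def)
  \<comment> \<open>The strict gap condition forces the infimum to be positive.\<close>
  then have "0 < (real n - 1) * lo" using up_pos by linarith
  then have lo_pos: "0 < lo" using n by (simp add: zero_less_mult_iff)
  have ab: "0 \<le> a" "a \<le> b" "a\<^sup>2 = lo" "b\<^sup>2 = up"
    using lo_pos up_pos order.trans[OF lo up] by (auto simp: a_def b_def)
  have \<sigma>: "a \<le> \<sigma> k" "\<sigma> k \<le> b" for k
    using assms(1)[of k] lo[of k] up[of k]
    by (auto simp: a_def b_def intro: real_le_rsqrt real_le_lsqrt)
  obtain G where G: "\<And>k. \<bar>g k\<bar> \<le> G" using assms(3) by (auto simp: bdd_above_def)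
  have G0: "0 \<le> G" using G[of 0] by linarith
  have H: "AE \<omega> in M. \<forall>u\<ge>0. a \<le> rank_coeff X \<sigma> i u \<omega> \<and> rank_coeff X \<sigma> i u \<omega> \<le> b" for i
    using rank
  proof eventually_elim
    case (elim \<omega>)
    show ?case
    proof (intro allI impI)
      fix u :: real assume "0 \<le> u"
      with elim have "rankable (\<lambda>i. X i u \<omega>)" by simp
      from rank_coeff_eq[where X=X, OF this] obtain k where "rank_coeff X \<sigma> i u \<omega> = \<sigma> k" by (rule exE)
      then show "a \<le> rank_coeff X \<sigma> i u \<omega> \<and> rank_coeff X \<sigma> i u \<omega> \<le> b" using \<sigma>[of k] by simp
    qed
  qed
  have drift: "AE \<omega> in M. \<bar>X i t \<omega> - X i s \<omega> - (I i t \<omega> - I i s \<omega>)\<bar> \<le> G * (t - s)" if st: "0 \<le> s" "s \<le> t" for i s t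
    using rank eq[of i]
  proof eventually_elim
    case (elim \<omega>)
    have "\<bar>rank_coeff X g i u \<omega>\<bar> \<le> G" if "0 \<le> u" for u
    proof -
      have "rankable (\<lambda>i. X i u \<omega>)" using elim(1) that by simp
      from rank_coeff_eq[where X=X, OF this] obtain k where "rank_coeff X g i u \<omega> = g k" by (rule exE)
      then show ?thesis using G by simp
    qed
    moreover have "0 \<le> t" using st by simp
    with elim(2) have t: "set_integrable lborel {0..t} (\<lambda>s. rank_coeff X g i s \<omega>)"
      "X i t \<omega> = X i 0 \<omega> + (LINT s:{0..t}|lborel. rank_coeff X g i s \<omega>) + I i t \<omega>" by blast+
    ultimately have "\<bar>(LINT u:{0..t}|lborel. rank_coeff X g i u \<omega>) - (LINT u:{0..s}|lborel. rank_coeff X g i u \<omega>)\<bar> \<le> G * (t - s)"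
      by (intro set_integral_increment_bound st) auto
    moreover have "X i s \<omega> = X i 0 \<omega> + (LINT s:{0..s}|lborel. rank_coeff X g i s \<omega>) + I i s \<omega>"
      using elim(2) st(1) by blast
    ultimately show ?case unfolding t(2) by simp
  qed
  \<comment> \<open>With this choice 2 (1 + d) \<open>up\<close> is the midpoint between 2
    \<open>up\<close> and (n - 1) \<open>lo\<close>.\<close>
  define d where "d = ((real n - 1) * lo - 2 * up) / (4 * up)"
  have d: "0 < d" using gap up_pos by (simp add: d_def)
  have gap': "2 * (1 + d) * up < (real n - 1) * lo"
  proof -
    define Q where "Q = (real n - 1) * lo"
    have "d * up = (Q - 2 * up) / 4" using up_pos by (simp add: d_def Q_def)
    moreover have "2 * (1 + d) * up = 2 * up + 2 * (d * up)" by (simp add: algebra_simps)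
    ultimately have "2 * (1 + d) * up < Q" using gap unfolding Q_def[symmetric] by simp
    then show ?thesis by (simp only: Q_def)
  qed
  have cluster: "{\<omega>\<in>space M. \<exists>t>0. spread J (\<lambda>i. X i t \<omega>) = 0} \<in> null_sets M" if J: "finite J" "card J = n" for J
  proof -
    note mom = ito_increment_moments[OF bm ito ab(1,2) H]
    have "J \<noteq> {}" using J assms(7) by auto
    interpret C: particle_cluster M F J X I G a b d
    proof (unfold_locales, goal_cases)
      case (7 i s t)
      then show ?case by (intro drift)
    next
      case (8 i s t)
      then show ?case by (intro mom(1))
    next
      case (9 i s t)
      then show ?case by (intro mom(2))
    next
      case (10 i s t \<zeta> B)
      then show ?case by (intro mom(3)[where \<zeta>=\<zeta> and B=B])
    next
      case (11 i s t \<zeta> B)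
      then show ?case by (intro mom(4)[where \<zeta>=\<zeta> and B=B])
    next
      case (12 i s t \<zeta> B)
      then show ?case by (intro mom(5)[where \<zeta>=\<zeta> and B=B])
    next
      case (13 i j s t \<zeta> B)
      then show ?case
        using ito_increments_uncorrelated[OF bm ind _ ito ito ab(1,2) H H] by blast
    next
      case 14
      show ?case using gap' by (simp add: ab J)
    qed (rule J \<open>J \<noteq> {}\<close> G0 d X)+
    show ?thesis using C.no_collision by (simp add: C.R_def)
  qed
  obtain N0 where N0: "{\<omega>\<in>space M. \<not> (\<forall>t\<ge>0. rankable (\<lambda>i. X i t \<omega>))} \<subseteq> N0" "N0 \<in> null_sets M"
    using rank by (rule AE_E3) blast
  \<comment> \<open>Which particles occupy given ranks is random, so the exceptional set takes in
    all of the countably many clusters of n names, and the paths that cannot be ranked.\<close>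
  define N where "N = N0 \<union> (\<Union>J\<in>{J. finite J \<and> card J = n}. {\<omega>\<in>space M. \<exists>t>0. spread J (\<lambda>i. X i t \<omega>) = 0})"
  have "countable {J :: nat set. finite J \<and> card J = n}"
    by (rule countable_subset[OF _ countable_Collect_finite]) auto
  then have N: "N \<in> null_sets M"
    unfolding N_def using cluster by (intro null_sets.Un N0(2) null_sets_UN') auto
  show ?thesis
    unfolding no_tuple_collisions_def
  proof (intro allI impI)
    fix k l :: nat assume kl: "k < l \<and> l - k = n - 1"
    have "{\<omega>\<in>space M. \<exists>t>0. \<forall>j\<in>{k..l}. ranked X j t \<omega> = ranked X k t \<omega>} \<subseteq> N"
    proof safe
      fix \<omega> t assume w: "\<omega> \<in> space M" "0 < t" and coll: "\<forall>j\<in>{k..l}. ranked X j t \<omega> = ranked X k t \<omega>"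
      show "\<omega> \<in> N"
      proof (cases "\<forall>t\<ge>0. rankable (\<lambda>i. X i t \<omega>)")
        case False
        then show ?thesis using w N0(1) by (auto simp: N_def)
      next
        case True
        moreover have "0 \<le> t" using w by simp
        ultimately have "rankable (\<lambda>i. X i t \<omega>)" by blast
        then obtain p where p: "is_ranking (\<lambda>i. X i t \<omega>) p" by (auto simp: rankable_def)
        have r: "ranking (\<lambda>i. X i t \<omega>) = p" by (rule ranking_eqI[OF p])
        \<comment> \<open>The names of the particles that hold the ranks k to l at the collision
          time; there are l - k + 1 = n of them since p is injective.\<close>
        define J where "J = p ` {k..l}"
        have "inj p" using p by (simp add: is_ranking_def bij_is_inj)
        then have "card J = card {k..l}" unfolding J_def by (intro card_image) (auto simp: inj_on_def)
        also have "\<dots> = n" using kl assms(7) by auto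
        finally have J: "card J = n" "finite J" "J \<noteq> {}" using kl by (auto simp: J_def)
        have "spread J (\<lambda>i. X i t \<omega>) = 0"
          by (rule spread_eq_0[OF J(2,3)]) (use coll in \<open>auto simp: J_def ranked_def r\<close>)
        then show ?thesis using w J by (auto simp: N_def)
      qed
    qed
    then show "{\<omega>\<in>space M. \<exists>t>0. \<forall>j\<in>{k..l}. ranked X j t \<omega> = ranked X k t \<omega>} \<in> null_sets M"
      by (rule null_sets_subset[OF N])
  qed
qed

end
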